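(* Let $h,k\ge1$ be integers with $(h,k)=1$ and let $a\in\mathbb{C}$ with $|\Re(a)|<1$. Then $$\frac{1+a}{2\pi}\int_{-\infty}^\infty\zeta\Big(\frac12+\frac a2+it\Big)\zeta\Big(\frac12+\frac a2-it\Big)\Big(\frac hk\Big)^{-it}\frac{dt}{(\frac12+\frac a2+it)(\frac12+\frac a2-it)}$$ $$=-\frac{\zeta(1+a)}{2}\Big(\Big(\frac kh\Big)^{\frac12+\frac a2}+\Big(\frac hk\Big)^{\frac12+\frac a2}\Big)+\frac{\zeta(a)}{a}\Big(\Big(\frac kh\Big)^{\frac12-\frac a2}+\Big(\frac hk\Big)^{\frac12-\frac a2}\Big)-\Big(\frac{1}{hk}\Big)^{\frac12+\frac a2}(2\pi)^a\Gamma(-a)\sin\frac{\pi a}{2}\Big(c_a\Big(\frac{\overline h}{k}\Big)+c_a\Big(\frac{\overline k}{h}\Big)\Big).$$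
   Context: For a rational $x=h/k$ with $(h,k)=1$, $k>0$, $c_a(h/k):=k^a\sum_{m=1}^{k-1}\cot(\pi mh/k)\,\zeta(-a,m/k)$, where $\zeta(s,x)$ is the Hurwitz zeta function (an empty sum, i.e. $k=1$, gives $0$). Here $\overline h$ denotes an integer with $h\overline h\equiv1\pmod k$ and $\overline k$ an integer with $k\overline k\equiv 1\pmod h$ ($c_a$ is $1$-periodic so the choice does not matter). The equality is an identity between meromorphic functions of $a$ in the strip (at $a=0$ understood as a limit).
   Formalization: The sign of the ζ(a)/a term is corrected from plus to minus: the printed formula fails, e.g. for h=k=1, a=1/2, where the left side is positive and the printed right side is negative. *)

theory Defs
  imports "HOL-Complex_Analysis.Complex_Analysis" "HOL-Number_Theory.Cong"
begin

text \<open>The Hurwitz zeta function \<open>\<zeta>(s, x)\<close>, for real \<open>x > 0\<close>, is the analytic continuation to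
  \<open>\<complex> - {1}\<close> of \<open>\<Sum>n\<ge>0. (n + x)\<^bsup>-s\<^esup>\<close>. The value \<open>0\<close> at the pole only makes the description
  unique.\<close>

definition hurwitz_zeta :: "real \<Rightarrow> complex \<Rightarrow> complex" where
  "hurwitz_zeta x = (THE f. f holomorphic_on (- {1}) \<and> f 1 = 0 \<and>
     (\<forall>s. Re s > 1 \<longrightarrow> (\<lambda>n. (of_nat n + of_real x) powr (- s)) sums f s))"

definition zeta :: "complex \<Rightarrow> complex" where
  "zeta = hurwitz_zeta 1"

definition cot_sum :: "complex \<Rightarrow> rat \<Rightarrow> complex" where
  "cot_sum a x = (case quotient_of x of (h, k) \<Rightarrow>
     of_int k powr a *
       (\<Sum>m = 1..k - 1. of_real (cot (pi * of_int m * of_int h / of_int k)) *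
          hurwitz_zeta (of_int m / of_int k) (- a)))"

definition twisted_integrand :: "nat \<Rightarrow> nat \<Rightarrow> complex \<Rightarrow> real \<Rightarrow> complex" where
  "twisted_integrand h k a t =
     zeta (1/2 + a/2 + \<i> * of_real t) * zeta (1/2 + a/2 - \<i> * of_real t) *
     (of_nat h / of_nat k) powr (- (\<i> * of_real t)) /
     ((1/2 + a/2 + \<i> * of_real t) * (1/2 + a/2 - \<i> * of_real t))"

definition twisted_moment :: "nat \<Rightarrow> nat \<Rightarrow> complex \<Rightarrow> complex" where
  "twisted_moment h k a =
     (1 + a) / of_real (2 * pi) * (LINT t|lborel. twisted_integrand h k a t)"

text \<open>\<open>h'\<close> and \<open>k'\<close> stand for the inverses of \<open>h\<close> modulo \<open>k\<close> and of \<open>k\<close> modulo \<open>h\<close>.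

  The sign of the \<open>\<zeta>(a)/a\<close> term is minus. With a plus sign, as in the printed formula, the
  expression has a pole at \<open>a = 0\<close>, while the integral is holomorphic there; already for
  \<open>h = k = 1\<close> the integral side is
  \<open>(1 + a) * \<integral>x\<in>{0..}. (frac x)\<^sup>2 * x\<^bsup>-2-a\<^esup> = - \<zeta>(1 + a) - 2 * \<zeta>(a) / a\<close>.\<close>

definition moment_formula :: "nat \<Rightarrow> nat \<Rightarrow> int \<Rightarrow> int \<Rightarrow> complex \<Rightarrow> complex" where
  "moment_formula h k h' k' a =
     - (zeta (1 + a) / 2) *
         ((of_nat k / of_nat h) powr (1/2 + a/2) + (of_nat h / of_nat k) powr (1/2 + a/2))
     - zeta a / a *
         ((of_nat k / of_nat h) powr (1/2 - a/2) + (of_nat h / of_nat k) powr (1/2 - a/2))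
     - (1 / (of_nat h * of_nat k)) powr (1/2 + a/2) * of_real (2 * pi) powr a *
         Gamma (- a) * sin (of_real pi * a / 2) *
         (cot_sum a (Fract h' (int k)) + cot_sum a (Fract k' (int h)))"

end

theory Submission
  imports Defs "HOL-Probability.Probability" "HOL-Real_Asymp.Real_Asymp"
begin

text \<open>
  For \<open>0 < Re s < 1\<close> one has \<open>- \<zeta>(s) / s = \<integral>u. frac (e\<^bsup>u\<^esup>) e\<^bsup>-su\<^esup>\<close> over the real line, so the twisted integrand
  is a product of two Fourier transforms and Parseval turns its integral into
  \<open>2\<pi> (hk)\<^bsup>-(1+a)/2\<^esup> \<integral>v. frac (he\<^bsup>v\<^esup>) frac (ke\<^bsup>v\<^esup>) e\<^bsup>-(1+a)v\<^esup>\<close>.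
  Cutting this integral off at \<open>v = ln N\<close> and expanding the fractional parts gives finite power sums,
  whose asymptotics for \<open>N \<rightarrow> \<infinity>\<close> produce \<open>\<zeta>(a)\<close>, \<open>\<zeta>(1 + a)\<close> and the sums of
  \<open>frac (kr/h) \<zeta>(1 + a, r/h)\<close> over \<open>r < h\<close>, together with their mirror image in \<open>h, k\<close>.
  The odd part of Hurwitz's formula rewrites \<open>\<zeta>(1 + a, r/h) - \<zeta>(1 + a, 1 - r/h)\<close> through
  \<open>\<zeta>(- a, n/h)\<close>, and the finite Fourier expansion of the sawtooth function turns the result into cotangent sums.
  The value at \<open>a = 0\<close> follows because the integral is continuous there.
\<close>

section \<open>The Hurwitz zeta function\<close>

text \<open>Zeta values enter as limits of finite sums with explicit counterterms, because the
  cut-off moment is itself a finite sum; the powers of \<open>N\<close> then cancel identically,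
  without estimates. As \<open>Re a\<close> may be negative, \<open>zeta a\<close> needs such a
  limit formula for \<open>Re s > -1\<close>, where a term \<open>N powr (- s) / 2\<close> survives.
  The obstacle in Parseval is that \<open>frac (exp u)\<close> jumps, so the Fourier transform of
  the function involved is not absolutely integrable. Hence the detour through square integrability
  and Gaussian damping; the values at the jumps do not matter because the jumps are countable. Only
  the odd part of Hurwitz's formula enters, because \<open>frac\<close> takes values adding up to 1
  at \<open>r\<close> and \<open>h - r\<close>: the even part of the residue sum is a plain sum of
  zeta values over all residues, hence a multiple of \<open>zeta (1 + a)\<close>. The odd part comes
  from evaluating one Mellin integral in two ways for real \<open>0 < s < 1\<close>, followed by
  analytic continuation.\<close>

text \<open>Remainder of the Taylor polynomial of degree \<open>p\<close> of
  \<open>z powr (1 - s)\<close> at \<open>u\<close>, evaluated one unit further on. It decays like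
  \<open>u powr (- Re s - p)\<close>, so raising \<open>p\<close> by one moves the abscissa of
  convergence of its sum over \<open>n\<close> one unit to the left.\<close>

definition powr_rem :: "nat \<Rightarrow> real \<Rightarrow> complex \<Rightarrow> complex" where
  "powr_rem p u s = of_real (u + 1) powr (1 - s) -
     (\<Sum>i\<le>p. ((1 - s) gchoose i) * of_real u powr (1 - s - of_nat i))"

lemma gbinomial_Suc_eq:
  fixes a :: "'a :: field_char_0"
  shows "(a gchoose Suc i) = (a gchoose i) * (a - of_nat i) / of_nat (Suc i)"
proof -
  have "(of_nat (Suc i) :: 'a) \<noteq> 0" by (rule of_nat_neq_0)
  then show ?thesis
    unfolding gbinomial_prod_rev fact_Suc prod.atLeast0_lessThan_Suc
    by (simp add: divide_simps mult_ac del: of_nat_Suc)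
qed

text \<open>Taylor's estimate on the segment from \<open>u\<close> to \<open>u + 1\<close>: the
  derivative of order \<open>p + 1\<close> is a multiple of \<open>z powr (- s - p)\<close>, largest
  at \<open>u\<close> because \<open>Re s + p \<ge> 0\<close>. The factor \<open>p + 1\<close> is
  \<open>fact (Suc p)\<close> from the derivative over \<open>fact p\<close> from the complex Taylor
  bound.\<close>

lemma norm_powr_rem_le:
  assumes "u > 0" "Re s + p \<ge> 0"
  shows "norm (powr_rem p u s) \<le> (p + 1) * norm ((1 - s) gchoose Suc p) * u powr (- Re s - p)"
proof -
  define S where "S = complex_of_real ` {u..u+1}"
  define f where "f = (\<lambda>i (z::complex). fact i * ((1 - s) gchoose i) * z powr (1 - s - of_nat i))"
  define B where "B = norm (fact (Suc p) * ((1 - s) gchoose Suc p)) * u powr (- Re s - p)"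
  have "cmod (f 0 (of_real (u+1)) - (\<Sum>i\<le>p. f i (of_real u) * (of_real (u+1) - of_real u) ^ i / fact i))
        \<le> B * cmod (of_real (u+1) - of_real u) ^ Suc p / fact p"
  proof (rule complex_Taylor[of S p f B])
    show "convex S" unfolding S_def by (intro convex_linear_image) (auto simp: linear_iff scaleR_conv_of_real)
    fix i x assume x: "x \<in> S"
    then obtain v where v: "x = of_real v" "v \<ge> u" by (auto simp: S_def)
    have "(f i has_field_derivative fact i * ((1 - s) gchoose i) * ((1 - s - of_nat i) * x powr (1 - s - of_nat i - 1))) (at x)"
      unfolding f_def using v assms
      by (intro DERIV_cmult has_field_derivative_powr) (auto simp: complex_nonpos_Reals_iff)
    also have "fact i * ((1 - s) gchoose i) * ((1 - s - of_nat i) * x powr (1 - s - of_nat i - 1)) = f (Suc i) x"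
    proof -
      have "fact (Suc i) * ((1 - s) gchoose Suc i) = fact i * ((1 - s) gchoose i) * (1 - s - of_nat i)"
        unfolding gbinomial_Suc_eq fact_Suc using of_nat_neq_0[of i, where 'a = complex]
        by (simp add: mult_ac del: of_nat_Suc)
      moreover have "(1 - s - of_nat i - 1) = 1 - s - of_nat (Suc i)" by simp
      ultimately show ?thesis by (simp only: f_def mult.assoc[symmetric])
    qed
    finally show "(f i has_field_derivative f (Suc i) x) (at x within S)"
      by (rule has_field_derivative_at_within)
  next
    fix x assume "x \<in> S"
    then obtain v where v: "x = of_real v" "v \<ge> u" by (auto simp: S_def)
    have "cmod (x powr (1 - s - of_nat (Suc p))) = v powr (- Re s - p)"
      using v assms by (simp add: norm_powr_real_powr)
    also have "\<dots> \<le> u powr (- Re s - p)"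
      using v assms by (intro powr_mono2') auto
    finally show "cmod (f (Suc p) x) \<le> B"
      unfolding f_def B_def norm_mult by (intro mult_left_mono) auto
  next
    show "of_real u \<in> S" "of_real (u + 1) \<in> S" by (auto simp: S_def simp del: of_real_add)
  qed
  also have "(\<Sum>i\<le>p. f i (of_real u) * (of_real (u+1) - of_real u) ^ i / fact i) =
             (\<Sum>i\<le>p. ((1 - s) gchoose i) * of_real u powr (1 - s - of_nat i))"
    by (intro sum.cong) (auto simp: f_def)
  also have "f 0 (of_real (u+1)) - \<dots> = powr_rem p u s"
    by (simp add: f_def powr_rem_def)
  also have "B * cmod (of_real (u+1) - of_real u) ^ Suc p / fact p =
     (real p + 1) * norm ((1 - s) gchoose Suc p) * u powr (- Re s - p)"
    using norm_of_nat[of "Suc p", where 'a = complex] by (simp add: B_def norm_mult add_ac)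
  finally show ?thesis .
qed

lemma summable_shift_powr:
  assumes "x > 0" "r > 1"
  shows "summable (\<lambda>n. (real n + x) powr - r)"
proof (rule summable_comparison_test_ev)
  show "eventually (\<lambda>n. norm ((real n + x) powr - r) \<le> real n powr - r) sequentially"
    using eventually_gt_at_top[of 0]
    by eventually_elim (use assms in \<open>auto intro!: powr_mono2'\<close>)
  show "summable (\<lambda>n. real n powr - r)" using assms by (simp add: summable_real_powr_iff)
qed

lemma continuous_on_gbinomial [continuous_intros]:
  fixes f :: "'a::topological_space \<Rightarrow> complex"
  assumes "continuous_on A f" shows "continuous_on A (\<lambda>x. f x gchoose n)"
  unfolding gbinomial_prod_rev by (intro continuous_intros assms) auto

lemma holomorphic_on_gbinomial [holomorphic_intros]:
  assumes "f holomorphic_on A" shows "(\<lambda>x. f x gchoose n) holomorphic_on A"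
  unfolding gbinomial_prod_rev by (intro holomorphic_intros assms) auto

lemma holomorphic_powr_rem: "u > 0 \<Longrightarrow> powr_rem p u holomorphic_on A"
  unfolding powr_rem_def[abs_def] by (intro holomorphic_intros) (auto simp: complex_nonpos_Reals_iff)

text \<open>The bound on the remainders is locally uniform in \<open>s\<close>, so the Weierstrass
  M-test makes the limit holomorphic; the same uniform convergence yields summability at each
  point.\<close>

lemma powr_rem_sums_holomorphic:
  assumes x: "x > 0"
  shows "(\<lambda>s. \<Sum>n. powr_rem p (real n + x) s) holomorphic_on {s. Re s > 1 - real p}"
    and "Re s > 1 - real p \<Longrightarrow> summable (\<lambda>n. powr_rem p (real n + x) s)"
proof -
  let ?S = "{s. Re s > 1 - real p}"
  have S: "open ?S" by (rule open_halfspace_Re_gt)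
  have *: "\<exists>d>0. cball z d \<subseteq> ?S \<and>
      uniform_limit (cball z d) (\<lambda>N s. \<Sum>n<N. powr_rem p (real n + x) s) (\<lambda>s. \<Sum>n. powr_rem p (real n + x) s) sequentially"
    if z: "z \<in> ?S" for z
  proof -
    \<comment> \<open>\<open>d\<close> is half the distance from \<open>z\<close> to the boundary
      line, which makes \<open>\<rho> = 1 + d\<close>. On the disc every remainder is at most a
      constant times \<open>(real n + x) powr - \<rho>\<close>; for \<open>n > 0\<close> the base
      exceeds 1, so the power grows with its exponent.\<close>
    define d where "d = (Re z - (1 - real p)) / 2"
    define \<rho> where "\<rho> = Re z - d + p"
    have d: "d > 0" and \<rho>: "\<rho> > 1" using z by (auto simp: d_def \<rho>_def field_simps)
    have re: "Re s \<ge> Re z - d" if "s \<in> cball z d" for s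
    proof -
      have "\<bar>Re (z - s)\<bar> \<le> cmod (z - s)" by (rule abs_Re_le_cmod)
      then show ?thesis using that by (simp add: dist_norm)
    qed
    have sub: "cball z d \<subseteq> ?S" using re \<rho> by (force simp: \<rho>_def)
    have "compact ((\<lambda>s. norm ((1 - s) gchoose Suc p)) ` cball z d)"
      by (intro compact_continuous_image continuous_intros) auto
    then obtain C where C: "\<And>s. s \<in> cball z d \<Longrightarrow> norm ((1 - s) gchoose Suc p) \<le> C"
      using compact_imp_bounded bounded_real by (metis (no_types, lifting) abs_norm_cancel imageI)
    have "uniform_limit (cball z d) (\<lambda>N s. \<Sum>n<N. powr_rem p (real n + x) s) (\<lambda>s. \<Sum>n. powr_rem p (real n + x) s) sequentially"
    proof (rule Weierstrass_m_test_ev)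
      show "summable (\<lambda>n. ((p + 1) * C) * (real n + x) powr - \<rho>)"
        by (intro summable_mult summable_shift_powr x \<rho>)
      show "\<forall>\<^sub>F n in sequentially. \<forall>s\<in>cball z d. norm (powr_rem p (real n + x) s) \<le> ((p + 1) * C) * (real n + x) powr - \<rho>"
        using eventually_gt_at_top[of 0]
      proof eventually_elim
        case (elim n)
        show ?case
        proof
          fix s assume s: "s \<in> cball z d"
          have "norm (powr_rem p (real n + x) s) \<le> (p + 1) * norm ((1 - s) gchoose Suc p) * (real n + x) powr (- Re s - p)"
            using norm_powr_rem_le[of "real n + x" s p] re[OF s] \<rho> x by (auto simp: \<rho>_def add_ac)
          also have "\<dots> \<le> ((p + 1) * C) * (real n + x) powr - \<rho>"
            using C[OF s] re[OF s] elim x order_trans[OF norm_ge_zero C[OF s]] by (intro mult_mono powr_mono) (auto simp: \<rho>_def)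
          finally show "norm (powr_rem p (real n + x) s) \<le> ((p + 1) * C) * (real n + x) powr - \<rho>" .
        qed
      qed
    qed
    with d sub show ?thesis by blast
  qed
  show "(\<lambda>s. \<Sum>n. powr_rem p (real n + x) s) holomorphic_on ?S"
    by (rule holomorphic_uniform_sequence[OF S, of "\<lambda>N s. \<Sum>n<N. powr_rem p (real n + x) s"])
       (use x in \<open>auto intro!: holomorphic_on_sum holomorphic_powr_rem *[simplified]\<close>)
  assume "Re s > 1 - real p"
  then obtain d where d: "d > 0" "uniform_limit (cball s d) (\<lambda>N s. \<Sum>n<N. powr_rem p (real n + x) s) (\<lambda>s. \<Sum>n. powr_rem p (real n + x) s) sequentially"
    using *[of s] by auto
  have "(\<lambda>N. \<Sum>n<N. powr_rem p (real n + x) s) \<longlonglongrightarrow> (\<Sum>n. powr_rem p (real n + x) s)"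
    by (rule tendsto_uniform_limitI[OF d(2)]) (use d in auto)
  then show "summable (\<lambda>n. powr_rem p (real n + x) s)" by (metis sums_def summable_def)
qed

definition hz_series :: "real \<Rightarrow> complex \<Rightarrow> complex" where
  "hz_series x s = (\<Sum>n. (of_nat n + of_real x) powr (- s))"

lemma hz_series_sums:
  assumes "x > 0" "Re s > 1"
  shows "(\<lambda>n. (of_nat n + of_real x) powr (- s)) sums hz_series x s"
  unfolding hz_series_def
proof (rule summable_sums, rule summable_norm_cancel)
  have "norm ((of_nat n + of_real x) powr (- s)) = (real n + x) powr (- Re s)" for n
    using norm_powr_real_powr[of "of_real (real n + x)" "-s"] assms by simp
  then show "summable (\<lambda>n. norm ((of_nat n + of_real x) powr (- s)))"
    using assms by (simp add: summable_shift_powr)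
qed

lemma tendsto_shift_powr_0:
  fixes s :: complex
  assumes "x > 0" "Re s < 0"
  shows "(\<lambda>n. of_real (real n + x) powr s) \<longlonglongrightarrow> 0"
proof (rule tendsto_norm_zero_cancel)
  have "norm (complex_of_real (real n + x) powr s) = (real n + x) powr Re s" for n
    using norm_powr_real_powr[of "of_real (real n + x)" s] assms by simp
  moreover have "(\<lambda>n. (real n + x) powr Re s) \<longlonglongrightarrow> 0" using assms by real_asymp
  ultimately show "(\<lambda>n. norm (complex_of_real (real n + x) powr s)) \<longlonglongrightarrow> 0" by simp
qed

text \<open>Summing the Taylor expansion of \<open>(u + 1)\<^bsup>1-s\<^esup>\<close> at \<open>u = n + x\<close> over \<open>n\<close> makes the left-hand side telescope; solving
  for the term of order one expresses \<open>Z(s) = (s - 1) \<zeta>(s, x)\<close> through \<open>Z(s + 1), Z(s + 2), \<dots>\<close> and a remainder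
  that converges further to the left. The zeros of the binomial coefficients cancel the poles of \<open>\<zeta>(s + j, x)\<close>.\<close>

definition hz_step :: "nat \<Rightarrow> real \<Rightarrow> (complex \<Rightarrow> complex) \<Rightarrow> complex \<Rightarrow> complex" where
  "hz_step q x Z s = of_real x powr (1 - s) - (\<Sum>j<q. ((1 - s) gchoose Suc j) / of_nat (j + 2) * Z (s + 1 + of_nat j))
      + (\<Sum>n. powr_rem (Suc q) (real n + x) s)"

lemma hz_step_eq:
  assumes x: "x > 0" and s: "Re s > 1"
    and Z: "\<And>j. j < q \<Longrightarrow> Z (s + 1 + of_nat j) = (s + of_nat j) * hz_series x (s + 1 + of_nat j)"
  shows "hz_step q x Z s = (s - 1) * hz_series x s"
proof -
  have "(\<lambda>n. (\<lambda>n. - (of_real (real n + x) powr (1 - s))) (Suc n) - (\<lambda>n. - (of_real (real n + x) powr (1 - s))) n)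
      sums (- 0 - (- (of_real (real 0 + x) powr (1 - s))))"
    by (rule telescope_sums, rule tendsto_minus, rule tendsto_shift_powr_0) (use x s in auto)
  then have tele: "(\<lambda>n. of_real (real (Suc n) + x) powr (1 - s) - of_real (real n + x) powr (1 - s)) sums
      - (of_real x powr (1 - s))" using sums_minus by fastforce
  have exp: "1 - s - of_nat (Suc i) = - (s + of_nat i)" for i by simp
  have each: "(\<lambda>n. ((1 - s) gchoose Suc i) * of_real (real n + x) powr (1 - s - of_nat (Suc i))) sums
      (((1 - s) gchoose Suc i) * hz_series x (s + of_nat i))" for i
    unfolding exp using hz_series_sums[of x "s + of_nat i"] x s by (intro sums_mult) auto
  have "(\<lambda>n. (of_real (real (Suc n) + x) powr (1 - s) - of_real (real n + x) powr (1 - s)) -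
       (\<Sum>i<Suc q. ((1 - s) gchoose Suc i) * of_real (real n + x) powr (1 - s - of_nat (Suc i)))) sums
      (- (of_real x powr (1 - s)) - (\<Sum>i<Suc q. ((1 - s) gchoose Suc i) * hz_series x (s + of_nat i)))"
    by (intro sums_diff tele sums_sum each)
  also have "(\<lambda>n. (of_real (real (Suc n) + x) powr (1 - s) - of_real (real n + x) powr (1 - s)) -
       (\<Sum>i<Suc q. ((1 - s) gchoose Suc i) * of_real (real n + x) powr (1 - s - of_nat (Suc i))))
     = (\<lambda>n. powr_rem (Suc q) (real n + x) s)"
  proof
    fix n
    show "(of_real (real (Suc n) + x) powr (1 - s) - of_real (real n + x) powr (1 - s)) -
       (\<Sum>i<Suc q. ((1 - s) gchoose Suc i) * of_real (real n + x) powr (1 - s - of_nat (Suc i))) = powr_rem (Suc q) (real n + x) s"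
      unfolding powr_rem_def lessThan_Suc_atMost[symmetric] 
      by (subst (2) sum.lessThan_Suc_shift) (simp add: add_ac)
  qed
  finally have "(\<Sum>n. powr_rem (Suc q) (real n + x) s) =
     - (of_real x powr (1 - s)) - (\<Sum>i<Suc q. ((1 - s) gchoose Suc i) * hz_series x (s + of_nat i))"
    by (rule sums_unique[symmetric])
  also have "(\<Sum>i<Suc q. ((1 - s) gchoose Suc i) * hz_series x (s + of_nat i)) =
     (1 - s) * hz_series x s + (\<Sum>j<q. ((1 - s) gchoose Suc (Suc j)) * hz_series x (s + 1 + of_nat j))"
    by (subst sum.lessThan_Suc_shift) (simp add: add_ac)
  \<comment> \<open>The coefficient with index \<open>j + 2\<close> contains the factor
    \<open>- (s + j)\<close>, and \<open>(s + j) * hz_series x (s + 1 + j)\<close> is exactly the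
    pole-free \<open>Z (s + 1 + j)\<close>.\<close>
  also have "(\<Sum>j<q. ((1 - s) gchoose Suc (Suc j)) * hz_series x (s + 1 + of_nat j)) =
     - (\<Sum>j<q. ((1 - s) gchoose Suc j) / of_nat (j + 2) * Z (s + 1 + of_nat j))"
    unfolding sum_negf[symmetric]
  proof (intro sum.cong refl)
    fix j assume "j \<in> {..<q}"
    moreover have "((1 - s) gchoose Suc (Suc j)) = ((1 - s) gchoose Suc j) * (1 - s - of_nat (Suc j)) / of_nat (j + 2)"
      by (subst gbinomial_Suc_eq) simp
    moreover have "C * (1 - s - of_nat (Suc j)) / D * W = - (C / D * ((s + of_nat j) * W))" for C D W :: complex
      by (simp add: divide_inverse algebra_simps)
    ultimately show "((1 - s) gchoose Suc (Suc j)) * hz_series x (s + 1 + of_nat j) =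
       - (((1 - s) gchoose Suc j) / of_nat (j + 2) * Z (s + 1 + of_nat j))"
      using Z[of j] by simp
  qed
  finally show ?thesis by (simp add: hz_step_def algebra_simps)
qed

text \<open>Each step gains one unit: for \<open>Re s > - q\<close> the shifts
  \<open>s + 1 + j\<close> stay in the half-plane where \<open>Z\<close> is already known, and the
  series of remainders of order \<open>q + 1\<close> converges.\<close>

lemma hz_step_holomorphic:
  assumes x: "x > 0" and Z: "Z holomorphic_on {s. Re s > 1 - real q}"
  shows "hz_step q x Z holomorphic_on {s. Re s > - real q}"
proof -
  have "(\<lambda>s. Z (s + 1 + of_nat j)) holomorphic_on {s. Re s > - real q}" if "j < q" for j
  proof -
    have "(Z \<circ> (\<lambda>s. s + 1 + of_nat j)) holomorphic_on {s. Re s > - real q}"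
      by (rule holomorphic_on_compose_gen[OF _ Z]) (auto intro!: holomorphic_intros)
    then show ?thesis by (simp add: o_def)
  qed
  moreover have "(\<lambda>s. \<Sum>n. powr_rem (Suc q) (real n + x) s) holomorphic_on {s. Re s > - real q}"
    using powr_rem_sums_holomorphic(1)[OF x, of "Suc q"] by simp
  ultimately show ?thesis
    unfolding hz_step_def[abs_def] using x by (intro holomorphic_intros) (auto simp: complex_nonpos_Reals_iff)
qed

lemma halfplane_continuation:
  assumes "f holomorphic_on {s. Re s > c}" "g holomorphic_on {s. Re s > c}" "c \<le> 1"
    "\<And>s. Re s > 1 \<Longrightarrow> f s = g s" "Re s > c"
  shows "f s = g s"
proof (rule analytic_continuation_open[of "{s. Re s > 1}" "{s. Re s > c}" f g])
  show "open {s. Re s > 1}" "open {s. Re s > c}" by (rule open_halfspace_Re_gt)+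
  show "connected {s. Re s > c}" by (intro convex_connected convex_halfspace_Re_gt)
  show "{s. 1 < Re s} \<noteq> {}" by (auto intro!: exI[of _ 2])
  show "s \<in> {s. Re s > c}" using assms by simp
qed (use assms in auto)

text \<open>Induction on \<open>q\<close> extends \<open>(s - 1) * hz_series x s\<close> to
  \<open>Re s > - q\<close>; by the identity theorem the extensions agree on overlaps, so they glue
  to one entire function. In the base case the sum over \<open>j < 0\<close> is empty, so no earlier
  \<open>Z\<close> enters.\<close>

lemma hz_entire_exists:
  assumes x: "x > 0"
  shows "\<exists>Z. Z holomorphic_on UNIV \<and> (\<forall>s. Re s > 1 \<longrightarrow> Z s = (s - 1) * hz_series x s)"
proof -
  have "\<exists>Z. Z holomorphic_on {s. Re s > - real q} \<and> (\<forall>s. Re s > 1 \<longrightarrow> Z s = (s - 1) * hz_series x s)" for q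
  proof (induction q)
    case 0
    have "hz_step 0 x Z holomorphic_on {s. Re s > - real 0}" for Z
      using powr_rem_sums_holomorphic(1)[OF x, of "Suc 0"] x
      unfolding hz_step_def[abs_def] by (intro holomorphic_intros) (auto simp: complex_nonpos_Reals_iff)
    then show ?case using hz_step_eq[of x _ 0] x by blast
  next
    case (Suc q)
    then obtain Z where Z: "Z holomorphic_on {s. Re s > - real q}" "\<And>s. Re s > 1 \<Longrightarrow> Z s = (s - 1) * hz_series x s" by blast
    have "hz_step (Suc q) x Z holomorphic_on {s. Re s > - real (Suc q)}"
      using Z by (intro hz_step_holomorphic x) auto
    moreover have "hz_step (Suc q) x Z s = (s - 1) * hz_series x s" if "Re s > 1" for s
      by (rule hz_step_eq[OF x that]) (use Z(2) that in auto)
    ultimately show ?case by blast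
  qed
  then obtain Z where Z: "\<And>q. Z q holomorphic_on {s. Re s > - real q}" "\<And>q s. Re s > 1 \<Longrightarrow> Z q s = (s - 1) * hz_series x s"
    by metis
  have eq: "Z p s = Z q s" if "Re s > - real p" "p \<le> q" for p q s
  proof (rule halfplane_continuation[OF Z(1)[of p] _ _ _ that(1)])
    show "Z q holomorphic_on {s. Re s > - real p}"
      using Z(1)[of q] by (rule holomorphic_on_subset) (use that in auto)
  qed (use Z(2) in auto)
  \<comment> \<open>Any index whose half-plane contains \<open>s\<close> would do; the ceiling of
    \<open>\<bar>Re s\<bar>\<close> plus one is a uniform choice.\<close>
  define F where "F s = Z (nat \<lceil>\<bar>Re s\<bar>\<rceil> + 1) s" for s
  have F: "F s = Z q s" if "Re s > - real q" for q s
  proof -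
    have "Re s > - real (nat \<lceil>\<bar>Re s\<bar>\<rceil> + 1)" by linarith
    then show ?thesis using eq[of q s "nat \<lceil>\<bar>Re s\<bar>\<rceil> + 1"] eq[of "nat \<lceil>\<bar>Re s\<bar>\<rceil> + 1" s q] that
      by (cases "q \<le> nat \<lceil>\<bar>Re s\<bar>\<rceil> + 1") (auto simp: F_def)
  qed
  have "F holomorphic_on (\<Union>q\<in>UNIV. {s. Re s > - real q})"
  proof (rule holomorphic_on_UN_open)
    fix q show "F holomorphic_on {s. Re s > - real q}"
      using Z(1)[of q] by (subst holomorphic_cong[OF refl F]) auto
  qed (rule open_halfspace_Re_gt)
  also have "(\<Union>q\<in>UNIV. {s. Re s > - real q}) = UNIV"
  proof -
    have "\<exists>q. Re s > - real q" for s using reals_Archimedean2[of "- Re s"] by (auto simp: minus_less_iff)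
    then show ?thesis by auto
  qed
  finally have "F holomorphic_on UNIV" .
  moreover have "F s = (s - 1) * hz_series x s" if "Re s > 1" for s
    using F[of 0 s] Z(2) that by simp
  ultimately show ?thesis by blast
qed

text \<open>Makes the definite description usable. Existence: the entire function \<open>Z\<close>
  divided by \<open>s - 1\<close>, with the prescribed value at 1. Uniqueness: two candidates agree
  for \<open>Re s > 1\<close>, and the punctured plane is connected.\<close>

lemma hurwitz_zeta_properties:
  assumes x: "x > 0"
  shows "hurwitz_zeta x holomorphic_on (- {1}) \<and> hurwitz_zeta x 1 = 0 \<and>
     (\<forall>s. Re s > 1 \<longrightarrow> (\<lambda>n. (of_nat n + of_real x) powr (- s)) sums hurwitz_zeta x s)"
proof -
  obtain Z where Z: "Z holomorphic_on UNIV" "\<And>s. Re s > 1 \<Longrightarrow> Z s = (s - 1) * hz_series x s"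
    using hz_entire_exists[OF x] by blast
  let ?P = "\<lambda>f. f holomorphic_on (- {1}) \<and> f 1 = 0 \<and>
     (\<forall>s. Re s > 1 \<longrightarrow> (\<lambda>n. (of_nat n + of_real x) powr (- s)) sums f s)"
  have P: "?P (\<lambda>s. if s = 1 then 0 else Z s / (s - 1))"
  proof (intro conjI allI impI)
    have "(\<lambda>s. Z s / (s - 1)) holomorphic_on -{1}"
      using Z(1) by (auto intro!: holomorphic_intros intro: holomorphic_on_subset)
    then show "(\<lambda>s. if s = 1 then 0 else Z s / (s - 1)) holomorphic_on -{1}"
      by (rule holomorphic_transform) auto
    fix s :: complex assume s: "Re s > 1"
    show "(\<lambda>n. (of_nat n + of_real x) powr (- s)) sums (if s = 1 then 0 else Z s / (s - 1))"
      using hz_series_sums[OF x s] Z(2)[OF s] s by auto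
  qed auto
  have "\<exists>!f. ?P f"
  proof (rule ex1I[of ?P, OF P])
    fix g assume g: "?P g"
    let ?f = "\<lambda>s. if s = 1 then 0 else Z s / (s - 1)"
    have "g s = ?f s" if "s \<noteq> 1" for s
    proof (rule analytic_continuation_open[of "{s. Re s > 1}" "-{1}" g ?f])
      show "open {s. Re s > 1}" by (rule open_halfspace_Re_gt)
      show "connected (-{1::complex})" by (rule connected_punctured_universe) auto
      show "{s. 1 < Re s} \<noteq> {}" by (auto intro!: exI[of _ 2])
      fix s assume "s \<in> {s. Re s > 1}"
      then have "Re s > 1" by simp
      then show "g s = ?f s" using g P sums_unique2 by blast
    qed (use g P that in auto)
    then show "g = ?f" using g by auto
  qed
  from theI'[OF this] show ?thesis unfolding hurwitz_zeta_def .
qed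

lemma hurwitz_zeta_holomorphic: "x > 0 \<Longrightarrow> hurwitz_zeta x holomorphic_on (- {1})"
  and hurwitz_zeta_sums: "x > 0 \<Longrightarrow> Re s > 1 \<Longrightarrow> (\<lambda>n. (of_nat n + of_real x) powr (- s)) sums hurwitz_zeta x s"
  using hurwitz_zeta_properties by blast+

lemma hurwitz_zeta_holomorphic_on [holomorphic_intros]:
  assumes "x > 0" "f holomorphic_on A" "\<And>z. z \<in> A \<Longrightarrow> f z \<noteq> 1"
  shows "(\<lambda>z. hurwitz_zeta x (f z)) holomorphic_on A"
proof -
  have "f ` A \<subseteq> - {1}" using assms(3) by auto
  from holomorphic_on_compose_gen[OF assms(2) hurwitz_zeta_holomorphic[OF assms(1)] this]
  show ?thesis by (simp add: o_def)
qed

section \<open>Zeta values as limits of corrected partial sums\<close>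

text \<open>Euler-Maclaurin summation with its first correction, read off from the recursion with
  \<open>q = 1\<close>: the partial sums of the remainders telescope, so their convergence turns
  into a limit formula. The half term has a plus sign because the sum stops before
  \<open>n = N\<close>.\<close>

lemma hurwitz_zeta_tendsto_half:
  assumes x: "x > 0" and s: "Re s > -1" "s \<noteq> 1"
  shows "(\<lambda>N. (\<Sum>n<N. of_real (real n + x) powr (- s)) - of_real (real N + x) powr (1 - s) / (1 - s)
       + of_real (real N + x) powr (- s) / 2) \<longlonglongrightarrow> hurwitz_zeta x s"
proof -
  obtain Z where Z: "Z holomorphic_on UNIV" "\<And>s. Re s > 1 \<Longrightarrow> Z s = (s - 1) * hz_series x s"
    using hz_entire_exists[OF x] by blast
  have zeta: "Z s = (s - 1) * hurwitz_zeta x s" if "s \<noteq> 1" for s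
  proof (rule analytic_continuation_open[of "{s. Re s > 1}" "-{1}" Z "\<lambda>s. (s - 1) * hurwitz_zeta x s"])
    show "open {s. Re s > 1}" by (rule open_halfspace_Re_gt)
    show "connected (-{1::complex})" by (rule connected_punctured_universe) auto
    show "{s. 1 < Re s} \<noteq> {}" by (auto intro!: exI[of _ 2])
    show "(\<lambda>s. (s - 1) * hurwitz_zeta x s) holomorphic_on - {1}"
      by (intro holomorphic_intros x) auto
    fix s assume "s \<in> {s. Re s > 1}"
    then have "Re s > 1" by simp
    then show "Z s = (s - 1) * hurwitz_zeta x s"
      using hz_series_sums[OF x] hurwitz_zeta_sums[OF x] Z(2) sums_unique2 by metis
  qed (use that in \<open>auto intro: holomorphic_on_subset[OF Z(1)]\<close>)
  \<comment> \<open>The entire function is a fixed point of the recursion wherever the remainder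
    series converges: this holds for \<open>Re s > 1\<close>, hence by continuation.\<close>
  have step: "Z s = hz_step q x Z s" if "Re s > - real q" for s q
  proof (rule halfplane_continuation[OF _ hz_step_holomorphic _ _ that])
    fix s assume s: "Re s > 1"
    have "hz_step q x Z s = (s - 1) * hz_series x s"
      by (rule hz_step_eq[OF x s]) (use Z(2) s in auto)
    then show "Z s = hz_step q x Z s" using Z(2)[OF s] by simp
  qed (use x in \<open>auto intro: holomorphic_on_subset[OF Z(1)]\<close>)
  have part: "(\<Sum>n<N. powr_rem 1 (real n + x) s) = of_real (real N + x) powr (1 - s) - of_real x powr (1 - s)
      + (s - 1) * (\<Sum>n<N. of_real (real n + x) powr (- s))" for N s
    by (induction N) (auto simp: powr_rem_def algebra_simps)
  have part2: "(\<Sum>n<N. powr_rem 2 (real n + x) s) = (\<Sum>n<N. powr_rem 1 (real n + x) s)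
      - ((1 - s) gchoose 2) * (\<Sum>n<N. of_real (real n + x) powr (- (s + 1)))" for N s
    by (induction N) (auto simp: powr_rem_def numeral_2_eq_2 algebra_simps)
  have rem: "(\<lambda>N. \<Sum>n<N. powr_rem p (real n + x) s) \<longlonglongrightarrow> (\<Sum>n. powr_rem p (real n + x) s)" if "Re s > 1 - real p" for s p
    using powr_rem_sums_holomorphic(2)[OF x that] by (simp add: summable_LIMSEQ)
  \<comment> \<open>Keeping \<open>Z (s + 1)\<close>, which stands for \<open>s\<close> times the
    zeta value at \<open>s + 1\<close>, avoids dividing by \<open>s\<close>, so that
    \<open>s = 0\<close> is covered too.\<close>
  have Z1: "(\<lambda>N. of_real (real N + x) powr (- s) + s * (\<Sum>n<N. of_real (real n + x) powr (- (s + 1)))) \<longlonglongrightarrow> Z (s + 1)"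
  proof -
    have "(\<lambda>N. of_real x powr (- s) + (\<Sum>n<N. powr_rem 1 (real n + x) (s + 1))) \<longlonglongrightarrow> 
          of_real x powr (- s) + (\<Sum>n. powr_rem 1 (real n + x) (s + 1))"
      by (intro tendsto_intros rem) (use s in auto)
    also have "of_real x powr (- s) + (\<Sum>n. powr_rem 1 (real n + x) (s + 1)) = Z (s + 1)"
      using step[of 0 "s + 1"] s by (simp add: hz_step_def)
    finally show ?thesis unfolding part by (simp add: algebra_simps)
  qed
  have "(\<lambda>N. of_real x powr (1 - s) - (1 - s) / 2 * (of_real (real N + x) powr (- s) + s * (\<Sum>n<N. of_real (real n + x) powr (- (s + 1))))
      + (\<Sum>n<N. powr_rem 2 (real n + x) s)) \<longlonglongrightarrow>
      of_real x powr (1 - s) - (1 - s) / 2 * Z (s + 1) + (\<Sum>n. powr_rem 2 (real n + x) s)"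
    by (intro tendsto_intros rem Z1) (use s in auto)
  also have "of_real x powr (1 - s) - (1 - s) / 2 * Z (s + 1) + (\<Sum>n. powr_rem 2 (real n + x) s) = Z s"
    using step[of 1 s] s by (simp add: hz_step_def numeral_2_eq_2)
  also have "Z s = (s - 1) * hurwitz_zeta x s" using zeta s by simp
  finally have lim: "(\<lambda>N. of_real x powr (1 - s) - (1 - s) / 2 * (of_real (real N + x) powr (- s) + s * (\<Sum>n<N. of_real (real n + x) powr (- (s + 1))))
      + (\<Sum>n<N. powr_rem 2 (real n + x) s)) \<longlonglongrightarrow> (s - 1) * hurwitz_zeta x s" .
  have eq: "of_real x powr (1 - s) - (1 - s) / 2 * (of_real (real N + x) powr (- s) + s * (\<Sum>n<N. of_real (real n + x) powr (- (s + 1))))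
      + (\<Sum>n<N. powr_rem 2 (real n + x) s) = (s - 1) * ((\<Sum>n<N. of_real (real n + x) powr (- s)) - of_real (real N + x) powr (1 - s) / (1 - s)
       + of_real (real N + x) powr (- s) / 2)" for N
  proof -
    have alg: "X - (1 - s) / 2 * (A + s * T) + ((B - X + (s - 1) * U) - ((1 - s) * (- s) / 2) * T) =
       (s - 1) * (U - B / (1 - s) + A / 2)" for X A T B U :: complex
      using s by (simp add: field_simps)
    have c2: "(1 - s) gchoose 2 = (1 - s) * (- s) / 2"
      by (simp add: gbinomial_prod_rev numeral_2_eq_2)
    show ?thesis unfolding part2 part c2 by (rule alg)
  qed
  have "(\<lambda>N. inverse (s - 1) * ((s - 1) * ((\<Sum>n<N. of_real (real n + x) powr (- s)) - of_real (real N + x) powr (1 - s) / (1 - s)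
       + of_real (real N + x) powr (- s) / 2))) \<longlonglongrightarrow> inverse (s - 1) * ((s - 1) * hurwitz_zeta x s)"
    by (rule tendsto_mult[OF tendsto_const lim[unfolded eq]])
  moreover have cancel: "inverse (s - 1) * ((s - 1) * y) = y" for y using s by simp
  ultimately show ?thesis unfolding cancel by blast
qed

text \<open>Mean value inequality: the derivative \<open>w * z powr (w - 1)\<close> tends to 0 along
  the positive axis because \<open>Re w < 1\<close>.\<close>

lemma tendsto_powr_shift_diff:
  fixes w :: complex
  assumes "x \<ge> 0" "Re w < 1"
  shows "(\<lambda>N. of_real (real N + x) powr w - of_real (real N) powr w) \<longlonglongrightarrow> 0"
proof (rule Lim_null_comparison)
  show "(\<lambda>N. (norm w * x) * real N powr (Re w - 1)) \<longlonglongrightarrow> 0"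
    using assms by real_asymp
  show "\<forall>\<^sub>F N in sequentially. norm (of_real (real N + x) powr w - of_real (real N) powr w) \<le> (norm w * x) * real N powr (Re w - 1)"
    using eventually_gt_at_top[of 0]
  proof eventually_elim
    case (elim N)
    define S where "S = complex_of_real ` {real N..real N + x}"
    have "cmod (of_real (real N + x) powr w - of_real (real N) powr w) \<le> (norm w * real N powr (Re w - 1)) * norm (complex_of_real (real N + x) - of_real (real N))"
    proof (rule field_differentiable_bound[of S])
      show "convex S" unfolding S_def by (intro convex_linear_image) (auto simp: linear_iff scaleR_conv_of_real)
      show "of_real (real N) \<in> S" "of_real (real N + x) \<in> S" using assms by (auto simp: S_def simp del: of_real_add of_real_of_nat_eq)
      fix z assume "z \<in> S"
      then obtain v where v: "z = of_real v" "v \<ge> real N" by (auto simp: S_def)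
      show "((\<lambda>z. z powr w) has_field_derivative w * z powr (w - 1)) (at z within S)"
        using v elim has_field_derivative_powr[of z w] 
        by (auto simp: complex_nonpos_Reals_iff intro: has_field_derivative_at_within)
      show "cmod (w * z powr (w - 1)) \<le> norm w * real N powr (Re w - 1)"
        unfolding norm_mult
      proof (intro mult_left_mono norm_ge_zero)
        have "cmod (z powr (w - 1)) = v powr (Re w - 1)"
          using v elim by (simp add: norm_powr_real_powr)
        also have "\<dots> \<le> real N powr (Re w - 1)"
          using v elim assms by (intro powr_mono2') auto
        finally show "cmod (z powr (w - 1)) \<le> real N powr (Re w - 1)" .
      qed
    qed
    then show ?case using assms by (simp add: mult_ac flip: of_real_diff)
  qed
qed

text \<open>For \<open>Re s > 0\<close> the half term vanishes, and replacing \<open>N + x\<close>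
  by \<open>N\<close> in the main term changes nothing in the limit. The counterterm is then
  independent of \<open>x\<close>, so it cancels in differences and in combinations whose weights
  sum to zero.\<close>

lemma hurwitz_zeta_tendsto:
  assumes x: "x > 0" and s: "Re s > 0" "s \<noteq> 1"
  shows "(\<lambda>N. (\<Sum>n<N. of_real (real n + x) powr (- s)) - of_real (real N) powr (1 - s) / (1 - s)) \<longlonglongrightarrow> hurwitz_zeta x s"
proof -
  have "(\<lambda>N. ((\<Sum>n<N. of_real (real n + x) powr (- s)) - of_real (real N + x) powr (1 - s) / (1 - s)
       + of_real (real N + x) powr (- s) / 2) + ((of_real (real N + x) powr (1 - s) - of_real (real N) powr (1 - s)) / (1 - s) - of_real (real N + x) powr (- s) / 2))
     \<longlonglongrightarrow> hurwitz_zeta x s + (0 / (1 - s) - 0 / 2)"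
    by (intro tendsto_intros hurwitz_zeta_tendsto_half tendsto_powr_shift_diff tendsto_shift_powr_0) (use x s in auto)
  then show ?thesis by (simp add: diff_divide_distrib)
qed

text \<open>Here the sum includes \<open>n = N\<close>, which turns the sign of the half term from
  plus into minus.\<close>

lemma zeta_tendsto_half:
  assumes s: "Re s > -1" "s \<noteq> 1"
  shows "(\<lambda>N. (\<Sum>n=1..N. of_nat n powr (- s)) - of_nat N powr (1 - s) / (1 - s) - of_nat N powr (- s) / 2) \<longlonglongrightarrow> zeta s"
proof -
  have "(\<lambda>N. (\<Sum>n=1..Suc N. of_nat n powr (- s)) - of_nat (Suc N) powr (1 - s) / (1 - s) - of_nat (Suc N) powr (- s) / 2) =
     (\<lambda>N. (\<Sum>n<N. of_real (real n + 1) powr (- s)) - of_real (real N + 1) powr (1 - s) / (1 - s)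
       + of_real (real N + 1) powr (- s) / 2)"
  proof
    fix N
    have "(\<Sum>n=1..Suc N. of_nat n powr (- s)) = (\<Sum>n<Suc N. of_nat (Suc n) powr (- s))"
      by (rule sum.reindex_bij_witness[of _ Suc "\<lambda>n. n - 1"]) auto
    then show "(\<Sum>n=1..Suc N. of_nat n powr (- s)) - of_nat (Suc N) powr (1 - s) / (1 - s) - of_nat (Suc N) powr (- s) / 2 =
     (\<Sum>n<N. of_real (real n + 1) powr (- s)) - of_real (real N + 1) powr (1 - s) / (1 - s)
       + of_real (real N + 1) powr (- s) / 2" by (simp add: add_ac)
  qed
  also have "\<dots> \<longlonglongrightarrow> zeta s" unfolding zeta_def by (rule hurwitz_zeta_tendsto_half) (use s in auto)
  finally show ?thesis by (rule LIMSEQ_imp_Suc)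
qed

section \<open>Parseval\<close>

definition fourier :: "(real \<Rightarrow> complex) \<Rightarrow> real \<Rightarrow> complex" where
  "fourier f t = (LINT u|lborel. f u * cis (- (t * u)))"

lemma measurable_cis [measurable]: "cis \<in> borel_measurable borel"
  by (intro borel_measurable_continuous_onI continuous_intros)

lemma integrable_mult_cis:
  fixes f :: "'a \<Rightarrow> complex"
  assumes "integrable M f" "g \<in> borel_measurable M"
  shows "integrable M (\<lambda>x. f x * cis (g x))"
  by (rule Bochner_Integration.integrable_bound[OF assms(1)])
     (use assms in \<open>auto simp: norm_mult\<close>)

lemma measurable_fourier [measurable]:
  assumes [measurable]: "f \<in> borel_measurable borel"
  shows "fourier f \<in> borel_measurable borel"
  unfolding fourier_def[abs_def] by measurable

lemma norm_fourier_le: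
  "norm (fourier f t) \<le> (LINT u|lborel. norm (f u))"
  unfolding fourier_def using integral_norm_bound[of lborel "\<lambda>u. f u * cis (- (t * u))"] by (simp add: norm_mult)

text \<open>The multiplication formula. The kernel has modulus 1, so integrability of
  \<open>a\<close> and \<open>b\<close> alone justifies Fubini.\<close>

lemma fourier_swap:
  assumes a: "integrable lborel a" and b: "integrable lborel b"
  shows "(LINT t|lborel. a t * fourier b t) = (LINT u|lborel. b u * fourier a u)"
proof -
  have [measurable]: "a \<in> borel_measurable borel" "b \<in> borel_measurable borel"
    using borel_measurable_integrable[OF a] borel_measurable_integrable[OF b] by auto
  have int: "integrable (lborel \<Otimes>\<^sub>M lborel) (\<lambda>(t, u). a t * b u * cis (- (t * u)))"
  proof (rule lborel_pair.Fubini_integrable)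
    have "(\<lambda>x. LINT y|lborel. norm (case (x, y) of (t, u) \<Rightarrow> a t * b u * cis (- (t * u)))) =
          (\<lambda>x. norm (a x) * (LINT y|lborel. norm (b y)))"
      by (simp add: norm_mult)
    then show "integrable lborel (\<lambda>x. LINT y|lborel. norm (case (x, y) of (t, u) \<Rightarrow> a t * b u * cis (- (t * u))))"
      using a by (simp add: integrable_norm)
    have "integrable lborel (\<lambda>u. a t * (b u * cis (- (t * u))))" for t
      by (intro integrable_mult_right integrable_mult_cis b) measurable
    then show "AE x in lborel. integrable lborel (\<lambda>y. case (x, y) of (t, u) \<Rightarrow> a t * b u * cis (- (t * u)))"
      by (simp add: mult.assoc)
  qed measurable
  have "(LINT t|lborel. a t * fourier b t) = (LINT t|lborel. LINT u|lborel. a t * b u * cis (- (t * u)))"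
    unfolding fourier_def by (simp add: mult.assoc)
  also have "\<dots> = (LINT u|lborel. LINT t|lborel. a t * b u * cis (- (t * u)))"
    using lborel_pair.Fubini_integral[OF int] by simp
  also have "\<dots> = (LINT u|lborel. b u * fourier a u)"
  proof (rule Bochner_Integration.integral_cong[OF refl])
    fix u
    have "(\<lambda>t. a t * b u * cis (- (t * u))) = (\<lambda>t. b u * (a t * cis (- (u * t))))"
      by (auto simp: mult_ac)
    then show "(LINT t|lborel. a t * b u * cis (- (t * u))) = b u * fourier a u"
      by (simp add: fourier_def)
  qed
  finally show ?thesis .
qed

lemma std_normal_density_uminus: "std_normal_density (- x) = std_normal_density x"
  by (simp add: std_normal_density_def)

lemma integrable_std_normal_density_scaled:
  assumes "e > 0"
  shows "integrable lborel (\<lambda>t. complex_of_real (std_normal_density (e * t)))"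
  using lborel_integrable_real_affine[OF integrable_normal_density[of 1 0], of e 0] assms
  by (simp add: complex_of_real_integrable_eq)

text \<open>The characteristic function of the standard normal law after the substitution
  \<open>r = e * t\<close>; the Gaussian reproduces itself up to scale.\<close>

lemma fourier_std_normal_density:
  assumes e: "e > 0"
  shows "fourier (\<lambda>t. of_real (std_normal_density (e * t))) y = of_real (sqrt (2 * pi) / e * std_normal_density (y / e))"
proof -
  have "char std_normal_distribution (- (y / e)) = (LINT r|lborel. of_real (std_normal_density r) * cis (- (y / e * r)))"
    unfolding char_def by (subst integral_density) (auto simp: cis_conv_exp scaleR_conv_of_real)
  also have "\<dots> = \<bar>e\<bar> *\<^sub>R (LINT t|lborel. of_real (std_normal_density (0 + e * t)) * cis (- (y / e * (0 + e * t))))"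
    by (subst lborel_integral_real_affine[where c = e and t = 0]) (use e in auto)
  also have "\<dots> = e * fourier (\<lambda>t. of_real (std_normal_density (e * t))) y"
    using e by (simp add: fourier_def scaleR_conv_of_real)
  finally have "e * fourier (\<lambda>t. of_real (std_normal_density (e * t))) y = exp (- ((y / e)^2) / 2)"
    by (simp add: char_std_normal_distribution)
  then show ?thesis using e by (simp add: std_normal_density_def field_simps)
qed

text \<open>With Gaussian damping everything is absolutely integrable, and the multiplication
  formula is applied twice: once to remove \<open>fourier f\<close>, and once inside
  \<open>inner\<close>, where \<open>fourier g\<close> against the damped exponential becomes an
  average of \<open>g\<close> about \<open>u + c\<close> on the scale \<open>e\<close>.\<close>

lemma gaussian_parseval:
  fixes f g :: "real \<Rightarrow> complex"
  assumes f: "integrable lborel f" and g: "integrable lborel g" and e: "e > 0"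
  shows "(LINT t|lborel. fourier f t * fourier g (- t) * cis (- (c * t)) * of_real (std_normal_density (e * t))) =
     of_real (sqrt (2 * pi)) * (LINT u|lborel. f u * (LINT w|lborel. g (u + c + e * w) * of_real (std_normal_density w)))"
proof -
  have [measurable]: "f \<in> borel_measurable borel" "g \<in> borel_measurable borel"
    using borel_measurable_integrable[OF f] borel_measurable_integrable[OF g] by auto
  let ?\<phi> = "\<lambda>t. complex_of_real (std_normal_density (e * t))"
  define A where "A = (\<lambda>t. fourier g (- t) * cis (- (c * t)) * ?\<phi> t)"
  have A: "integrable lborel A"
  proof (rule Bochner_Integration.integrable_bound)
    show "integrable lborel (\<lambda>t. of_real (LINT u|lborel. norm (g u)) * ?\<phi> t)"
      by (intro integrable_mult_right integrable_std_normal_density_scaled e)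
    show "AE x in lborel. norm (A x) \<le> norm (of_real (LINT u|lborel. norm (g u)) * ?\<phi> x)"
      unfolding A_def norm_mult
      by (intro always_eventually allI mult_right_mono) (use norm_fourier_le[of g] in \<open>auto intro: order_trans[OF _ abs_ge_self]\<close>)
  qed (auto simp: A_def)
  have inner: "fourier A u = of_real (sqrt (2 * pi)) * (LINT w|lborel. g (u + c + e * w) * of_real (std_normal_density w))" for u
  proof -
    define a where "a = (\<lambda>t. ?\<phi> t * cis ((u + c) * t))"
    have a: "integrable lborel a"
      unfolding a_def by (intro integrable_mult_cis integrable_std_normal_density_scaled e) measurable
    have "fourier A u = (LINT t|lborel. a (- t) * fourier g (- t))"
      unfolding fourier_def[of A] unfolding A_def a_def
    proof (intro Bochner_Integration.integral_cong refl)
      fix t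
      have "cis ((u + c) * - t) = cis (- (c * t)) * cis (- (u * t))"
        unfolding cis_mult by (simp add: algebra_simps)
      then show "fourier g (- t) * cis (- (c * t)) * ?\<phi> t * cis (- (u * t)) = ?\<phi> (- t) * cis ((u + c) * - t) * fourier g (- t)"
        using std_normal_density_uminus[of "e * t"] by (simp add: mult_ac)
    qed
    also have "\<dots> = (LINT t|lborel. a t * fourier g t)"
      using lborel_integral_real_affine[of "-1" "\<lambda>t. a t * fourier g t" 0] by simp
    also have "\<dots> = (LINT v|lborel. g v * fourier a v)"
      by (rule fourier_swap[OF a g])
    also have "\<dots> = (LINT v|lborel. g v * fourier ?\<phi> (v - u - c))"
      unfolding fourier_def a_def
      by (intro Bochner_Integration.integral_cong refl) (simp add: cis_mult mult.assoc, simp add: algebra_simps)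
    also have "(LINT v|lborel. g v * fourier ?\<phi> (v - u - c)) = (LINT v|lborel. g v * of_real (sqrt (2 * pi) / e * std_normal_density ((v - u - c) / e)))"
      by (simp only: fourier_std_normal_density[OF e])
    also have "\<dots> = \<bar>e\<bar> *\<^sub>R (LINT w|lborel. g (u + c + e * w) * of_real (sqrt (2 * pi) / e * std_normal_density ((u + c + e * w - u - c) / e)))"
      by (rule lborel_integral_real_affine) (use e in auto)
    also have "\<dots> = (LINT w|lborel. of_real (sqrt (2 * pi)) * (g (u + c + e * w) * of_real (std_normal_density w)))"
      unfolding integral_scaleR_right[symmetric]
      by (intro Bochner_Integration.integral_cong refl) (use e in \<open>simp add: scaleR_conv_of_real field_simps\<close>)
    finally show ?thesis by simp
  qed
  have "(LINT t|lborel. fourier f t * fourier g (- t) * cis (- (c * t)) * ?\<phi> t) = (LINT t|lborel. A t * fourier f t)"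
    by (simp add: A_def mult_ac)
  also have "\<dots> = (LINT u|lborel. f u * fourier A u)" by (rule fourier_swap[OF A f])
  also have "\<dots> = (LINT u|lborel. of_real (sqrt (2 * pi)) * (f u * (LINT w|lborel. g (u + c + e * w) * of_real (std_normal_density w))))"
    unfolding inner by (simp add: mult_ac)
  finally show ?thesis by simp
qed

lemma std_normal_density_le: "std_normal_density x \<le> 1 / sqrt (2 * pi)"
  by (simp add: std_normal_density_def divide_right_mono)

lemma norm_normal_average_le:
  fixes g :: "real \<Rightarrow> complex"
  assumes [measurable]: "g \<in> borel_measurable borel" and g: "\<And>u. norm (g u) \<le> B"
  shows "norm (LINT w|lborel. g (v + e * w) * of_real (std_normal_density w)) \<le> B"
proof -
  have "norm (LINT w|lborel. g (v + e * w) * of_real (std_normal_density w)) \<le>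
        (LINT w|lborel. norm (g (v + e * w) * of_real (std_normal_density w)))"
    by (rule integral_norm_bound)
  also have "\<dots> \<le> (LINT w|lborel. B * std_normal_density w)"
  proof (rule integral_mono')
    show "integrable lborel (\<lambda>w. B * std_normal_density w)" by (intro integrable_mult_right integrable_normal_density) auto
    fix w :: real
    show "norm (g (v + e * w) * of_real (std_normal_density w)) \<le> B * std_normal_density w"
      unfolding norm_mult using g by (auto intro!: mult_right_mono)
    show "0 \<le> B * std_normal_density w" by (intro mult_nonneg_nonneg order_trans[OF norm_ge_zero g[of 0]]) auto
  qed
  also have "\<dots> = B" by (simp add: integral_normal_density)
  finally show ?thesis .
qed

text \<open>The easy half of Plancherel's theorem, for bounded integrable functions. With the
  conjugate of \<open>f\<close> as second function, the damped integrals of the squared modulus are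
  bounded by \<open>C\<close> uniformly in the width, and Fatou's lemma removes the damping.\<close>

lemma fourier_square_integrable:
  fixes f :: "real \<Rightarrow> complex"
  assumes f: "integrable lborel f" and B: "\<And>u. norm (f u) \<le> B"
  shows "integrable lborel (\<lambda>t. (norm (fourier f t))\<^sup>2)"
proof -
  have [measurable]: "f \<in> borel_measurable borel" using borel_measurable_integrable[OF f] by auto
  have "integrable lborel (\<lambda>u. cnj (f u))" using f by simp
  then have [measurable]: "(\<lambda>u. cnj (f u)) \<in> borel_measurable borel" using borel_measurable_integrable[of lborel "\<lambda>u. cnj (f u)"] by simp
  define C where "C = sqrt (2 * pi) * (LINT u|lborel. norm (f u) * B)"
  have B0: "B \<ge> 0" using order_trans[OF norm_ge_zero B] .
  define e where "e n = 1 / real (Suc n)" for n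
  have e: "e n > 0" for n by (simp add: e_def)
  define U where "U n t = (norm (fourier f t))\<^sup>2 * std_normal_density (e n * t)" for n t
  have [measurable]: "U n \<in> borel_measurable borel" for n unfolding U_def by measurable
  have Uint: "integrable lborel (U n)" for n
  proof (rule Bochner_Integration.integrable_bound)
    show "integrable lborel (\<lambda>t. (LINT u|lborel. norm (f u))\<^sup>2 * std_normal_density (e n * t))"
      using integrable_std_normal_density_scaled[OF e, of n] by (intro integrable_mult_right) (simp add: complex_of_real_integrable_eq)
    show "AE t in lborel. norm (U n t) \<le> norm ((LINT u|lborel. norm (f u))\<^sup>2 * std_normal_density (e n * t))"
      using norm_fourier_le[of f] by (auto simp: U_def abs_mult intro!: mult_right_mono power_mono)
  qed simp
  have Ule: "(LINT t|lborel. U n t) \<le> C" for n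
  proof -
    have cnj: "fourier (\<lambda>u. cnj (f u)) (- t) = cnj (fourier f t)" for t
      using Bochner_Integration.integral_cnj[of lborel "\<lambda>u. f u * cis (- (t * u))"]
      by (simp add: fourier_def cis_cnj)
    have "of_real (LINT t|lborel. U n t) = (LINT t|lborel. fourier f t * fourier (\<lambda>u. cnj (f u)) (- t) * cis (- (0 * t)) * of_real (std_normal_density (e n * t)))"
      unfolding integral_complex_of_real[symmetric] U_def cnj
      by (intro Bochner_Integration.integral_cong refl) (simp add: complex_norm_square[symmetric])
    also have "\<dots> = of_real (sqrt (2 * pi)) * (LINT u|lborel. f u * (LINT w|lborel. cnj (f (u + 0 + e n * w)) * of_real (std_normal_density w)))"
      by (rule gaussian_parseval[OF f _ e]) (use f in simp)
    finally have "norm (complex_of_real (LINT t|lborel. U n t)) = sqrt (2 * pi) * norm (LINT u|lborel. f u * (LINT w|lborel. cnj (f (u + 0 + e n * w)) * of_real (std_normal_density w)))"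
      by (simp add: norm_mult)
    also have "\<dots> \<le> C" unfolding C_def
    proof (rule mult_left_mono)
      have "norm (LINT u|lborel. f u * (LINT w|lborel. cnj (f (u + 0 + e n * w)) * of_real (std_normal_density w))) \<le>
         (LINT u|lborel. norm (f u * (LINT w|lborel. cnj (f (u + 0 + e n * w)) * of_real (std_normal_density w))))"
        by (rule integral_norm_bound)
      also have "\<dots> \<le> (LINT u|lborel. norm (f u) * B)"
      proof (rule integral_mono')
        show "integrable lborel (\<lambda>u. norm (f u) * B)" using f by simp
        fix u show "norm (f u * (LINT w|lborel. cnj (f (u + 0 + e n * w)) * of_real (std_normal_density w))) \<le> norm (f u) * B"
          unfolding norm_mult by (intro mult_left_mono norm_normal_average_le) (use B in auto)
      qed (use B0 in auto)
      finally show "norm (LINT u|lborel. f u * (LINT w|lborel. cnj (f (u + 0 + e n * w)) * of_real (std_normal_density w))) \<le> (LINT u|lborel. norm (f u) * B)" .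
    qed auto
    finally show ?thesis by simp
  qed
  have lim: "(\<lambda>n. U n t) \<longlonglongrightarrow> (norm (fourier f t))\<^sup>2 / sqrt (2 * pi)" for t
  proof -
    have "(\<lambda>n. std_normal_density (e n * t)) \<longlonglongrightarrow> std_normal_density (0 * t)"
      unfolding std_normal_density_def e_def
      by (intro tendsto_intros) (rule LIMSEQ_Suc[OF lim_1_over_n], simp)
    from tendsto_mult[OF tendsto_const this, of "(norm (fourier f t))\<^sup>2"]
    show ?thesis by (simp add: U_def std_normal_density_def)
  qed
  have "(\<integral>\<^sup>+t. ennreal ((norm (fourier f t))\<^sup>2 / sqrt (2 * pi)) \<partial>lborel) = (\<integral>\<^sup>+t. liminf (\<lambda>n. ennreal (U n t)) \<partial>lborel)"
    using lim by (intro nn_integral_cong lim_imp_Liminf[symmetric] tendsto_ennrealI) auto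
  also have "\<dots> \<le> liminf (\<lambda>n. \<integral>\<^sup>+t. ennreal (U n t) \<partial>lborel)"
    by (rule nn_integral_liminf) measurable
  also have "\<dots> \<le> ennreal C"
  proof (rule Liminf_le)
    have "(\<integral>\<^sup>+t. ennreal (U n t) \<partial>lborel) \<le> ennreal C" for n
    proof -
      have "AE t in lborel. 0 \<le> U n t" by (simp add: U_def)
      then show ?thesis by (subst nn_integral_eq_integral[OF Uint]) (auto intro: ennreal_leI Ule)
    qed
    then show "\<forall>\<^sub>F n in sequentially. (\<integral>\<^sup>+t. ennreal (U n t) \<partial>lborel) \<le> ennreal C" by simp
  qed simp
  finally have "integrable lborel (\<lambda>t. (norm (fourier f t))\<^sup>2 / sqrt (2 * pi))"
    by (intro integrableI_bounded) (auto simp: less_top[symmetric] top_unique)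
  from integrable_mult_left[OF this, of "sqrt (2 * pi)"] show ?thesis by simp
qed

text \<open>Neither transform need be integrable, but both are square integrable, and
  \<open>p * q \<le> p\<^sup>2 + q\<^sup>2\<close>.\<close>

lemma integrable_fourier_product:
  fixes f g :: "real \<Rightarrow> complex"
  assumes f: "integrable lborel f" and Bf: "\<And>u. norm (f u) \<le> Bf"
    and g: "integrable lborel g" and Bg: "\<And>u. norm (g u) \<le> Bg"
  shows "integrable lborel (\<lambda>t. fourier f t * fourier g (- t) * cis (- (c * t)))"
proof -
  have [measurable]: "f \<in> borel_measurable borel" "g \<in> borel_measurable borel"
    using borel_measurable_integrable[OF f] borel_measurable_integrable[OF g] by auto
  have F: "integrable lborel (\<lambda>t. (norm (fourier f t))\<^sup>2)" by (rule fourier_square_integrable[OF f Bf])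
  have "integrable lborel (\<lambda>t. (norm (fourier g t))\<^sup>2)" by (rule fourier_square_integrable[OF g Bg])
  from lborel_integrable_real_affine[OF this, of "-1" 0]
  have G: "integrable lborel (\<lambda>t. (norm (fourier g (- t)))\<^sup>2)" by simp
  show ?thesis
  proof (rule Bochner_Integration.integrable_bound[OF Bochner_Integration.integrable_add[OF F G]])
    show "AE x in lborel. norm (fourier f x * fourier g (- x) * cis (- (c * x))) \<le> norm ((norm (fourier f x))\<^sup>2 + (norm (fourier g (- x)))\<^sup>2)"
    proof (intro always_eventually allI)
      fix x
      have "p * q \<le> p\<^sup>2 + q\<^sup>2" if "p \<ge> 0" "q \<ge> 0" for p q :: real
        using sum_squares_bound[of p q] mult_nonneg_nonneg[OF that] by linarith
      then show "norm (fourier f x * fourier g (- x) * cis (- (c * x))) \<le> norm ((norm (fourier f x))\<^sup>2 + (norm (fourier g (- x)))\<^sup>2)"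
        by (simp add: norm_mult)
    qed
  qed measurable
qed

text \<open>The scale \<open>e\<close> tends to 0 on both sides of \<open>gaussian_parseval\<close>.
  On the left the damping factor tends to \<open>1 / sqrt (2 * pi)\<close>; on the right the
  averages tend to \<open>g (u + c)\<close> at continuity points, that is, for almost every
  \<open>u\<close>. The two factors \<open>sqrt (2 * pi)\<close> combine to
  \<open>2 * pi\<close>.\<close>

lemma fourier_parseval:
  fixes f g :: "real \<Rightarrow> complex"
  assumes f: "integrable lborel f" and Bf: "\<And>u. norm (f u) \<le> Bf"
    and g: "integrable lborel g" and Bg: "\<And>u. norm (g u) \<le> Bg"
    and cont: "countable {u. \<not> isCont g u}"
  shows "(LINT t|lborel. fourier f t * fourier g (- t) * cis (- (c * t))) = of_real (2 * pi) * (LINT u|lborel. f u * g (u + c))"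
proof -
  have [measurable]: "f \<in> borel_measurable borel" "g \<in> borel_measurable borel"
    using borel_measurable_integrable[OF f] borel_measurable_integrable[OF g] by auto
  define e where "e n = 1 / real (Suc n)" for n
  have e: "e n > 0" for n by (simp add: e_def)
  have e0: "e \<longlonglongrightarrow> 0" unfolding e_def by (rule LIMSEQ_Suc[OF lim_1_over_n])
  let ?P = "\<lambda>t. fourier f t * fourier g (- t) * cis (- (c * t))"
  note P = integrable_fourier_product[OF f Bf g Bg, of c]
  have "(\<lambda>n. LINT t|lborel. ?P t * of_real (std_normal_density (e n * t))) \<longlonglongrightarrow> (LINT t|lborel. ?P t * of_real (1 / sqrt (2 * pi)))"
  proof (rule integral_dominated_convergence[where w = "\<lambda>t. norm (?P t) * (1 / sqrt (2 * pi))"])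
    show "integrable lborel (\<lambda>t. norm (?P t) * (1 / sqrt (2 * pi)))"
      by (intro integrable_mult_left integrable_norm P)
    show "AE t in lborel. norm (?P t * of_real (std_normal_density (e n * t))) \<le> norm (?P t) * (1 / sqrt (2 * pi))" for n
    proof (intro always_eventually allI)
      fix t
      have "norm (?P t) * std_normal_density (e n * t) \<le> norm (?P t) * (1 / sqrt (2 * pi))"
        by (intro mult_left_mono std_normal_density_le norm_ge_zero)
      then show "norm (?P t * of_real (std_normal_density (e n * t))) \<le> norm (?P t) * (1 / sqrt (2 * pi))"
        by (simp add: norm_mult)
    qed
    show "AE t in lborel. (\<lambda>n. ?P t * of_real (std_normal_density (e n * t))) \<longlonglongrightarrow> ?P t * of_real (1 / sqrt (2 * pi))"
    proof (intro always_eventually allI)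
      fix t
      have "(\<lambda>n. std_normal_density (e n * t)) \<longlonglongrightarrow> std_normal_density (0 * t)"
        unfolding std_normal_density_def by (intro tendsto_intros e0) simp
      then have "(\<lambda>n. std_normal_density (e n * t)) \<longlonglongrightarrow> 1 / sqrt (2 * pi)" by (simp add: std_normal_density_def)
      then show "(\<lambda>n. ?P t * of_real (std_normal_density (e n * t))) \<longlonglongrightarrow> ?P t * of_real (1 / sqrt (2 * pi))"
        by (intro tendsto_mult tendsto_const tendsto_of_real)
    qed
  qed measurable
  then have lim1: "(\<lambda>n. LINT t|lborel. ?P t * of_real (std_normal_density (e n * t))) \<longlonglongrightarrow> (LINT t|lborel. ?P t) / of_real (sqrt (2 * pi))"
    by simp
  define G where "G n u = (LINT w|lborel. g (u + c + e n * w) * of_real (std_normal_density w))" for n u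
  have [measurable]: "G n \<in> borel_measurable borel" for n unfolding G_def by measurable
  have "countable ((\<lambda>u. u - c) ` {u. \<not> isCont g u})" using cont by simp
  then have "(\<lambda>u. u - c) ` {u. \<not> isCont g u} \<in> null_sets lborel" by (rule countable_imp_null_set_lborel)
  then have AE_cont: "AE u in lborel. isCont g (u + c)"
    by (rule AE_not_in[THEN eventually_mono]) force
  have "(\<lambda>n. LINT u|lborel. f u * G n u) \<longlonglongrightarrow> (LINT u|lborel. f u * g (u + c))"
  proof (rule integral_dominated_convergence[where w = "\<lambda>u. norm (f u) * Bg"])
    show "integrable lborel (\<lambda>u. norm (f u) * Bg)" using f by simp
    show "AE u in lborel. norm (f u * G n u) \<le> norm (f u) * Bg" for n
      unfolding norm_mult G_def by (intro always_eventually allI mult_left_mono norm_normal_average_le) (use Bg in auto)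
    show "AE u in lborel. (\<lambda>n. f u * G n u) \<longlonglongrightarrow> f u * g (u + c)"
      using AE_cont
    proof eventually_elim
      case (elim u)
      have "(\<lambda>n. G n u) \<longlonglongrightarrow> (LINT w|lborel. g (u + c) * of_real (std_normal_density w))"
        unfolding G_def
      proof (rule integral_dominated_convergence[where w = "\<lambda>w. Bg * std_normal_density w"])
        show "integrable lborel (\<lambda>w. Bg * std_normal_density w)" by (intro integrable_mult_right integrable_normal_density) auto
        show "AE w in lborel. norm (g (u + c + e n * w) * of_real (std_normal_density w)) \<le> Bg * std_normal_density w" for n
          by (intro always_eventually allI) (use Bg in \<open>auto simp: norm_mult intro!: mult_right_mono\<close>)
        show "AE w in lborel. (\<lambda>n. g (u + c + e n * w) * of_real (std_normal_density w)) \<longlonglongrightarrow> g (u + c) * of_real (std_normal_density w)"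
        proof (intro always_eventually allI tendsto_mult tendsto_const)
          fix w
          have "(\<lambda>n. u + c + e n * w) \<longlonglongrightarrow> u + c + 0 * w" by (intro tendsto_intros e0)
          then show "(\<lambda>n. g (u + c + e n * w)) \<longlonglongrightarrow> g (u + c)"
            using isCont_tendsto_compose[OF elim] by simp
        qed
      qed measurable
      also have "(LINT w|lborel. g (u + c) * of_real (std_normal_density w)) = g (u + c)"
        by (simp add: integral_normal_density)
      finally show ?case by (intro tendsto_mult tendsto_const)
    qed
  qed measurable
  then have "(\<lambda>n. of_real (sqrt (2 * pi)) * (LINT u|lborel. f u * G n u)) \<longlonglongrightarrow> of_real (sqrt (2 * pi)) * (LINT u|lborel. f u * g (u + c))"
    by (intro tendsto_mult tendsto_const)
  also have "(\<lambda>n. of_real (sqrt (2 * pi)) * (LINT u|lborel. f u * G n u)) = (\<lambda>n. LINT t|lborel. ?P t * of_real (std_normal_density (e n * t)))"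
    unfolding G_def by (intro ext gaussian_parseval[symmetric] f g e)
  finally have "(LINT t|lborel. ?P t) / of_real (sqrt (2 * pi)) = of_real (sqrt (2 * pi)) * (LINT u|lborel. f u * g (u + c))"
    by (rule LIMSEQ_unique[OF lim1])
  then have "(LINT t|lborel. ?P t) = (of_real (sqrt (2 * pi)))\<^sup>2 * (LINT u|lborel. f u * g (u + c))"
    by (simp add: field_simps power2_eq_square)
  also have "(complex_of_real (sqrt (2 * pi)))\<^sup>2 = of_real (2 * pi)" by (simp flip: of_real_power)
  finally show ?thesis .
qed

section \<open>The moment of fractional parts\<close>

lemma integrable_exp_atMost:
  assumes "r > (0::real)"
  shows "integrable lborel (\<lambda>u. indicator {..L} u * exp (r * u))"
proof -
  have "(\<integral>\<^sup>+x. ennreal (exp (- (r * x))) * indicator {- L..} x \<partial>lborel) = ennreal (0 - (- exp (- (r * (- L))) / r))"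
  proof (rule nn_integral_FTC_atLeast)
    show "((\<lambda>x. - exp (- (r * x)) / r) has_real_derivative exp (- (r * x))) (at x)" for x
      using assms by (auto intro!: derivative_eq_intros)
    show "((\<lambda>x. - exp (- (r * x)) / r) \<longlongrightarrow> 0) at_top" using assms by real_asymp
  qed auto
  also have "(\<lambda>x. ennreal (exp (- (r * x))) * indicator {- L..} x) = (\<lambda>x. ennreal (indicator {- L..} x * exp (- (r * x))))"
    by (auto simp: indicator_def)
  finally have "integrable lborel (\<lambda>x. indicator {- L..} x * exp (- (r * x)))"
    by (intro integrableI_bounded) (auto simp: abs_mult)
  from lborel_integrable_real_affine[OF this, of "-1" 0] show ?thesis
    by (simp add: indicator_def if_distrib cong: if_cong)
qed

lemma has_bochner_integral_exp_Icc:
  fixes w :: complex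
  assumes "w \<noteq> 0" "c \<le> L"
  shows "has_bochner_integral lborel (\<lambda>u. indicator {c..L} u *\<^sub>R exp (w * of_real u)) ((exp (w * of_real L) - exp (w * of_real c)) / w)"
proof -
  have "integrable lborel (\<lambda>u. indicator {c..L} u *\<^sub>R exp (w * of_real u))"
    by (rule borel_integrable_compact) (auto intro!: continuous_intros)
  moreover have "(LINT u|lborel. indicator {c..L} u *\<^sub>R exp (w * of_real u)) = exp (w * of_real L) / w - exp (w * of_real c) / w"
  proof (rule integral_FTC_atLeastAtMost[OF assms(2)])
    fix x
    have "((\<lambda>z. exp (w * z) / w) has_field_derivative exp (w * of_real x)) (at (of_real x))"
      using assms by (auto intro!: derivative_eq_intros)
    then show "((\<lambda>u. exp (w * of_real u) / w) has_vector_derivative exp (w * of_real x)) (at x within {c..L})"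
      by (intro has_vector_derivative_real_field) 
  qed (auto intro!: continuous_intros)
  ultimately show ?thesis by (simp add: has_bochner_integral_iff diff_divide_distrib)
qed

lemma has_bochner_integral_exp_atMost:
  fixes w :: complex
  assumes w: "Re w > 0"
  shows "has_bochner_integral lborel (\<lambda>u. indicator {..L} u *\<^sub>R exp (w * of_real u)) (exp (w * of_real L) / w)"
proof -
  have int: "integrable lborel (\<lambda>u. indicator {..L} u *\<^sub>R exp (w * of_real u))"
    by (rule Bochner_Integration.integrable_bound[OF integrable_exp_atMost[OF w, of L]]) auto
  have w0: "w \<noteq> 0" using w by auto
  have "(\<lambda>n. LINT u|lborel. indicator {L - real n..L} u *\<^sub>R exp (w * of_real u)) \<longlonglongrightarrow> (LINT u|lborel. indicator {..L} u *\<^sub>R exp (w * of_real u))"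
  proof (rule integral_dominated_convergence[OF _ _ integrable_exp_atMost[OF w, of L]])
    show "AE u in lborel. (\<lambda>n. indicator {L - real n..L} u *\<^sub>R exp (w * of_real u)) \<longlonglongrightarrow> indicator {..L} u *\<^sub>R exp (w * of_real u)"
    proof (rule always_eventually, rule allI, rule tendsto_eventually)
      fix u
      obtain m where m: "L - u < real m" using reals_Archimedean2 by blast
      show "\<forall>\<^sub>F n in sequentially. indicator {L - real n..L} u *\<^sub>R exp (w * of_real u) = indicator {..L} u *\<^sub>R exp (w * of_real u)"
        using eventually_ge_at_top[of m] by eventually_elim (use m in \<open>auto simp: indicator_def\<close>)
    qed
  qed (auto simp: indicator_def)
  moreover have "(LINT u|lborel. indicator {L - real n..L} u *\<^sub>R exp (w * of_real u)) = (exp (w * of_real L) - exp (w * of_real (L - real n))) / w" for n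
    by (rule has_bochner_integral_integral_eq, rule has_bochner_integral_exp_Icc) (use w0 in auto)
  moreover have "(\<lambda>n. (exp (w * of_real L) - exp (w * of_real (L - real n))) / w) \<longlonglongrightarrow> (exp (w * of_real L) - 0) / w"
  proof (intro tendsto_intros w0 tendsto_norm_zero_cancel[of "\<lambda>n. exp (w * of_real (L - real n))"])
    have "(\<lambda>n. exp (Re w * (L - real n))) \<longlonglongrightarrow> 0" using w by real_asymp
    then show "(\<lambda>n. norm (exp (w * of_real (L - real n)))) \<longlonglongrightarrow> 0" by simp
  qed
  ultimately have "(LINT u|lborel. indicator {..L} u *\<^sub>R exp (w * of_real u)) = exp (w * of_real L) / w"
    using LIMSEQ_unique by fastforce
  with int show ?thesis by (simp add: has_bochner_integral_iff)
qed

text \<open>Besides integrability the majorant itself is exported: dominated convergence as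
  \<open>a\<close> tends to 0 needs one that serves all parameters.\<close>

lemma integrable_exp_decay:
  fixes f :: "real \<Rightarrow> complex"
  assumes [measurable]: "f \<in> borel_measurable borel" and "p > 0" "q > 0"
    and "\<And>u. u \<le> 0 \<Longrightarrow> norm (f u) \<le> C * exp (p * u)" "\<And>u. u \<ge> 0 \<Longrightarrow> norm (f u) \<le> C * exp (- (q * u))"
  shows "integrable lborel f"
    and "integrable lborel (\<lambda>u. C * (indicator {..0} u * exp (p * u) + indicator {..0} (- u) * exp (q * (- u))))"
    and "norm (f u) \<le> C * (indicator {..0} u * exp (p * u) + indicator {..0} (- u) * exp (q * (- u)))"
proof -
  show int: "integrable lborel (\<lambda>u. C * (indicator {..0} u * exp (p * u) + indicator {..0} (- u) * exp (q * (- u))))"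
    using lborel_integrable_real_affine[OF integrable_exp_atMost[OF assms(3), of 0], of "-1" 0] integrable_exp_atMost[OF assms(2), of 0]
    by (intro integrable_mult_right Bochner_Integration.integrable_add) simp_all
  have C: "C \<ge> 0" using order_trans[OF norm_ge_zero assms(4)[of 0]] by simp
  show le: "norm (f u) \<le> C * (indicator {..0} u * exp (p * u) + indicator {..0} (- u) * exp (q * (- u)))" for u
  proof (cases "u \<le> 0")
    case True
    then have "norm (f u) \<le> C * exp (p * u)" by (rule assms)
    also have "\<dots> \<le> C * (indicator {..0} u * exp (p * u) + indicator {..0} (- u) * exp (q * (- u)))"
      using C True by (intro mult_left_mono) auto
    finally show ?thesis .
  qed (use assms(5)[of u] in auto)
  show "integrable lborel f"
    by (rule Bochner_Integration.integrable_bound[OF int]) (use le in \<open>auto intro: order_trans[OF _ abs_ge_self]\<close>)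
qed

lemma integral_atMost_ln_tendsto:
  fixes f :: "real \<Rightarrow> complex"
  assumes "integrable lborel f"
  shows "(\<lambda>N. LINT u|lborel. indicator {..ln (real N)} u *\<^sub>R f u) \<longlonglongrightarrow> (LINT u|lborel. f u)"
proof (rule integral_dominated_convergence[where w = "\<lambda>u. norm (f u)"])
  have [measurable]: "f \<in> borel_measurable lborel" using borel_measurable_integrable[OF assms] .
  show "(\<lambda>u. indicator {..ln (real N)} u *\<^sub>R f u) \<in> borel_measurable lborel" for N by measurable
  show "AE u in lborel. (\<lambda>N. indicator {..ln (real N)} u *\<^sub>R f u) \<longlonglongrightarrow> f u"
  proof (rule always_eventually, rule allI, rule tendsto_eventually)
    fix u
    have "filterlim (\<lambda>N. ln (real N)) at_top sequentially" by real_asymp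
    then have "eventually (\<lambda>N. u \<le> ln (real N)) sequentially" by (simp add: filterlim_at_top)
    then show "\<forall>\<^sub>F N in sequentially. indicator {..ln (real N)} u *\<^sub>R f u = f u"
      by eventually_elim auto
  qed
qed (use assms in \<open>auto simp: indicator_def\<close>)

section \<open>Fractional parts as linear terms minus step functions\<close>

text \<open>The floor counts the positive integers up to \<open>x\<close>; as a sum of step
  functions it can be integrated term by term.\<close>

lemma sum_of_bool_le_eq:
  assumes "0 \<le> x" "x \<le> real M"
  shows "(\<Sum>m=1..M. of_bool (real m \<le> x)) = x - frac x"
proof -
  have "(\<Sum>m=1..M. of_bool (real m \<le> x)) = (\<Sum>m\<in>{m \<in> {1..M}. real m \<le> x}. (1::real))"
    by (rule sum.mono_neutral_cong_right) auto
  also have "{m \<in> {1..M}. real m \<le> x} = {1..nat \<lfloor>x\<rfloor>}"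
    using assms by (auto simp: le_nat_iff le_floor_iff)
  finally show ?thesis using assms by (simp add: frac_def)
qed

text \<open>Cutting at \<open>ln N\<close> makes the number of jumps finite:
  \<open>real h * exp v\<close> stays at most \<open>h * N\<close>, and the jump to \<open>m\<close>
  happens at \<open>ln (m / h)\<close>.\<close>

lemma frac_exp_eq:
  assumes h: "h \<ge> 1" and N: "N \<ge> 1" and v: "v \<le> ln (real N)"
  shows "frac (real h * exp v) = real h * exp v - (\<Sum>m=1..h*N. of_bool (ln (real m / real h) \<le> v))"
proof -
  have "exp v \<le> real N" using v N by (metis exp_le_cancel_iff exp_ln_iff of_nat_0_less_iff order_less_le_trans zero_less_one)
  then have "real h * exp v \<le> real (h * N)" using h by simp
  then have "(\<Sum>m=1..h*N. of_bool (real m \<le> real h * exp v)) = real h * exp v - frac (real h * exp v)"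
    by (intro sum_of_bool_le_eq) auto
  moreover have "(\<Sum>m=1..h*N. of_bool (real m \<le> real h * exp v)) = (\<Sum>m=1..h*N. of_bool (ln (real m / real h) \<le> v) :: real)"
  proof (intro sum.cong refl arg_cong[of _ _ of_bool])
    fix m assume "m \<in> {1..h*N}"
    then have "m \<ge> 1" by simp
    then have "(ln (real m / real h) \<le> v) = (real m / real h \<le> exp v)"
      using h by (metis divide_pos_pos exp_le_cancel_iff exp_ln of_nat_0_less_iff order_less_le_trans zero_less_one)
    then show "(real m \<le> real h * exp v) = (ln (real m / real h) \<le> v)" using h by (simp add: field_simps)
  qed
  ultimately show ?thesis by (simp only:)
qed

lemma exp_times_ln: "y > 0 \<Longrightarrow> exp (w * complex_of_real (ln y)) = of_real y powr w"
  by (simp add: powr_def Ln_of_real)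

lemma frac_nonneg_le: "x \<ge> 0 \<Longrightarrow> frac x \<le> x" for x :: real
  by (simp add: frac_def)

lemma zeta_tendsto:
  assumes s: "Re s > 0" "s \<noteq> 1"
  shows "(\<lambda>N. (\<Sum>n=1..N. of_nat n powr (- s)) - of_nat N powr (1 - s) / (1 - s)) \<longlonglongrightarrow> zeta s"
proof -
  have z: "(\<lambda>N. of_nat N powr (- s)) \<longlonglongrightarrow> 0"
    using LIMSEQ_imp_Suc[of "\<lambda>N. of_nat N powr (- s)" 0] tendsto_shift_powr_0[of 1 "-s"] s
    by (simp add: add_ac)
  have "(\<lambda>N. ((\<Sum>n=1..N. of_nat n powr (- s)) - of_nat N powr (1 - s) / (1 - s) - of_nat N powr (- s) / 2) + of_nat N powr (- s) / 2) \<longlonglongrightarrow> zeta s + 0 / 2"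
    by (intro tendsto_intros zeta_tendsto_half z) (use s in auto)
  then show ?thesis by simp
qed

lemma measurable_frac [measurable]: "(frac :: real \<Rightarrow> real) \<in> borel_measurable borel"
  unfolding frac_def[abs_def] by measurable

lemma integrable_frac_exp:
  assumes s: "0 < Re s" "Re s < 1"
  shows "integrable lborel (\<lambda>u. of_real (frac (exp u)) * exp (- s * of_real u))"
proof (rule integrable_exp_decay(1)[where p = "1 - Re s" and q = "Re s" and C = 1])
  fix u :: real
  have n: "norm (of_real (frac (exp u)) * exp (- s * of_real u)) = frac (exp u) * exp (- (Re s * u))"
    by (simp add: norm_mult)
  have "frac (exp u) * exp (- (Re s * u)) \<le> exp u * exp (- (Re s * u))"
    by (intro mult_right_mono frac_nonneg_le) auto
  then show "norm (of_real (frac (exp u)) * exp (- s * of_real u)) \<le> 1 * exp ((1 - Re s) * u)"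
    unfolding n by (simp add: algebra_simps flip: exp_add)
  have "frac (exp u) * exp (- (Re s * u)) \<le> 1 * exp (- (Re s * u))"
    by (intro mult_right_mono less_imp_le[OF frac_lt_1]) auto
  then show "norm (of_real (frac (exp u)) * exp (- s * of_real u)) \<le> 1 * exp (- (Re s * u))"
    unfolding n by simp
qed (use s in simp_all)

text \<open>The classical Mellin transform of the fractional part, in the variable
  \<open>exp u\<close>. Integrating the step functions up to \<open>ln N\<close> gives
  \<open>- 1 / s\<close> times the corrected partial sum of the zeta series, whose limit is
  known.\<close>

lemma integral_frac_exp:
  assumes s: "0 < Re s" "Re s < 1"
  shows "(LINT u|lborel. of_real (frac (exp u)) * exp (- s * of_real u)) = - zeta s / s"
proof -
  have s0: "s \<noteq> 0" "s \<noteq> 1" using s by auto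
  let ?f = "\<lambda>u. of_real (frac (exp u)) * exp (- s * of_real u)"
  have val: "(LINT u|lborel. indicator {..ln (real N)} u *\<^sub>R ?f u) =
      - ((\<Sum>n=1..N. of_nat n powr (- s)) - of_nat N powr (1 - s) / (1 - s)) / s" if N: "N \<ge> 1" for N
  proof -
    let ?L = "ln (real N)"
    have eq: "indicator {..?L} u *\<^sub>R ?f u = indicator {..?L} u *\<^sub>R exp ((1 - s) * of_real u) -
        (\<Sum>n=1..N. indicator {ln (real n)..?L} u *\<^sub>R exp (- s * of_real u))" for u
    proof (cases "u \<le> ?L")
      case True
      have "?f u = (exp (of_real u) - (\<Sum>n=1..N. of_bool (ln (real n) \<le> u))) * exp (- s * of_real u)"
        using frac_exp_eq[of 1 N u] True N by (simp add: exp_of_real)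
      also have "\<dots> = exp ((1 - s) * of_real u) - (\<Sum>n=1..N. of_bool (ln (real n) \<le> u) * exp (- s * of_real u))"
        by (simp add: algebra_simps sum_distrib_left flip: exp_add)
      also have "(\<Sum>n=1..N. of_bool (ln (real n) \<le> u) * exp (- s * of_real u)) = (\<Sum>n=1..N. indicator {ln (real n)..?L} u *\<^sub>R exp (- s * of_real u))"
        by (intro sum.cong) (use True in auto)
      finally show ?thesis using True by simp
    qed auto
    have "has_bochner_integral lborel (\<lambda>u. indicator {..?L} u *\<^sub>R ?f u)
      (exp ((1 - s) * of_real ?L) / (1 - s) - (\<Sum>n=1..N. (exp (- s * of_real ?L) - exp (- s * of_real (ln (real n)))) / (- s)))"
      unfolding eq
      by (intro has_bochner_integral_diff has_bochner_integral_sum has_bochner_integral_exp_atMost has_bochner_integral_exp_Icc)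
         (use s s0 N in auto)
    then have "(LINT u|lborel. indicator {..?L} u *\<^sub>R ?f u) = 
       exp ((1 - s) * of_real ?L) / (1 - s) - (\<Sum>n=1..N. (exp (- s * of_real ?L) - exp (- s * of_real (ln (real n)))) / (- s))"
      by (rule has_bochner_integral_integral_eq)
    also have "(\<Sum>n=1..N. (exp (- s * of_real ?L) - exp (- s * of_real (ln (real n)))) / (- s)) =
       (\<Sum>n=1..N. (of_nat n powr (- s) - of_nat N powr (- s)) / s)"
      by (intro sum.cong refl, subst (1 2) exp_times_ln) (use N s0 in \<open>auto simp: field_simps\<close>)
    also have "\<dots> = ((\<Sum>n=1..N. of_nat n powr (- s)) - of_nat N * of_nat N powr (- s)) / s"
      by (simp add: sum_subtractf flip: sum_divide_distrib)
    also have "of_nat N * of_nat N powr (- s) = of_nat N powr (1 - s)"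
      using N by (simp add: powr_diff powr_minus divide_inverse)
    also have "exp ((1 - s) * of_real ?L) = of_nat N powr (1 - s)"
      by (subst exp_times_ln) (use N in auto)
    also have "X / (1 - s) - (S - X) / s = - (S - X / (1 - s)) / s" for X S
      using s0 by (simp add: field_simps)
    finally show ?thesis .
  qed
  have "(\<lambda>N. LINT u|lborel. indicator {..ln (real N)} u *\<^sub>R ?f u) \<longlonglongrightarrow> (LINT u|lborel. ?f u)"
    by (intro integral_atMost_ln_tendsto integrable_frac_exp s)
  moreover have "(\<lambda>N. - ((\<Sum>n=1..N. of_nat n powr (- s)) - of_nat N powr (1 - s) / (1 - s)) / s) \<longlonglongrightarrow> - zeta s / s"
    by (intro tendsto_divide tendsto_minus tendsto_const zeta_tendsto s s0)
  then have "(\<lambda>N. LINT u|lborel. indicator {..ln (real N)} u *\<^sub>R ?f u) \<longlonglongrightarrow> - zeta s / s"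
    by (rule Lim_transform_eventually) (rule eventually_mono[OF eventually_ge_at_top[of 1]], rule val[symmetric])
  ultimately show ?thesis by (rule LIMSEQ_unique)
qed

section \<open>The moment of two fractional parts and its cut-off\<close>

text \<open>In the variable \<open>x = exp v\<close> this is the integral over the positive
  half-line of \<open>frac (h * x) * frac (k * x) * x powr (- 2 - a)\<close>.\<close>

definition frac_moment :: "nat \<Rightarrow> nat \<Rightarrow> complex \<Rightarrow> complex" where
  "frac_moment h k a = (LINT v|lborel. of_real (frac (real h * exp v) * frac (real k * exp v)) * exp (- (1 + a) * of_real v))"

text \<open>For \<open>v \<le> 0\<close> each fractional part is at most its argument, which gives
  two powers of \<open>exp v\<close>; for \<open>v \<ge> 0\<close> each is at most 1. Since
  \<open>h\<close> and \<open>k\<close> are at least 1, the constant \<open>h * k\<close> serves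
  both sides, and the rate \<open>1 - r\<close> is uniform over
  \<open>\<bar>Re a\<bar> \<le> r\<close>.\<close>

lemma norm_frac_moment_le:
  assumes a: "\<bar>Re a\<bar> \<le> r" "r < 1" and h: "h \<ge> 1" "k \<ge> 1"
  defines "f \<equiv> (\<lambda>v. of_real (frac (real h * exp v) * frac (real k * exp v)) * exp (- (1 + a) * of_real v))"
  shows "v \<le> 0 \<Longrightarrow> norm (f v) \<le> (real h * real k) * exp ((1 - r) * v)"
    and "v \<ge> 0 \<Longrightarrow> norm (f v) \<le> (real h * real k) * exp (- ((1 - r) * v))"
proof -
  have n: "norm (f v) = (frac (real h * exp v) * frac (real k * exp v)) * exp (- ((1 + Re a) * v))"
    by (simp add: f_def norm_mult abs_mult) (simp add: algebra_simps)
  show "norm (f v) \<le> (real h * real k) * exp ((1 - r) * v)" if v: "v \<le> 0"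
  proof -
    have "norm (f v) \<le> ((real h * exp v) * (real k * exp v)) * exp (- ((1 + Re a) * v))"
      unfolding n by (intro mult_right_mono mult_mono frac_nonneg_le) auto
    also have "\<dots> = (real h * real k) * exp ((1 - Re a) * v)"
      by (simp add: algebra_simps flip: exp_add)
    also have "\<dots> \<le> (real h * real k) * exp ((1 - r) * v)"
      using a v by (intro mult_left_mono) (auto intro!: mult_right_mono_neg)
    finally show ?thesis .
  qed
  show "norm (f v) \<le> (real h * real k) * exp (- ((1 - r) * v))" if v: "v \<ge> 0"
  proof -
    have "norm (f v) \<le> (1 * 1) * exp (- ((1 + Re a) * v))"
      unfolding n by (intro mult_right_mono mult_mono less_imp_le[OF frac_lt_1]) auto
    also have "\<dots> \<le> (real h * real k) * exp (- ((1 - r) * v))"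
    proof (intro mult_mono)
      show "exp (- ((1 + Re a) * v)) \<le> exp (- ((1 - r) * v))"
        using a v by (auto intro!: mult_right_mono)
      show "1 \<le> real h" "1 \<le> real k" using h by auto
    qed auto
    finally show ?thesis .
  qed
qed

lemma integrable_frac_moment:
  assumes a: "\<bar>Re a\<bar> < 1" and h: "h \<ge> 1" "k \<ge> 1"
  shows "integrable lborel (\<lambda>v. of_real (frac (real h * exp v) * frac (real k * exp v)) * exp (- (1 + a) * of_real v))"
  by (rule integrable_exp_decay(1)[where p = "1 - \<bar>Re a\<bar>" and q = "1 - \<bar>Re a\<bar>", OF _ _ _ norm_frac_moment_le])
     (use assms in auto)

text \<open>On the disc of radius 1/2 about 0 the bound with \<open>r = 1/2\<close> is one majorant
  for all \<open>a\<close>, so dominated convergence applies along every sequence.\<close>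

lemma frac_moment_tendsto_0:
  assumes h: "h \<ge> 1" "k \<ge> 1"
  shows "(frac_moment h k \<longlongrightarrow> frac_moment h k 0) (at 0)"
proof -
  have "(frac_moment h k \<longlongrightarrow> frac_moment h k 0) (at 0 within ball 0 (1/2))"
    unfolding tendsto_at_iff_sequentially
  proof (intro allI impI)
    fix X :: "nat \<Rightarrow> complex" assume X: "\<forall>i. X i \<in> ball 0 (1/2) - {0}" "X \<longlonglongrightarrow> 0"
    have re: "\<bar>Re (X i)\<bar> \<le> 1/2" for i
      using X(1) abs_Re_le_cmod[of "X i"] by (smt (verit) DiffD1 dist_0_norm mem_ball)
    let ?f = "\<lambda>a v. of_real (frac (real h * exp v) * frac (real k * exp v)) * exp (- (1 + a) * of_real v)"
    have bound: "norm (?f (X i) v) \<le> (real h * real k) * (indicator {..0} v * exp ((1 - 1/2) * v) + indicator {..0} (- v) * exp ((1 - 1/2) * (- v)))"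
      and int: "integrable lborel (\<lambda>v. (real h * real k) * (indicator {..0} v * exp ((1 - 1/2) * v) + indicator {..0} (- v) * exp ((1 - 1/2) * (- v))))" for i v
      by (rule integrable_exp_decay(2,3)[where f = "?f (X i)", OF _ _ _ norm_frac_moment_le]; use re h in simp)+
    have "(\<lambda>i. frac_moment h k (X i)) \<longlonglongrightarrow> frac_moment h k 0"
      unfolding frac_moment_def
    proof (rule integral_dominated_convergence[OF _ _ int])
      show "AE v in lborel. (\<lambda>i. ?f (X i) v) \<longlonglongrightarrow> ?f 0 v"
        by (intro always_eventually allI tendsto_intros X)
    qed (use bound in auto)
    then show "(frac_moment h k \<circ> X) \<longlonglongrightarrow> frac_moment h k 0" by (simp add: o_def)
  qed
  then show ?thesis by (subst (asm) at_within_open) auto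
qed

lemma of_nat_div_powr:
  assumes "n \<ge> 1" "k \<ge> 1"
  shows "complex_of_real (real n / real k) powr w = of_nat n powr w * of_nat k powr (- w)"
proof -
  have "complex_of_real (real n / real k) powr w = exp (w * of_real (ln (real n / real k)))"
    using assms by (intro exp_times_ln[symmetric]) auto
  also have "\<dots> = exp (w * of_real (ln (real n))) * exp (- w * of_real (ln (real k)))"
    using assms by (simp add: ln_div algebra_simps flip: exp_add)
  also have "\<dots> = of_nat n powr w * of_nat k powr (- w)"
    using assms by (subst (1 2) exp_times_ln) auto
  finally show ?thesis .
qed

text \<open>Both fractional parts are written as linear term minus step functions and the product is
  multiplied out. The product of the linear terms is integrable at minus infinity because
  \<open>Re a < 1\<close>; a product of two step functions starts at the later jump, hence the
  \<open>max\<close>. The antiderivative of \<open>exp (- a * v)\<close> requires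
  \<open>a \<noteq> 0\<close>.\<close>

lemma integral_frac_moment_atMost:
  assumes a: "\<bar>Re a\<bar> < 1" "a \<noteq> 0" and h: "h \<ge> 1" "k \<ge> 1" and N: "N \<ge> 1"
  shows "(LINT v|lborel. indicator {..ln (real N)} v *\<^sub>R (of_real (frac (real h * exp v) * frac (real k * exp v)) * exp (- (1 + a) * of_real v))) =
     of_nat h * of_nat k * of_nat N powr (1 - a) / (1 - a)
     - of_nat h * (\<Sum>n=1..k*N. (of_real (real n / real k) powr (- a) - of_nat N powr (- a)) / a)
     - of_nat k * (\<Sum>m=1..h*N. (of_real (real m / real h) powr (- a) - of_nat N powr (- a)) / a)
     + (\<Sum>m=1..h*N. \<Sum>n=1..k*N. (of_real (max (real m / real h) (real n / real k)) powr (- 1 - a) - of_nat N powr (- 1 - a)) / (1 + a))"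
proof -
  let ?L = "ln (real N)"
  let ?f = "\<lambda>v. of_real (frac (real h * exp v) * frac (real k * exp v)) * exp (- (1 + a) * of_real v)"
  have a1: "1 + a \<noteq> 0" "1 - a \<noteq> 0" using a by (auto simp: complex_eq_iff)
  have eq: "indicator {..?L} v *\<^sub>R ?f v = of_nat h * of_nat k * (indicator {..?L} v *\<^sub>R exp ((1 - a) * of_real v))
      - of_nat h * (\<Sum>n=1..k*N. indicator {ln (real n / real k)..?L} v *\<^sub>R exp (- a * of_real v))
      - of_nat k * (\<Sum>m=1..h*N. indicator {ln (real m / real h)..?L} v *\<^sub>R exp (- a * of_real v))
      + (\<Sum>m=1..h*N. \<Sum>n=1..k*N. indicator {max (ln (real m / real h)) (ln (real n / real k))..?L} v *\<^sub>R exp (- (1 + a) * of_real v))" for v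
  proof (cases "v \<le> ?L")
    case True
    let ?e = "exp (- (1 + a) * of_real v)"
    let ?A = "\<Sum>m=1..h*N. of_bool (ln (real m / real h) \<le> v) :: complex"
    let ?B = "\<Sum>n=1..k*N. of_bool (ln (real n / real k) \<le> v) :: complex"
    have e1: "exp (of_real v) * ?e = exp (- a * of_real v)" "exp (of_real v) * (exp (of_real v) * ?e) = exp ((1 - a) * of_real v)"
      by (simp_all add: algebra_simps flip: exp_add)
    have "of_real (frac (real h * exp v)) = of_nat h * exp (of_real v) - ?A"
         "of_real (frac (real k * exp v)) = of_nat k * exp (of_real v) - ?B"
      using frac_exp_eq[of h N v] frac_exp_eq[of k N v] True h N by (simp_all add: exp_of_real)
    then have "?f v = (of_nat h * exp (of_real v) - ?A) * (of_nat k * exp (of_real v) - ?B) * ?e" by simp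
    also have "\<dots> = of_nat h * of_nat k * (exp (of_real v) * (exp (of_real v) * ?e)) - of_nat h * (?B * (exp (of_real v) * ?e)) - of_nat k * (?A * (exp (of_real v) * ?e)) + ?A * ?B * ?e"
      by (simp only: algebra_simps)
    also have "\<dots> = of_nat h * of_nat k * exp ((1 - a) * of_real v) - of_nat h * (?B * exp (- a * of_real v)) - of_nat k * (?A * exp (- a * of_real v)) + ?A * ?B * ?e"
      unfolding e1(2) unfolding e1(1) ..
    also have "?B * exp (- a * of_real v) = (\<Sum>n=1..k*N. indicator {ln (real n / real k)..?L} v *\<^sub>R exp (- a * of_real v))"
      unfolding sum_distrib_right by (intro sum.cong) (use True in auto)
    also have "?A * exp (- a * of_real v) = (\<Sum>m=1..h*N. indicator {ln (real m / real h)..?L} v *\<^sub>R exp (- a * of_real v))"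
      unfolding sum_distrib_right by (intro sum.cong) (use True in auto)
    also have "?A * ?B * ?e = (\<Sum>m=1..h*N. \<Sum>n=1..k*N. indicator {max (ln (real m / real h)) (ln (real n / real k))..?L} v *\<^sub>R ?e)"
      unfolding sum_product unfolding sum_distrib_right by (intro sum.cong refl) (use True in auto)
    finally show ?thesis using True by simp
  qed auto
  have le: "ln (real n / real k) \<le> ?L" if "n \<in> {1..k*N}" "k \<ge> 1" for n k
  proof -
    have "real n \<le> real N * real k" using that by (metis atLeastAtMost_iff mult.commute of_nat_le_iff of_nat_mult)
    then show ?thesis using that N by (subst ln_le_cancel_iff) (auto simp: divide_simps)
  qed
  have single: "(\<Sum>n=1..k*N. (exp (- a * of_real ?L) - exp (- a * of_real (ln (real n / real k)))) / (- a)) =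
     (\<Sum>n=1..k*N. (of_real (real n / real k) powr (- a) - of_nat N powr (- a)) / a)" if "k \<ge> 1" for k
    by (intro sum.cong refl, subst (1 2) exp_times_ln) (use N that in \<open>auto simp: minus_divide_left diff_divide_distrib\<close>)
  have "has_bochner_integral lborel (\<lambda>v. indicator {..?L} v *\<^sub>R ?f v)
    (of_nat h * of_nat k * (exp ((1 - a) * of_real ?L) / (1 - a))
      - of_nat h * (\<Sum>n=1..k*N. (exp (- a * of_real ?L) - exp (- a * of_real (ln (real n / real k)))) / (- a))
      - of_nat k * (\<Sum>m=1..h*N. (exp (- a * of_real ?L) - exp (- a * of_real (ln (real m / real h)))) / (- a))
      + (\<Sum>m=1..h*N. \<Sum>n=1..k*N. (exp (- (1 + a) * of_real ?L) - exp (- (1 + a) * of_real (max (ln (real m / real h)) (ln (real n / real k))))) / (- (1 + a))))"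
    unfolding eq
    by (intro has_bochner_integral_diff has_bochner_integral_add has_bochner_integral_mult_right has_bochner_integral_sum
          has_bochner_integral_exp_atMost has_bochner_integral_exp_Icc le max.boundedI)
       (use a a1 h in \<open>auto simp: neg_eq_iff_add_eq_0\<close>)
  then have "(LINT v|lborel. indicator {..?L} v *\<^sub>R ?f v) =
    (of_nat h * of_nat k * (exp ((1 - a) * of_real ?L) / (1 - a))
      - of_nat h * (\<Sum>n=1..k*N. (exp (- a * of_real ?L) - exp (- a * of_real (ln (real n / real k)))) / (- a))
      - of_nat k * (\<Sum>m=1..h*N. (exp (- a * of_real ?L) - exp (- a * of_real (ln (real m / real h)))) / (- a))
      + (\<Sum>m=1..h*N. \<Sum>n=1..k*N. (exp (- (1 + a) * of_real ?L) - exp (- (1 + a) * of_real (max (ln (real m / real h)) (ln (real n / real k))))) / (- (1 + a))))"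
    by (rule has_bochner_integral_integral_eq)
  also have "(\<Sum>n=1..k*N. (exp (- a * of_real ?L) - exp (- a * of_real (ln (real n / real k)))) / (- a)) =
     (\<Sum>n=1..k*N. (of_real (real n / real k) powr (- a) - of_nat N powr (- a)) / a)"
    by (rule single[OF h(2)])
  also have "(\<Sum>m=1..h*N. (exp (- a * of_real ?L) - exp (- a * of_real (ln (real m / real h)))) / (- a)) =
     (\<Sum>m=1..h*N. (of_real (real m / real h) powr (- a) - of_nat N powr (- a)) / a)"
    by (rule single[OF h(1)])
  also have "(\<Sum>m=1..h*N. \<Sum>n=1..k*N. (exp (- (1 + a) * of_real ?L) - exp (- (1 + a) * of_real (max (ln (real m / real h)) (ln (real n / real k))))) / (- (1 + a))) =
     (\<Sum>m=1..h*N. \<Sum>n=1..k*N. (of_real (max (real m / real h) (real n / real k)) powr (- 1 - a) - of_nat N powr (- 1 - a)) / (1 + a))"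
  proof (intro sum.cong refl)
    fix m n assume mn: "m \<in> {1..h*N}" "n \<in> {1..k*N}"
    then have pos: "real m / real h > 0" "real n / real k > 0" using h by auto
    have "max (ln (real m / real h)) (ln (real n / real k)) = ln (max (real m / real h) (real n / real k))"
      using pos by (auto simp: max_def)
    moreover have "exp (- (1 + a) * of_real (ln (max (real m / real h) (real n / real k)))) = of_real (max (real m / real h) (real n / real k)) powr (- (1 + a))"
      by (rule exp_times_ln) (use pos in auto)
    moreover have "exp (- (1 + a) * of_real ?L) = of_real (real N) powr (- (1 + a))"
      by (rule exp_times_ln) (use N in auto)
    moreover have "- (1 + a) = - 1 - a" by simp
    moreover have "(X - Y) / (- (1 + a)) = (Y - X) / (1 + a)" for X Y
      by (metis minus_diff_eq minus_divide_divide)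
    ultimately show "(exp (- (1 + a) * of_real ?L) - exp (- (1 + a) * of_real (max (ln (real m / real h)) (ln (real n / real k))))) / (- (1 + a))
       = (of_real (max (real m / real h) (real n / real k)) powr (- 1 - a) - of_nat N powr (- 1 - a)) / (1 + a)"
      by (metis of_real_of_nat_eq)
  qed
  also have "exp ((1 - a) * of_real ?L) = of_nat N powr (1 - a)"
    by (subst exp_times_ln) (use N in auto)
  finally show ?thesis by (simp add: mult.assoc)
qed

section \<open>Evaluation and asymptotics of the cut-off sums\<close>

text \<open>Each pair is assigned to its larger fraction. For given \<open>m\<close>, the number of
  \<open>n\<close> with \<open>n / k \<le> m / h\<close> is the floor of \<open>k * m / h\<close>,
  written as argument minus fractional part; ties are counted twice and subtracted once. By
  coprimality the ties are the pairs \<open>(h * y, k * y)\<close>, with common value the integer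
  \<open>y\<close>.\<close>

lemma sum_max_fractions:
  fixes g :: "real \<Rightarrow> complex"
  assumes h: "h \<ge> 1" "k \<ge> 1" and cop: "coprime h k"
  shows "(\<Sum>m=1..h*N. \<Sum>n=1..k*N. g (max (real m / real h) (real n / real k))) =
     (\<Sum>m=1..h*N. of_real (real k * real m / real h - frac (real k * real m / real h)) * g (real m / real h))
   + (\<Sum>n=1..k*N. of_real (real h * real n / real k - frac (real h * real n / real k)) * g (real n / real k))
   - (\<Sum>y=1..N. g (real y))"
proof -
  have pt: "g (max (real m / real h) (real n / real k)) =
     of_bool (real n \<le> real k * real m / real h) * g (real m / real h) +
     of_bool (real m \<le> real h * real n / real k) * g (real n / real k) - of_bool (k * m = h * n) * g (real m / real h)" for m n
  proof -
    have 1: "real n \<le> real k * real m / real h \<longleftrightarrow> real n / real k \<le> real m / real h"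
         "real m \<le> real h * real n / real k \<longleftrightarrow> real m / real h \<le> real n / real k"
      using h by (simp_all add: field_simps)
    have "k * m = h * n \<longleftrightarrow> real (k * m) = real (h * n)" by linarith
    then have 2: "k * m = h * n \<longleftrightarrow> real m / real h = real n / real k"
      using h by (simp add: field_simps)
    show ?thesis unfolding 1 2 by (auto simp: max_def)
  qed
  have count: "(\<Sum>n=1..k*N. of_bool (real n \<le> real k * real m / real h) * G) = of_real (real k * real m / real h - frac (real k * real m / real h)) * G"
    if "m \<in> {1..h*N}" "h \<ge> 1" for h k m and G :: complex
  proof -
    have "real m \<le> real h * real N" using that by (metis atLeastAtMost_iff of_nat_le_iff of_nat_mult)
    then have "real k * real m \<le> real k * (real h * real N)" by (intro mult_left_mono) auto
    then have "real k * real m / real h \<le> real (k * N)" using that by (simp add: field_simps)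
    then have cnt: "(\<Sum>n=1..k*N. of_bool (real n \<le> real k * real m / real h)) = real k * real m / real h - frac (real k * real m / real h)"
      by (intro sum_of_bool_le_eq) auto
    have "(\<Sum>n=1..k*N. of_bool (real n \<le> real k * real m / real h) :: complex) = of_real (real k * real m / real h - frac (real k * real m / real h))"
      by (subst arg_cong[OF cnt[symmetric], of complex_of_real]) simp
    then show ?thesis by (simp flip: sum_distrib_right)
  qed
  have diag: "(\<Sum>m=1..h*N. \<Sum>n=1..k*N. of_bool (k * m = h * n) * g (real m / real h)) = (\<Sum>y=1..N. g (real y))"
  proof -
    have "(\<Sum>m=1..h*N. \<Sum>n=1..k*N. of_bool (k * m = h * n) * g (real m / real h)) =
          (\<Sum>(m, n)\<in>{1..h*N} \<times> {1..k*N}. of_bool (k * m = h * n) * g (real m / real h))"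
      by (rule sum.cartesian_product)
    also have "\<dots> = (\<Sum>(m, n)\<in>(\<lambda>y. (h * y, k * y)) ` {1..N}. g (real m / real h))"
    proof (rule sum.mono_neutral_cong_right)
      show "(\<lambda>y. (h * y, k * y)) ` {1..N} \<subseteq> {1..h*N} \<times> {1..k*N}" using h by (auto simp: Suc_le_eq)
      show "\<forall>i\<in>{1..h * N} \<times> {1..k * N} - (\<lambda>y. (h * y, k * y)) ` {1..N}. (case i of (m, n) \<Rightarrow> of_bool (k * m = h * n) * g (real m / real h)) = 0"
      proof
        fix i assume i: "i \<in> {1..h * N} \<times> {1..k * N} - (\<lambda>y. (h * y, k * y)) ` {1..N}"
        obtain m n where mn: "i = (m, n)" by (cases i)
        have "k * m \<noteq> h * n"
        proof
          assume eq: "k * m = h * n"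
          then have "h dvd k * m" by simp
          then have "h dvd m" using cop by (simp add: coprime_dvd_mult_right_iff)
          then obtain y where y: "m = h * y" by auto
          then have "n = k * y" using eq h by simp
          moreover have "y \<in> {1..N}" using i y mn h by (auto simp: Suc_le_eq)
          ultimately show False using i y mn by auto
        qed
        then show "(case i of (m, n) \<Rightarrow> of_bool (k * m = h * n) * g (real m / real h)) = 0" by (simp add: mn)
      qed
    qed auto
    also have "\<dots> = (\<Sum>y=1..N. g (real (h * y) / real h))"
      using h by (subst sum.reindex) (auto simp: inj_on_def)
    also have "\<dots> = (\<Sum>y=1..N. g (real y))" using h by simp
    finally show ?thesis .
  qed
  have "(\<Sum>m=1..h*N. \<Sum>n=1..k*N. g (max (real m / real h) (real n / real k))) =
     (\<Sum>m=1..h*N. \<Sum>n=1..k*N. of_bool (real n \<le> real k * real m / real h) * g (real m / real h))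
   + (\<Sum>m=1..h*N. \<Sum>n=1..k*N. of_bool (real m \<le> real h * real n / real k) * g (real n / real k))
   - (\<Sum>m=1..h*N. \<Sum>n=1..k*N. of_bool (k * m = h * n) * g (real m / real h))"
    unfolding pt by (simp add: sum.distrib sum_subtractf)
  also have "(\<Sum>m=1..h*N. \<Sum>n=1..k*N. of_bool (real n \<le> real k * real m / real h) * g (real m / real h)) =
      (\<Sum>m=1..h*N. of_real (real k * real m / real h - frac (real k * real m / real h)) * g (real m / real h))"
    by (intro sum.cong refl count) (use h in auto)
  also have "(\<Sum>m=1..h*N. \<Sum>n=1..k*N. of_bool (real m \<le> real h * real n / real k) * g (real n / real k)) =
      (\<Sum>n=1..k*N. of_real (real h * real n / real k - frac (real h * real n / real k)) * g (real n / real k))"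
    by (subst sum.swap, intro sum.cong refl count) (use h in auto)
  finally show ?thesis unfolding diag .
qed

text \<open>Residues run from 1 to \<open>h\<close> instead of 0 to \<open>h - 1\<close>, so that
  \<open>r / h\<close> is positive and can serve as a Hurwitz parameter.\<close>

lemma sum_blocks: "(\<Sum>m=1..h*N. F m) = (\<Sum>r=1..h. \<Sum>j<N. F (j * h + r))" for F :: "nat \<Rightarrow> complex"
proof (induction N)
  case (Suc N)
  have "(\<Sum>m=1..h*Suc N. F m) = (\<Sum>m=1..h*N. F m) + (\<Sum>m=h*N+1..h*N+h. F m)"
    using sum.ub_add_nat[of 1 "h*N" F h] by (simp add: algebra_simps)
  also have "(\<Sum>m=h*N+1..h*N+h. F m) = (\<Sum>r=1..h. F (N * h + r))"
    by (rule sum.reindex_bij_witness[of _ "\<lambda>r. N * h + r" "\<lambda>m. m - h * N"]) (auto simp: algebra_simps)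
  finally show ?case unfolding Suc.IH by (simp add: sum.distrib)
qed simp

lemma frac_mult_div_shift: "h \<ge> 1 \<Longrightarrow> frac (real k * real (j * h + r) / real h) = frac (real k * real r / real h)"
proof -
  assume "h \<ge> 1"
  then have "real k * real (j * h + r) / real h = real k * real r / real h + real (k * j)" by (simp add: field_simps)
  then show ?thesis unfolding frac_def by (simp del: of_nat_mult)
qed

lemma mult_div_not_Ints:
  assumes "coprime h k" "r \<in> {1..<h}"
  shows "real k * real r / real h \<notin> \<int>"
proof
  assume "real k * real r / real h \<in> \<int>"
  then obtain z where z: "real k * real r / real h = of_int z" by (auto elim: Ints_cases)
  then have "real_of_int (int k * int r) = of_int (z * int h)" using assms by (simp add: field_simps)
  then have "int k * int r = z * int h" by linarith
  then have "int h dvd int (k * r)" by simp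
  then have "h dvd k * r" by (simp only: int_dvd_int_iff)
  then have "h dvd r" using assms by (simp add: coprime_dvd_mult_right_iff)
  then show False using assms by (auto dest: dvd_imp_le)
qed

lemma frac_mult_div_reflect:
  assumes "coprime h k" "r \<in> {1..<h}"
  shows "frac (real k * real (h - r) / real h) = 1 - frac (real k * real r / real h)"
proof -
  have "real k * real (h - r) / real h = - (real k * real r / real h) + real k"
    using assms by (simp add: of_nat_diff field_simps)
  moreover have "\<lfloor>- (real k * real r / real h) + real k\<rfloor> = \<lfloor>- (real k * real r / real h)\<rfloor> + int k" by linarith
  ultimately have "frac (real k * real (h - r) / real h) = frac (- (real k * real r / real h))"
    unfolding frac_def by simp
  then show ?thesis using mult_div_not_Ints[OF assms] by (simp add: frac_neg)
qed

text \<open>The parts at \<open>r\<close> and \<open>h - r\<close> add up to 1, since by coprimality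
  none of the arguments is an integer. The value supplies the counterterm in
  \<open>sum_frac_powr_tendsto\<close>.\<close>

lemma sum_frac_mult_div:
  assumes "coprime h k" "h \<ge> 1"
  shows "(\<Sum>r\<in>{1..<h}. frac (real k * real r / real h)) = (real h - 1) / 2"
proof -
  have "(\<Sum>r\<in>{1..<h}. frac (real k * real r / real h)) = (\<Sum>r\<in>{1..<h}. frac (real k * real (h - r) / real h))"
    by (rule sum.reindex_bij_witness[of _ "\<lambda>r. h - r" "\<lambda>r. h - r"]) auto
  also have "\<dots> = (\<Sum>r\<in>{1..<h}. 1 - frac (real k * real r / real h))"
    by (intro sum.cong refl frac_mult_div_reflect assms) 
  also have "\<dots> = (real h - 1) - (\<Sum>r\<in>{1..<h}. frac (real k * real r / real h))"
    using assms by (simp add: sum_subtractf of_nat_diff)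
  finally show ?thesis by simp
qed


text \<open>The limit formula for \<open>zeta a\<close> along the subsequence \<open>k * N\<close>,
  multiplied by \<open>k powr a\<close>. As \<open>Re a\<close> may be negative or 0, the half term
  need not vanish and has to be carried along.\<close>

lemma sum_div_powr_tendsto:
  assumes a: "\<bar>Re a\<bar> < 1" "k \<ge> 1"
  shows "(\<lambda>N. (\<Sum>n=1..k*N. of_real (real n / real k) powr (- a)) - of_nat k * of_nat N powr (1 - a) / (1 - a) - of_nat N powr (- a) / 2)
     \<longlonglongrightarrow> of_nat k powr a * zeta a"
proof -
  have "a \<noteq> 1" using a by auto
  then have "(\<lambda>N. (\<Sum>n=1..N. of_nat n powr (- a)) - of_nat N powr (1 - a) / (1 - a) - of_nat N powr (- a) / 2) \<longlonglongrightarrow> zeta a"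
    using a by (intro zeta_tendsto_half) auto
  moreover have "strict_mono (\<lambda>N. k * N)" using a by (auto simp: strict_mono_def)
  ultimately have "(\<lambda>N. (\<Sum>n=1..k*N. of_nat n powr (- a)) - of_nat (k*N) powr (1 - a) / (1 - a) - of_nat (k*N) powr (- a) / 2) \<longlonglongrightarrow> zeta a"
    using LIMSEQ_subseq_LIMSEQ by (fastforce simp: o_def)
  then have lim: "(\<lambda>N. of_nat k powr a * ((\<Sum>n=1..k*N. of_nat n powr (- a)) - of_nat (k*N) powr (1 - a) / (1 - a) - of_nat (k*N) powr (- a) / 2)) \<longlonglongrightarrow> of_nat k powr a * zeta a"
    by (intro tendsto_mult tendsto_const)
  have eq: "of_nat k powr a * ((\<Sum>n=1..k*N. of_nat n powr (- a)) - of_nat (k*N) powr (1 - a) / (1 - a) - of_nat (k*N) powr (- a) / 2) =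
     (\<Sum>n=1..k*N. of_real (real n / real k) powr (- a)) - of_nat k * of_nat N powr (1 - a) / (1 - a) - of_nat N powr (- a) / 2" if "N \<ge> 1" for N
  proof -
    have "(\<Sum>n=1..k*N. complex_of_real (real n / real k) powr (- a)) = (\<Sum>n=1..k*N. of_nat k powr a * of_nat n powr (- a))"
      by (intro sum.cong refl, subst of_nat_div_powr) (use a in auto)
    moreover have "of_nat k powr a * of_nat (k*N) powr (- a) = complex_of_nat N powr (- a)"
      using of_nat_div_powr[of "k * N" k "-a"] a that by (simp add: mult.commute)
    moreover have "of_nat k powr a * of_nat (k*N) powr (1 - a) = of_nat k * complex_of_nat N powr (1 - a)"
    proof -
      have "complex_of_nat N powr (1 - a) = of_nat (k*N) powr (1 - a) * of_nat k powr (a - 1)"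
        using of_nat_div_powr[of "k * N" k "1-a"] a that by simp
      moreover have "of_nat k powr (a - 1) = of_nat k powr a / complex_of_nat k"
        using a by (simp add: powr_diff)
      ultimately show ?thesis using a by simp
    qed
    ultimately show ?thesis by (simp add: algebra_simps sum_distrib_left)
  qed
  show ?thesis
    by (rule Lim_transform_eventually[OF lim]) (rule eventually_mono[OF eventually_ge_at_top[of 1]], rule eq)
qed

text \<open>The fractional part depends only on \<open>m\<close> modulo \<open>h\<close>, so the sum
  splits into one truncated Hurwitz series per residue. Each series is corrected by
  \<open>N powr (- a) / a\<close>, and the weights sum to \<open>(h - 1) / 2\<close>.\<close>

lemma sum_frac_powr_tendsto:
  assumes a: "\<bar>Re a\<bar> < 1" "a \<noteq> 0" and h: "h \<ge> 1" and cop: "coprime h k"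
  shows "(\<lambda>N. (\<Sum>m=1..h*N. of_real (frac (real k * real m / real h)) * of_real (real m / real h) powr (- 1 - a)) + of_real ((real h - 1) / 2) * (of_nat N powr (- a) / a))
     \<longlonglongrightarrow> (\<Sum>r\<in>{1..<h}. of_real (frac (real k * real r / real h)) * hurwitz_zeta (real r / real h) (1 + a))"
proof -
  have blocks: "(\<Sum>m=1..h*N. of_real (frac (real k * real m / real h)) * of_real (real m / real h) powr (- 1 - a)) =
    (\<Sum>r\<in>{1..<h}. of_real (frac (real k * real r / real h)) * (\<Sum>j<N. of_real (real j + real r / real h) powr (- (1 + a))))" for N
  proof -
    have "(\<Sum>m=1..h*N. complex_of_real (frac (real k * real m / real h)) * of_real (real m / real h) powr (- 1 - a)) =
       (\<Sum>r=1..h. \<Sum>j<N. of_real (frac (real k * real r / real h)) * of_real (real j + real r / real h) powr (- (1 + a)))"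
      unfolding sum_blocks
    proof (intro sum.cong refl)
      fix r j
      have "real (j * h + r) / real h = real j + real r / real h" using h by (simp add: field_simps)
      moreover have "- (1 + a) = - 1 - a" by simp
      ultimately show "complex_of_real (frac (real k * real (j * h + r) / real h)) * of_real (real (j * h + r) / real h) powr (- 1 - a) =
          of_real (frac (real k * real r / real h)) * of_real (real j + real r / real h) powr (- (1 + a))"
        unfolding frac_mult_div_shift[OF h] by (simp only:)
    qed
    also have "\<dots> = (\<Sum>r=1..h. of_real (frac (real k * real r / real h)) * (\<Sum>j<N. of_real (real j + real r / real h) powr (- (1 + a))))"
      by (simp add: sum_distrib_left)
    \<comment> \<open>The residue \<open>r = h\<close> drops out: its argument is the integer
      \<open>k\<close>, with fractional part 0.\<close>
    also have "\<dots> = (\<Sum>r\<in>{1..<h}. of_real (frac (real k * real r / real h)) * (\<Sum>j<N. of_real (real j + real r / real h) powr (- (1 + a))))"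
      using h by (intro sum.mono_neutral_right) (auto simp: Suc_le_eq not_less)
    finally show ?thesis .
  qed
  have "(\<lambda>N. \<Sum>r\<in>{1..<h}. of_real (frac (real k * real r / real h)) * ((\<Sum>j<N. of_real (real j + real r / real h) powr (- (1 + a))) - of_real (real N) powr (1 - (1 + a)) / (1 - (1 + a))))
     \<longlonglongrightarrow> (\<Sum>r\<in>{1..<h}. of_real (frac (real k * real r / real h)) * hurwitz_zeta (real r / real h) (1 + a))"
    by (intro tendsto_intros hurwitz_zeta_tendsto) (use a h in auto)
  also have "(\<lambda>N. \<Sum>r\<in>{1..<h}. of_real (frac (real k * real r / real h)) * ((\<Sum>j<N. of_real (real j + real r / real h) powr (- (1 + a))) - of_real (real N) powr (1 - (1 + a)) / (1 - (1 + a))))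
    = (\<lambda>N. (\<Sum>m=1..h*N. of_real (frac (real k * real m / real h)) * of_real (real m / real h) powr (- 1 - a)) + of_real ((real h - 1) / 2) * (of_nat N powr (- a) / a))"
    unfolding blocks sum_frac_mult_div[OF cop h, symmetric]
    by (simp add: algebra_simps sum.distrib sum_distrib_left sum_distrib_right)
  finally show ?thesis .
qed

text \<open>The cut-off moment is regrouped into sums that each carry the counterterm for which a
  limit is known. The regrouping \<open>Jeq\<close> is exact for every \<open>N \<ge> 1\<close>, so
  powers of \<open>N\<close> that do not tend to 0 need no estimate.\<close>

lemma frac_moment_eq:
  assumes a: "\<bar>Re a\<bar> < 1" "a \<noteq> 0" and h: "h \<ge> 1" "k \<ge> 1" and cop: "coprime h k"
  shows "(1 + a) * frac_moment h k a = - (of_nat h * of_nat k powr a + of_nat k * of_nat h powr a) * zeta a / a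
     - (\<Sum>r\<in>{1..<h}. of_real (frac (real k * real r / real h)) * hurwitz_zeta (real r / real h) (1 + a))
     - (\<Sum>r\<in>{1..<k}. of_real (frac (real h * real r / real k)) * hurwitz_zeta (real r / real k) (1 + a))
     - zeta (1 + a)"
proof -
  have a1: "1 + a \<noteq> 0" "1 - a \<noteq> 0" using a by (auto simp: complex_eq_iff)
  define S where "S k N = (\<Sum>n=1..k*N. complex_of_real (real n / real k) powr (- a))" for k N :: nat
  define Q where "Q h k N = (\<Sum>m=1..h*N. complex_of_real (frac (real k * real m / real h)) * of_real (real m / real h) powr (- 1 - a))" for h k N :: nat
  define R where "R N = (\<Sum>y=1..N. complex_of_nat y powr (- (1 + a)))" for N
  define J where "J N = (LINT v|lborel. indicator {..ln (real N)} v *\<^sub>R (of_real (frac (real h * exp v) * frac (real k * exp v)) * exp (- (1 + a) * of_real v)))" for N :: nat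
  have Jeq: "(1 + a) * J N = - (of_nat h * (S k N - of_nat k * of_nat N powr (1 - a) / (1 - a) - of_nat N powr (- a) / 2)
       + of_nat k * (S h N - of_nat h * of_nat N powr (1 - a) / (1 - a) - of_nat N powr (- a) / 2)) / a
      - (Q h k N + of_real ((real h - 1) / 2) * (of_nat N powr (- a) / a))
      - (Q k h N + of_real ((real k - 1) / 2) * (of_nat N powr (- a) / a))
      - (R N - of_nat N powr (1 - (1 + a)) / (1 - (1 + a)))" if N: "N \<ge> 1" for N
  proof -
    have pw: "of_real (real m / real h) * of_real (real m / real h) powr (- 1 - a) = complex_of_real (real m / real h) powr (- a)" if "m \<ge> 1" "h \<ge> 1" for m h
    proof -
      have "complex_of_real (real m / real h) \<noteq> 0" using that by simp
      then have "complex_of_real (real m / real h) powr (1 + (- 1 - a)) = of_real (real m / real h) * of_real (real m / real h) powr (- 1 - a)"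
        by (subst powr_add) simp
      then show ?thesis by simp
    qed
    have T: "(\<Sum>m=1..h*N. of_real (real k * real m / real h - frac (real k * real m / real h)) * complex_of_real (real m / real h) powr (- 1 - a)) =
       of_nat k * S h N - Q h k N" if "h \<ge> 1" for h k
    proof -
      have "(\<Sum>m=1..h*N. of_real (real k * real m / real h - frac (real k * real m / real h)) * complex_of_real (real m / real h) powr (- 1 - a)) =
        (\<Sum>m=1..h*N. of_nat k * complex_of_real (real m / real h) powr (- a) - complex_of_real (frac (real k * real m / real h)) * of_real (real m / real h) powr (- 1 - a))"
      proof (intro sum.cong refl)
        fix m assume "m \<in> {1..h*N}"
        then have m: "m \<ge> 1" by simp
        show "of_real (real k * real m / real h - frac (real k * real m / real h)) * complex_of_real (real m / real h) powr (- 1 - a) =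
          of_nat k * complex_of_real (real m / real h) powr (- a) - complex_of_real (frac (real k * real m / real h)) * of_real (real m / real h) powr (- 1 - a)"
          unfolding pw[OF m that, symmetric] by (simp add: algebra_simps)
      qed
      then show ?thesis by (simp add: S_def Q_def sum_subtractf sum_distrib_left)
    qed
    have "(\<Sum>m=1..h*N. \<Sum>n=1..k*N. (of_real (max (real m / real h) (real n / real k)) powr (- 1 - a) - of_nat N powr (- 1 - a)) / (1 + a)) =
        ((\<Sum>m=1..h*N. \<Sum>n=1..k*N. (\<lambda>y. of_real y powr (- 1 - a)) (max (real m / real h) (real n / real k))) - of_nat (h * N) * (of_nat (k * N) * of_nat N powr (- 1 - a))) / (1 + a)"
      by (simp add: sum_subtractf flip: sum_divide_distrib)
    also have "(\<Sum>m=1..h*N. \<Sum>n=1..k*N. (\<lambda>y. of_real y powr (- 1 - a)) (max (real m / real h) (real n / real k))) =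
       (of_nat k * S h N - Q h k N) + (of_nat h * S k N - Q k h N) - R N"
      by (subst sum_max_fractions[OF h cop, where g = "\<lambda>y. of_real y powr (- 1 - a)"], subst T[OF h(1)], subst T[OF h(2)])
         (simp add: R_def)
    also have "of_nat (h * N) * (of_nat (k * N) * of_nat N powr (- 1 - a)) = of_nat h * of_nat k * (complex_of_nat N powr (1 - a))"
    proof -
      have "complex_of_nat N powr (1 - a) = of_nat N powr (1 + (1 + (- 1 - a)))" by simp
      also have "\<dots> = of_nat N * (of_nat N * of_nat N powr (- 1 - a))"
        using N by (subst powr_add, subst powr_add) simp
      finally show ?thesis by simp
    qed
    finally have dbl: "(\<Sum>m=1..h*N. \<Sum>n=1..k*N. (of_real (max (real m / real h) (real n / real k)) powr (- 1 - a) - of_nat N powr (- 1 - a)) / (1 + a)) =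
       ((of_nat k * S h N - Q h k N) + (of_nat h * S k N - Q k h N) - R N - of_nat h * of_nat k * (complex_of_nat N powr (1 - a))) / (1 + a)" .
    have sgl: "(\<Sum>n=1..k*N. (of_real (real n / real k) powr (- a) - of_nat N powr (- a)) / a) = (S k N - of_nat k * of_nat N powr (1 - a)) / a" for k
    proof -
      have "complex_of_nat N powr (1 - a) = of_nat N powr (1 + (- a))" by simp
      also have "\<dots> = of_nat N * of_nat N powr (- a)" using N by (subst powr_add) simp
      finally show ?thesis by (simp add: S_def sum_subtractf mult.assoc flip: sum_divide_distrib)
    qed
    have Jv: "J N = of_nat h * of_nat k * of_nat N powr (1 - a) / (1 - a) - of_nat h * ((S k N - of_nat k * of_nat N powr (1 - a)) / a)
       - of_nat k * ((S h N - of_nat h * of_nat N powr (1 - a)) / a)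
       + ((of_nat k * S h N - Q h k N) + (of_nat h * S k N - Q k h N) - R N - of_nat h * of_nat k * (complex_of_nat N powr (1 - a))) / (1 + a)"
      unfolding J_def integral_frac_moment_atMost[OF a h N] sgl dbl ..
    \<comment> \<open>\<open>X\<close> is \<open>N powr (1 - a)\<close> and \<open>Y\<close> is
      \<open>N powr (- a)\<close>. The coefficients of \<open>X\<close> agree on both sides; on the
      right those of \<open>Y / a\<close> add up to
      \<open>(H + K) / 2 - (H - 1) / 2 - (K - 1) / 2 - 1 = 0\<close>, the last \<open>- 1\<close>
      coming from the ties in the double sum.\<close>
    have alg: "(1 + a) * (H * K * X / (1 - a) - H * ((Sk - K * X) / a) - K * ((Sh - H * X) / a)
        + ((K * Sh - Q1) + (H * Sk - Q2) - RR - H * K * X) / (1 + a)) =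
       - (H * (Sk - K * X / (1 - a) - Y / 2) + K * (Sh - H * X / (1 - a) - Y / 2)) / a
        - (Q1 + ((H - 1) / 2) * (Y / a)) - (Q2 + ((K - 1) / 2) * (Y / a)) - (RR - Y / (1 - (1 + a)))"
      for H K X Y Sh Sk Q1 Q2 RR :: complex
    proof -
      have "(1 + a) * (H * K * X / (1 - a) - H * ((Sk - K * X) / a) - K * ((Sh - H * X) / a)
        + ((K * Sh - Q1) + (H * Sk - Q2) - RR - H * K * X) / (1 + a)) =
        (1 + a) * (H * K * X / (1 - a) - H * ((Sk - K * X) / a) - K * ((Sh - H * X) / a))
        + ((K * Sh - Q1) + (H * Sk - Q2) - RR - H * K * X)"
        using a1 by (simp add: distrib_left)
      also have "\<dots> = - (H * (Sk - K * X / (1 - a) - Y / 2) + K * (Sh - H * X / (1 - a) - Y / 2)) / a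
        - (Q1 + ((H - 1) / 2) * (Y / a)) - (Q2 + ((K - 1) / 2) * (Y / a)) - (RR + Y / a)"
        using a1 a by (simp add: divide_simps) algebra
      finally show ?thesis by simp
    qed
    have ex: "- a = 1 - (1 + a)" by simp
    have cst: "complex_of_real ((real h - 1) / 2) = (of_nat h - 1) / 2" "complex_of_real ((real k - 1) / 2) = (of_nat k - 1) / 2" by simp_all
    show ?thesis unfolding Jv cst ex[symmetric]
      using alg[of "of_nat h" "of_nat k" "of_nat N powr (1 - a)" "S k N" "S h N" "Q h k N" "Q k h N" "R N" "of_nat N powr (- a)"]
      by simp
  qed
  have "J \<longlonglongrightarrow> frac_moment h k a"
    unfolding J_def frac_moment_def by (intro integral_atMost_ln_tendsto integrable_frac_moment a h)
  then have "(\<lambda>N. (1 + a) * J N) \<longlonglongrightarrow> (1 + a) * frac_moment h k a" by (intro tendsto_intros)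
  then have "(\<lambda>N. - (of_nat h * (S k N - of_nat k * of_nat N powr (1 - a) / (1 - a) - of_nat N powr (- a) / 2)
       + of_nat k * (S h N - of_nat h * of_nat N powr (1 - a) / (1 - a) - of_nat N powr (- a) / 2)) / a
      - (Q h k N + of_real ((real h - 1) / 2) * (of_nat N powr (- a) / a))
      - (Q k h N + of_real ((real k - 1) / 2) * (of_nat N powr (- a) / a))
      - (R N - of_nat N powr (1 - (1 + a)) / (1 - (1 + a)))) \<longlonglongrightarrow> (1 + a) * frac_moment h k a"
    by (rule Lim_transform_eventually) (rule eventually_mono[OF eventually_ge_at_top[of 1]], rule Jeq)
  moreover have "(\<lambda>N. - (of_nat h * (S k N - of_nat k * of_nat N powr (1 - a) / (1 - a) - of_nat N powr (- a) / 2)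
       + of_nat k * (S h N - of_nat h * of_nat N powr (1 - a) / (1 - a) - of_nat N powr (- a) / 2)) / a
      - (Q h k N + of_real ((real h - 1) / 2) * (of_nat N powr (- a) / a))
      - (Q k h N + of_real ((real k - 1) / 2) * (of_nat N powr (- a) / a))
      - (R N - of_nat N powr (1 - (1 + a)) / (1 - (1 + a)))) \<longlonglongrightarrow>
     - (of_nat h * (of_nat k powr a * zeta a) + of_nat k * (of_nat h powr a * zeta a)) / a
     - (\<Sum>r\<in>{1..<h}. of_real (frac (real k * real r / real h)) * hurwitz_zeta (real r / real h) (1 + a))
     - (\<Sum>r\<in>{1..<k}. of_real (frac (real h * real r / real k)) * hurwitz_zeta (real r / real k) (1 + a))
     - zeta (1 + a)"
    unfolding S_def Q_def R_def
    by (rule tendsto_diff tendsto_divide tendsto_minus tendsto_add tendsto_mult_left sum_div_powr_tendsto sum_frac_powr_tendsto zeta_tendsto tendsto_const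
         a(1) a(2) h(1) h(2) cop | (use a h cop in \<open>simp add: coprime_commute; fail\<close>))+
  ultimately have "(1 + a) * frac_moment h k a =
     - (of_nat h * (of_nat k powr a * zeta a) + of_nat k * (of_nat h powr a * zeta a)) / a
     - (\<Sum>r\<in>{1..<h}. of_real (frac (real k * real r / real h)) * hurwitz_zeta (real r / real h) (1 + a))
     - (\<Sum>r\<in>{1..<k}. of_real (frac (real h * real r / real k)) * hurwitz_zeta (real r / real k) (1 + a))
     - zeta (1 + a)"
    by (rule LIMSEQ_unique)
  then show ?thesis by (simp add: algebra_simps)
qed

section \<open>The odd part of Hurwitz's formula\<close>

text \<open>Euler's integral under \<open>t = exp u\<close>, followed by a shift of \<open>u\<close>
  by \<open>ln c\<close>. The endpoint 0 is removed beforehand, since \<open>exp\<close> reaches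
  only the open half-line.\<close>

lemma has_bochner_integral_Gamma_exp:
  assumes s: "s > (0::real)" and c: "c > 0"
  shows "has_bochner_integral lborel (\<lambda>u. exp (s * u - c * exp u)) (Gamma s * c powr (- s))"
proof -
  have G: "((\<lambda>t. t powr (s - 1) / exp t) has_integral Gamma s) {0<..}"
  proof -
    have "((\<lambda>t. t powr (s - 1) / exp t) has_integral Gamma s) {0..} \<longleftrightarrow> ((\<lambda>t. t powr (s - 1) / exp t) has_integral Gamma s) {0<..}"
      by (rule has_integral_spike_set_eq; rule negligible_subset[of "{0}"]) auto
    then show ?thesis using Gamma_integral_real[OF s] by simp
  qed
  then have "(\<lambda>t. t powr (s - 1) / exp t) absolutely_integrable_on {0<..} \<and> integral {0<..} (\<lambda>t. t powr (s - 1) / exp t) = Gamma s"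
    by (auto intro!: nonnegative_absolutely_integrable_1 simp: integrable_on_def integral_unique)
  moreover have "range (exp :: real \<Rightarrow> real) = {0<..}" by (auto simp: image_iff) (metis exp_ln)
  ultimately have "(\<lambda>x. \<bar>exp x\<bar> * (exp x powr (s - 1) / exp (exp x))) absolutely_integrable_on UNIV \<and>
     integral UNIV (\<lambda>x. \<bar>exp x\<bar> * (exp x powr (s - 1) / exp (exp x))) = Gamma s"
    by (subst has_absolute_integral_change_of_variables_1'[where g = exp and g' = exp]) (auto intro!: derivative_eq_intros simp: inj_on_def)
  moreover have "(\<lambda>x. \<bar>exp x\<bar> * (exp x powr (s - 1) / exp (exp x))) = (\<lambda>u. exp (s * u - exp u))"
  proof
    fix x :: real
    have "exp x * exp x powr (s - 1) = exp (x + (s - 1) * x)" unfolding exp_add by (simp add: powr_def)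
    also have "x + (s - 1) * x = s * x" by (simp add: algebra_simps)
    finally show "\<bar>exp x\<bar> * (exp x powr (s - 1) / exp (exp x)) = exp (s * x - exp x)" by (simp add: exp_diff)
  qed
  ultimately have "((\<lambda>u. exp (s * u - exp u)) has_integral Gamma s) UNIV"
    by (metis has_integral_integral set_lebesgue_integral_eq_integral(1))
  then have "integral\<^sup>N lborel (\<lambda>u. exp (s * u - exp u)) = Gamma s"
    by (intro nn_integral_has_integral_lborel) auto
  then have "has_bochner_integral lborel (\<lambda>u. exp (s * u - exp u)) (Gamma s)"
    using s by (intro has_bochner_integral_nn_integral) (auto simp: Gamma_real_pos less_imp_le)
  then have "has_bochner_integral lborel (\<lambda>u. exp (s * (ln c + 1 * u) - exp (ln c + 1 * u))) (Gamma s /\<^sub>R \<bar>1\<bar>)"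
    by (subst (asm) lborel_has_bochner_integral_real_affine_iff[of 1 _ _ "ln c"]) auto
  then have "has_bochner_integral lborel (\<lambda>u. c powr (- s) * exp (s * (ln c + 1 * u) - exp (ln c + 1 * u))) (c powr (- s) * (Gamma s /\<^sub>R \<bar>1\<bar>))"
    by (rule has_bochner_integral_mult_right)
  moreover have "c powr (- s) * exp (s * (ln c + 1 * u) - exp (ln c + 1 * u)) = exp (s * u - c * exp u)" for u
  proof -
    have 1: "exp (ln c + 1 * u) = c * exp u" using c by (simp add: exp_add)
    have 2: "c powr (- s) = exp (- (s * ln c))" using c by (simp add: powr_def)
    show ?thesis unfolding 1 2 exp_add[symmetric] by (simp add: algebra_simps)
  qed
  ultimately show ?thesis by (simp add: mult.commute)
qed

text \<open>For \<open>c = 1\<close> the factor \<open>1 / (1 + exp (2 * u))\<close> is itself an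
  Euler integral in a second variable \<open>v\<close>. All integrands are positive, so Tonelli
  applies; the integral in \<open>u\<close> gives \<open>Gamma (s / 2)\<close>, the one in
  \<open>v\<close> gives \<open>Gamma (1 - s / 2)\<close>, and the reflection formula produces the
  sine. Shifting \<open>u\<close> by \<open>ln c\<close> gives the general case.\<close>

lemma has_bochner_integral_mellin_quadratic:
  assumes s: "0 < s" "s < (2::real)" and c: "c > 0"
  shows "has_bochner_integral lborel (\<lambda>u. exp (s * u) / (c\<^sup>2 + exp (2 * u))) (c powr (s - 2) * (pi / (2 * sin (pi * s / 2))))"
proof -
  have nnG: "(\<integral>\<^sup>+u. ennreal (exp (s * u - c * exp u)) \<partial>lborel) = ennreal (Gamma s * c powr (- s))" if "s > 0" "c > 0" for s c :: real
    using has_bochner_integral_Gamma_exp[OF that] by (subst nn_integral_eq_integral) (auto simp: has_bochner_integral_iff)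
  have half: "(\<integral>\<^sup>+u. ennreal (exp (s * u - c * exp (2 * u))) \<partial>lborel) = ennreal (1 / 2 * (Gamma (s / 2) * c powr (- (s / 2))))" if "c > 0" for c
  proof -
    have "has_bochner_integral lborel (\<lambda>u. exp (s / 2 * (0 + 2 * u) - c * exp (0 + 2 * u))) ((Gamma (s / 2) * c powr (- (s / 2))) /\<^sub>R \<bar>2\<bar>)"
      using has_bochner_integral_Gamma_exp[of "s/2" c] s that
      by (subst (asm) lborel_has_bochner_integral_real_affine_iff[of 2 _ _ 0]) auto
    moreover have "(\<lambda>u. exp (s / 2 * (0 + 2 * u) - c * exp (0 + 2 * u))) = (\<lambda>u. exp (s * u - c * exp (2 * u)))" by simp
    moreover have "(Gamma (s / 2) * c powr (- (s / 2))) /\<^sub>R \<bar>2\<bar> = 1 / 2 * (Gamma (s / 2) * c powr (- (s / 2)))" by simp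
    ultimately have "has_bochner_integral lborel (\<lambda>u. exp (s * u - c * exp (2 * u))) (1 / 2 * (Gamma (s / 2) * c powr (- (s / 2))))"
      by (simp only:)
    then show ?thesis by (subst nn_integral_eq_integral) (auto simp only: has_bochner_integral_iff exp_ge_zero intro!: AE_I2)
  qed
  have "(\<integral>\<^sup>+u. ennreal (exp (s * u) / (1 + exp (2 * u))) \<partial>lborel) =
        (\<integral>\<^sup>+u. \<integral>\<^sup>+v. ennreal (exp (s * u) * exp (v - (1 + exp (2 * u)) * exp v)) \<partial>lborel \<partial>lborel)"
  proof (rule nn_integral_cong)
    fix u :: real
    have p: "1 + exp (2 * u) > 0" by (simp add: add_pos_pos)
    have "(\<integral>\<^sup>+v. ennreal (exp (s * u) * exp (v - (1 + exp (2 * u)) * exp v)) \<partial>lborel) =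
       ennreal (exp (s * u)) * (\<integral>\<^sup>+v. ennreal (exp (1 * v - (1 + exp (2 * u)) * exp v)) \<partial>lborel)"
      by (subst nn_integral_cmult[symmetric]) (auto simp: ennreal_mult')
    also have "\<dots> = ennreal (exp (s * u) * (1 + exp (2 * u)) powr (- 1))"
      by (subst nnG) (use p in \<open>auto simp flip: ennreal_mult'\<close>)
    also have "exp (s * u) * (1 + exp (2 * u)) powr (- 1) = exp (s * u) / (1 + exp (2 * u))"
      using p by (simp add: powr_minus_divide)
    finally show "ennreal (exp (s * u) / (1 + exp (2 * u))) = (\<integral>\<^sup>+v. ennreal (exp (s * u) * exp (v - (1 + exp (2 * u)) * exp v)) \<partial>lborel)" ..
  qed
  also have "\<dots> = (\<integral>\<^sup>+v. \<integral>\<^sup>+u. ennreal (exp (s * u) * exp (v - (1 + exp (2 * u)) * exp v)) \<partial>lborel \<partial>lborel)"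
    by (rule lborel_pair.Fubini') measurable
  also have "\<dots> = (\<integral>\<^sup>+v. ennreal (1 / 2 * Gamma (s / 2)) * ennreal (exp ((1 - s / 2) * v - 1 * exp v)) \<partial>lborel)"
  proof (rule nn_integral_cong)
    fix v :: real
    have "(\<integral>\<^sup>+u. ennreal (exp (s * u) * exp (v - (1 + exp (2 * u)) * exp v)) \<partial>lborel) =
       (\<integral>\<^sup>+u. ennreal (exp (v - exp v)) * ennreal (exp (s * u - exp v * exp (2 * u))) \<partial>lborel)"
      by (intro nn_integral_cong) (simp add: algebra_simps flip: exp_add ennreal_mult')
    also have "\<dots> = ennreal (exp (v - exp v)) * ennreal (1 / 2 * (Gamma (s / 2) * exp v powr (- (s / 2))))"
      by (subst nn_integral_cmult) (simp_all only: half exp_gt_zero, measurable)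
    also have "\<dots> = ennreal (1 / 2 * Gamma (s / 2)) * ennreal (exp ((1 - s / 2) * v - 1 * exp v))"
    proof -
      have "exp (v - exp v) * exp v powr (- (s / 2)) = exp ((1 - s / 2) * v - 1 * exp v)"
        by (simp add: powr_def algebra_simps flip: exp_add)
      then have "exp (v - exp v) * (1 / 2 * (Gamma (s / 2) * exp v powr (- (s / 2)))) = 1 / 2 * Gamma (s / 2) * exp ((1 - s / 2) * v - 1 * exp v)"
        by simp
      moreover have "Gamma (s / 2) > 0" using s by (simp add: Gamma_real_pos)
      ultimately show ?thesis by (simp flip: ennreal_mult)
    qed
    finally show "(\<integral>\<^sup>+u. ennreal (exp (s * u) * exp (v - (1 + exp (2 * u)) * exp v)) \<partial>lborel) = ennreal (1 / 2 * Gamma (s / 2)) * ennreal (exp ((1 - s / 2) * v - 1 * exp v))" .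
  qed
  also have "\<dots> = ennreal (1 / 2 * Gamma (s / 2)) * ennreal (Gamma (1 - s / 2) * 1 powr (- (1 - s / 2)))"
    by (subst nn_integral_cmult) (use s in \<open>simp_all only: nnG\<close>, simp_all)
  also have "\<dots> = ennreal (1 / 2 * (Gamma (s / 2) * Gamma (1 - s / 2)))"
    using s by (simp add: Gamma_real_pos less_imp_le flip: ennreal_mult)
  also have "Gamma (s / 2) * Gamma (1 - s / 2) = pi / sin (pi * s / 2)"
  proof -
    have "complex_of_real (Gamma (s / 2) * Gamma (1 - s / 2)) = of_real (pi / sin (pi * s / 2))"
      using Gamma_reflection_complex[of "of_real (s / 2)"]
      by (simp add: Gamma_complex_of_real[symmetric] sin_of_real[symmetric])
    then show ?thesis by (simp only: of_real_eq_iff)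
  qed
  finally have "has_bochner_integral lborel (\<lambda>u. exp (s * u) / (1 + exp (2 * u))) (1 / 2 * (pi / sin (pi * s / 2)))"
  proof (intro has_bochner_integral_nn_integral)
    have "sin (pi * s / 2) > 0" using s by (intro sin_gt_zero) auto
    then show "0 \<le> 1 / 2 * (pi / sin (pi * s / 2))" by simp
    show "AE u in lborel. 0 \<le> exp (s * u) / (1 + exp (2 * u))" by (simp add: add_pos_pos less_imp_le)
  qed auto
  then have "has_bochner_integral lborel (\<lambda>u. exp (s * (- ln c + 1 * u)) / (1 + exp (2 * (- ln c + 1 * u)))) ((1 / 2 * (pi / sin (pi * s / 2))) /\<^sub>R \<bar>1\<bar>)"
    by (subst (asm) lborel_has_bochner_integral_real_affine_iff[of 1 _ _ "- ln c"]) auto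
  then have "has_bochner_integral lborel (\<lambda>u. c powr (s - 2) * (exp (s * (- ln c + 1 * u)) / (1 + exp (2 * (- ln c + 1 * u))))) (c powr (s - 2) * ((1 / 2 * (pi / sin (pi * s / 2))) /\<^sub>R \<bar>1\<bar>))"
    by (rule has_bochner_integral_mult_right)
  moreover have "c powr (s - 2) * (exp (s * (- ln c + 1 * u)) / (1 + exp (2 * (- ln c + 1 * u)))) = exp (s * u) / (c\<^sup>2 + exp (2 * u))" for u
  proof -
    have e: "exp (- (2 * ln c)) = 1 / c\<^sup>2" "exp (- (s * ln c)) = c powr (- s)"
      using c by (simp_all add: powr_def exp_minus exp_double inverse_eq_divide power_one_over)
    have "c powr (s - 2) * c powr (- s) = 1 / c\<^sup>2"
    proof -
      have "c powr (s - 2) * c powr (- s) = c powr (s - 2 + - s)" by (rule powr_add[symmetric])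
      also have "s - 2 + - s = - 2" by simp
      finally show ?thesis using c by (simp add: powr_minus_divide)
    qed
    moreover have "exp (s * (- ln c + 1 * u)) = c powr (- s) * exp (s * u)"
      unfolding e(2)[symmetric] exp_add[symmetric] by (simp add: algebra_simps)
    moreover have "exp (2 * (- ln c + 1 * u)) = exp (2 * u) / c\<^sup>2"
      using e(1) by (simp add: algebra_simps exp_diff exp_minus field_simps)
    ultimately have "c powr (s - 2) * (exp (s * (- ln c + 1 * u)) / (1 + exp (2 * (- ln c + 1 * u)))) = (1 / c\<^sup>2) * exp (s * u) / (1 + exp (2 * u) / c\<^sup>2)"
      by (metis mult.assoc times_divide_eq_right)
    also have "\<dots> = exp (s * u) / (c\<^sup>2 + exp (2 * u))"
      using c by (simp add: field_simps)
    finally show ?thesis .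
  qed
  ultimately show ?thesis by simp
qed

section \<open>Two expansions of the cotangent\<close>

text \<open>Logarithmic derivative of the reflection formula
  \<open>Gamma z * Gamma (1 - z) = pi / sin (pi * z)\<close>.\<close>

lemma Digamma_reflection:
  assumes "sin (of_real pi * z) \<noteq> (0::complex)"
  shows "Digamma (1 - z) - Digamma z = of_real pi * cot (of_real pi * z)"
proof -
  have nz: "z \<notin> \<int>\<^sub>\<le>\<^sub>0" "1 - z \<notin> \<int>\<^sub>\<le>\<^sub>0"
  proof -
    have "z \<notin> \<int>" using assms by (metis Ints_cases of_real_of_int_eq sin_of_real sin_npi_int mult.commute of_real_mult of_real_0)
    then show "z \<notin> \<int>\<^sub>\<le>\<^sub>0" "1 - z \<notin> \<int>\<^sub>\<le>\<^sub>0"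
      by (metis nonpos_Ints_Int, metis nonpos_Ints_Int Ints_diff Ints_1 diff_diff_eq2 add_diff_cancel_left')
  qed
  have "((\<lambda>z. Gamma z * Gamma (1 - z)) has_field_derivative Gamma z * Gamma (1 - z) * (Digamma z - Digamma (1 - z))) (at z)"
    using nz by (auto intro!: derivative_eq_intros simp: algebra_simps)
  moreover have "((\<lambda>z. of_real pi / sin (of_real pi * z)) has_field_derivative
      - (of_real pi * (cos (of_real pi * z) * of_real pi)) / (sin (of_real pi * z))\<^sup>2) (at z)"
    using assms by (auto intro!: derivative_eq_intros simp: power2_eq_square)
  moreover have "(\<lambda>z. Gamma z * Gamma (1 - z)) = (\<lambda>z::complex. of_real pi / sin (of_real pi * z))"
    by (intro ext Gamma_reflection_complex)
  ultimately have eq: "of_real pi / sin (of_real pi * z) * (Digamma z - Digamma (1 - z)) = - (of_real pi * (cos (of_real pi * z) * of_real pi)) / (sin (of_real pi * z))\<^sup>2"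
    using DERIV_unique Gamma_reflection_complex[of z] by metis
  have solve: "X = - (P * (C / S))" if "P / S * X = - (P * (C * P)) / S\<^sup>2" "S \<noteq> 0" "P \<noteq> 0" for X P C S :: complex
  proof -
    have "X = (S / P) * (P / S * X)" using that(2,3) by simp
    also have "\<dots> = - (P * (C / S))" unfolding that(1) using that(2,3) by (simp add: field_simps power2_eq_square)
    finally show ?thesis .
  qed
  have "Digamma z - Digamma (1 - z) = - (of_real pi * (cos (of_real pi * z) / sin (of_real pi * z)))"
    by (rule solve[OF eq]) (use assms in auto)
  then show ?thesis unfolding cot_def by (metis minus_diff_eq minus_minus)
qed


text \<open>In the upper half-plane the exponential has modulus below 1, so this form leads to a
  geometric series.\<close>

lemma cot_conv_exp:
  assumes "exp (2 * \<i> * (of_real pi * z)) \<noteq> (1::complex)"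
  shows "cot (of_real pi * z) = \<i> - 2 * \<i> / (1 - exp (2 * \<i> * (of_real pi * z)))" and "sin (of_real pi * z) \<noteq> 0"
proof -
  define e where "e = exp (\<i> * (of_real pi * z))"
  have e0: "e \<noteq> 0" by (simp add: e_def)
  have w: "exp (2 * \<i> * (of_real pi * z)) = e\<^sup>2" unfolding e_def power2_eq_square exp_add[symmetric] by (rule arg_cong[of _ _ exp]) simp
  have em: "exp (- (\<i> * (of_real pi * z))) = 1 / e" by (simp add: e_def exp_minus inverse_eq_divide)
  have c: "cos (of_real pi * z) = (e + 1 / e) / 2" unfolding cos_exp_eq em by (simp add: e_def)
  have s: "sin (of_real pi * z) = (e - 1 / e) / (2 * \<i>)" unfolding sin_exp_eq em by (simp add: e_def)
  have e1: "e\<^sup>2 \<noteq> 1" using assms w by simp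
  then show s0: "sin (of_real pi * z) \<noteq> 0" unfolding s using e0 by (auto simp: field_simps power2_eq_square)
  have "cot (of_real pi * z) = \<i> * (e + 1 / e) / (e - 1 / e)" 
  proof -
    have "X / 2 / (Y / (2 * \<i>)) = \<i> * X / Y" for X Y :: complex
      by (cases "Y = 0") (auto simp: field_simps)
    then show ?thesis unfolding cot_def c s .
  qed
  also have "\<dots> = \<i> * ((e + 1 / e) * e) / ((e - 1 / e) * e)" using e0 by simp
  also have "\<dots> = \<i> * (e\<^sup>2 + 1) / (e\<^sup>2 - 1)" using e0 by (simp add: algebra_simps power2_eq_square)
  also have "\<dots> = \<i> - 2 * \<i> / (1 - e\<^sup>2)" using e1 by (simp add: divide_simps) (simp add: algebra_simps)
  finally show "cot (of_real pi * z) = \<i> - 2 * \<i> / (1 - exp (2 * \<i> * (of_real pi * z)))" unfolding w .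
qed

text \<open>The real part of \<open>pi * cot (pi * z)\<close> at \<open>z = x + \<i> * t\<close>.
  Subtracting the Digamma series at \<open>z\<close> from that at \<open>1 - z\<close> cancels the
  convergence terms \<open>1 / (n + 1)\<close> and leaves the pairs
  \<open>1 / (z + n) - 1 / (1 - z + n)\<close>.\<close>

lemma partial_fractions_sums:
  assumes t: "t > 0"
  shows "(\<lambda>n. (x + real n) / ((x + real n)\<^sup>2 + t\<^sup>2) - (1 - x + real n) / ((1 - x + real n)\<^sup>2 + t\<^sup>2))
     sums (2 * pi * Im (1 / (1 - of_real (exp (- (2 * pi * t))) * cis (2 * pi * x))))"
proof -
  define z where "z = Complex x t"
  define w where "w = of_real (exp (- (2 * pi * t))) * cis (2 * pi * x)"
  have ew: "exp (2 * \<i> * (of_real pi * z)) = w"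
    unfolding w_def z_def by (simp add: exp_eq_polar complex_eq_iff mult_ac)
  have "norm w < 1" using t by (simp add: w_def norm_mult)
  then have w1: "w \<noteq> 1" by auto
  note cot = cot_conv_exp[of z, unfolded ew, OF w1]
  have z0: "z \<noteq> 0" "1 - z \<noteq> 0" using t by (auto simp: z_def complex_eq_iff)
  have "(\<lambda>n. (inverse (of_nat (Suc n)) - inverse (1 - z + of_nat n)) - (inverse (of_nat (Suc n)) - inverse (z + of_nat n)))
     sums ((Digamma (1 - z) + euler_mascheroni) - (Digamma z + euler_mascheroni))"
    unfolding Digamma_def using summable_Digamma[OF z0(1)] summable_Digamma[OF z0(2)]
    by (intro sums_diff) (simp_all add: summable_sums)
  then have "(\<lambda>n. inverse (z + of_nat n) - inverse (1 - z + of_nat n)) sums (of_real pi * cot (of_real pi * z))"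
    using Digamma_reflection[OF cot(2)] by simp
  then have "(\<lambda>n. Re (inverse (z + of_nat n) - inverse (1 - z + of_nat n))) sums Re (of_real pi * cot (of_real pi * z))"
    by (rule sums_Re)
  moreover have "Re (inverse (z + of_nat n) - inverse (1 - z + of_nat n)) = (x + real n) / ((x + real n)\<^sup>2 + t\<^sup>2) - (1 - x + real n) / ((1 - x + real n)\<^sup>2 + t\<^sup>2)" for n
    by (simp add: z_def)
  moreover have "Re (of_real pi * cot (of_real pi * z)) = 2 * pi * Im (1 / (1 - w))"
    unfolding cot(1) by (simp add: Re_divide Im_divide)
  ultimately show ?thesis unfolding w_def by (simp only:)
qed

lemma sin_reflect_mod:
  assumes "n \<le> h" "h \<ge> 1"
  shows "sin (2 * pi * real m * real (h - n) / real h) = - sin (2 * pi * real m * real n / real h)"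
proof -
  have "2 * pi * real m * real (h - n) / real h = real m * (2 * pi) - 2 * pi * real m * real n / real h"
    using assms by (simp add: of_nat_diff field_simps)
  then show ?thesis using sin_npi[of "2 * m"] cos_npi[of "2 * m"] by (simp add: sin_diff mult_ac)
qed

lemma sum_sin_mod:
  assumes "h \<ge> 1"
  shows "(\<Sum>n\<in>{1..<h}. sin (2 * pi * real m * real n / real h)) = 0"
proof -
  have "(\<Sum>n\<in>{1..<h}. sin (2 * pi * real m * real n / real h)) = (\<Sum>n\<in>{1..<h}. sin (2 * pi * real m * real (h - n) / real h))"
    by (rule sum.reindex_bij_witness[of _ "\<lambda>r. h - r" "\<lambda>r. h - r"]) auto
  also have "\<dots> = (\<Sum>n\<in>{1..<h}. - sin (2 * pi * real m * real n / real h))"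
    by (intro sum.cong refl sin_reflect_mod) (use assms in auto)
  finally show ?thesis by (simp add: sum_negf)
qed

text \<open>The imaginary part of the geometric series in
  \<open>w = exp (- t) * cis (2 * pi * m / h)\<close>, grouped into blocks of \<open>h\<close>
  terms: \<open>w ^ h = exp (- h * t)\<close> is real, so the blocks form a real geometric series.
  Within a block the sine weights sum to 0.\<close>

lemma sin_blocks_sums:
  assumes t: "t > 0" and h: "h \<ge> 1"
  shows "(\<lambda>l. \<Sum>n\<in>{1..<h}. sin (2 * pi * real m * real n / real h) * exp (- ((real n + real l * real h) * t)))
     sums (Im (1 / (1 - of_real (exp (- t)) * cis (2 * pi * (real m / real h)))))"
proof -
  define w where "w = of_real (exp (- t)) * cis (2 * pi * (real m / real h))"
  have pw: "w ^ n = of_real (exp (- (real n * t))) * cis (2 * pi * real m * real n / real h)" for n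
  proof -
    have "exp (- t) ^ n = exp (- (real n * t))" using exp_of_nat_mult[of n "- t"] by simp
    then have "complex_of_real (exp (- t)) ^ n = of_real (exp (- (real n * t)))" by (metis of_real_power)
    then show ?thesis unfolding w_def power_mult_distrib Complex.DeMoivre by (simp add: mult_ac)
  qed
  have wh: "w ^ h = of_real (exp (- (real h * t)))"
    unfolding pw using h cis_multiple_2pi[of "real m"] by (simp add: mult_ac)
  have "norm w < 1" using t by (simp add: w_def norm_mult)
  then have w1: "w \<noteq> 1" by auto
  let ?q = "exp (- (real h * t))"
  have q: "norm ?q < 1" using t h by simp
  have S: "(\<Sum>n\<in>{1..<h}. sin (2 * pi * real m * real n / real h) * exp (- (real n * t))) = Im (\<Sum>n<h. w ^ n)"
  proof -
    have "Im (\<Sum>n<h. w ^ n) = (\<Sum>n<h. sin (2 * pi * real m * real n / real h) * exp (- (real n * t)))"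
      unfolding Im_sum pw by (intro sum.cong) (auto simp: mult_ac)
    also have "\<dots> = (\<Sum>n\<in>{1..<h}. sin (2 * pi * real m * real n / real h) * exp (- (real n * t)))"
      by (rule sum.mono_neutral_right) (auto simp: not_le)
    finally show ?thesis ..
  qed
  have "(\<Sum>n<h. w ^ n) = (1 - w ^ h) / (1 - w)" using w1 by (simp add: sum_gp_strict)
  also have "\<dots> = of_real (1 - ?q) * (1 / (1 - w))" unfolding wh by simp
  finally have "Im (\<Sum>n<h. w ^ n) = (1 - ?q) * Im (1 / (1 - w))" by (metis Im_complex_of_real Re_complex_of_real Im_complex_of_real add_0_right mult_zero_left times_complex.sel(2))
  with S have S': "(\<Sum>n\<in>{1..<h}. sin (2 * pi * real m * real n / real h) * exp (- (real n * t))) = (1 - ?q) * Im (1 / (1 - w))" by simp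
  have "(\<lambda>l. ((1 - ?q) * Im (1 / (1 - w))) * ?q ^ l) sums (((1 - ?q) * Im (1 / (1 - w))) * (1 / (1 - ?q)))"
    by (intro sums_mult geometric_sums q)
  also have "((1 - ?q) * Im (1 / (1 - w))) * (1 / (1 - ?q)) = Im (1 / (1 - w))"
  proof -
    have "?q < 1" using t h by simp
    then have "1 - ?q \<noteq> 0" by linarith
    then show ?thesis by (metis (no_types, lifting) mult.commute mult.right_neutral nonzero_mult_div_cancel_left times_divide_eq_right)
  qed
  also have "(\<lambda>l. ((1 - ?q) * Im (1 / (1 - w))) * ?q ^ l) = (\<lambda>l. \<Sum>n\<in>{1..<h}. sin (2 * pi * real m * real n / real h) * exp (- ((real n + real l * real h) * t)))"
  proof
    fix l
    have "?q ^ l = exp (- (real l * real h * t))" using exp_of_nat_mult[of l "- (real h * t)"] by (simp add: mult.assoc)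
    then show "((1 - ?q) * Im (1 / (1 - w))) * ?q ^ l = (\<Sum>n\<in>{1..<h}. sin (2 * pi * real m * real n / real h) * exp (- ((real n + real l * real h) * t)))"
      unfolding S'[symmetric] sum_distrib_right by (intro sum.cong refl) (simp add: algebra_simps flip: exp_add)
  qed
  finally show ?thesis unfolding w_def .
qed


section \<open>Termwise Mellin integration of both expansions\<close>

text \<open>The single terms integrate to order \<open>l powr (- s)\<close>, not summable for
  \<open>s < 1\<close>; the cancellation inside a block improves this to
  \<open>l powr (- (s + 1))\<close>, which permits exchanging sum and integral.\<close>

lemma mellin_sin_blocks_sums:
  fixes m h :: nat and s :: real
  assumes s: "0 < s" "s < 1" and h: "h \<ge> 1"
  defines "B \<equiv> \<lambda>n. sin (2 * pi * real m * real n / real h)"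
  shows "(\<lambda>l. \<Sum>n\<in>{1..<h}. B n * (Gamma s * (2 * pi * (real n + real l * real h)) powr (- s))) sums
     (LINT u|lborel. exp (s * u) * Im (1 / (1 - of_real (exp (- (2 * pi * exp u))) * cis (2 * pi * (real m / real h)))))"
proof -
  define f where "f l u = (\<Sum>n\<in>{1..<h}. B n * exp (s * u - (2 * pi * (real n + real l * real h)) * exp u))" for l :: nat and u :: real
  define C where "C = (\<Sum>n\<in>{1..<h}. real n)"
  have f_eq: "f l u = exp (s * u) * (\<Sum>n\<in>{1..<h}. B n * exp (- ((real n + real l * real h) * (2 * pi * exp u))))" for l u
  proof -
    have "exp (s * u - (2 * pi * (real n + real l * real h)) * exp u) = exp (s * u) * exp (- ((real n + real l * real h) * (2 * pi * exp u)))" for n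
      unfolding exp_add[symmetric] by (simp add: algebra_simps)
    then show ?thesis unfolding f_def sum_distrib_left by (intro sum.cong refl) (simp only: mult_ac)
  qed
  have hb: "has_bochner_integral lborel (f l) (\<Sum>n\<in>{1..<h}. B n * (Gamma s * (2 * pi * (real n + real l * real h)) powr (- s)))" for l
    unfolding f_def
    by (intro has_bochner_integral_sum has_bochner_integral_mult_right has_bochner_integral_Gamma_exp)
       (use s in \<open>auto intro!: mult_pos_pos add_pos_nonneg\<close>)
  have bound: "norm (f l u) \<le> C * (2 * pi) * exp ((s + 1) * u - (2 * pi * (1 + real l * real h)) * exp u)" for l u
  proof -
    define t where "t = 2 * pi * exp u"
    have t: "t > 0" by (simp add: t_def)
    \<comment> \<open>Because the sine weights sum to 0, the exponential of \<open>n = 1\<close> can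
      be subtracted from all of them. The difference carries an extra factor
      \<open>t = 2 * pi * exp u\<close>, which raises \<open>s\<close> to \<open>s + 1\<close> in
      the Gamma integral.\<close>
    have "(\<Sum>n\<in>{1..<h}. B n * exp (- ((real n + real l * real h) * t))) =
       (\<Sum>n\<in>{1..<h}. B n * (exp (- ((real n + real l * real h) * t)) - exp (- ((1 + real l * real h) * t))))"
      using sum_sin_mod[OF h, of m] by (simp add: B_def right_diff_distrib sum_subtractf flip: sum_distrib_right)
    also have "\<bar>\<dots>\<bar> \<le> (\<Sum>n\<in>{1..<h}. real n * (t * exp (- ((1 + real l * real h) * t))))"
    proof (rule order_trans[OF sum_abs], rule sum_mono)
      fix n assume n: "n \<in> {1..<h}"
      have e: "exp (- ((real n + real l * real h) * t)) = exp (- ((1 + real l * real h) * t)) * exp (- ((real n - 1) * t))"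
        by (simp add: algebra_simps flip: exp_add)
      have "1 - (real n - 1) * t \<le> exp (- ((real n - 1) * t))" using exp_ge_add_one_self[of "- ((real n - 1) * t)"] by simp
      moreover have "exp (- ((real n - 1) * t)) \<le> 1" using n t by simp
      moreover have "(real n - 1) * t \<le> real n * t" using t by simp
      ultimately have "\<bar>exp (- ((real n - 1) * t)) - 1\<bar> \<le> real n * t" by linarith
      then have "exp (- ((1 + real l * real h) * t)) * \<bar>exp (- ((real n - 1) * t)) - 1\<bar> \<le> exp (- ((1 + real l * real h) * t)) * (real n * t)"
        by (intro mult_left_mono) auto
      moreover have "\<bar>exp (- ((real n + real l * real h) * t)) - exp (- ((1 + real l * real h) * t))\<bar> = exp (- ((1 + real l * real h) * t)) * \<bar>exp (- ((real n - 1) * t)) - 1\<bar>"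
      proof -
        have "X * Y - X = X * (Y - 1)" for X Y :: real by (simp add: algebra_simps)
        then show ?thesis unfolding e by (simp add: abs_mult)
      qed
      ultimately have "1 * \<bar>exp (- ((real n + real l * real h) * t)) - exp (- ((1 + real l * real h) * t))\<bar> \<le> real n * (t * exp (- ((1 + real l * real h) * t)))"
        by (simp add: mult_ac)
      moreover have "\<bar>B n\<bar> * \<bar>exp (- ((real n + real l * real h) * t)) - exp (- ((1 + real l * real h) * t))\<bar> \<le> 1 * \<bar>exp (- ((real n + real l * real h) * t)) - exp (- ((1 + real l * real h) * t))\<bar>"
        by (intro mult_right_mono) (auto simp: B_def)
      ultimately show "\<bar>B n * (exp (- ((real n + real l * real h) * t)) - exp (- ((1 + real l * real h) * t)))\<bar> \<le> real n * (t * exp (- ((1 + real l * real h) * t)))"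
        unfolding abs_mult by linarith
    qed
    also have "\<dots> = C * (t * exp (- ((1 + real l * real h) * t)))" unfolding C_def sum_distrib_right ..
    finally have "norm (f l u) \<le> exp (s * u) * (C * (t * exp (- ((1 + real l * real h) * t))))"
      unfolding f_eq t_def[symmetric] by (simp add: abs_mult)
    also have "\<dots> = C * (2 * pi) * (exp (s * u) * exp u * exp (- ((1 + real l * real h) * t)))" by (simp add: t_def)
    also have "exp (s * u) * exp u * exp (- ((1 + real l * real h) * t)) = exp ((s + 1) * u - (2 * pi * (1 + real l * real h)) * exp u)"
      unfolding exp_add[symmetric] t_def by (simp add: algebra_simps)
    finally show ?thesis .
  qed
  have hbb: "has_bochner_integral lborel (\<lambda>u. C * (2 * pi) * exp ((s + 1) * u - (2 * pi * (1 + real l * real h)) * exp u))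
      (C * (2 * pi) * (Gamma (s + 1) * (2 * pi * (1 + real l * real h)) powr (- (s + 1))))" for l
    by (intro has_bochner_integral_mult_right has_bochner_integral_Gamma_exp) (use s in \<open>auto intro!: mult_pos_pos add_pos_nonneg\<close>)
  have sums_pt: "(\<lambda>l. f l u) sums (exp (s * u) * Im (1 / (1 - of_real (exp (- (2 * pi * exp u))) * cis (2 * pi * (real m / real h)))))" for u
    unfolding f_eq B_def by (intro sums_mult sin_blocks_sums h) simp
  have "(\<lambda>l. integral\<^sup>L lborel (f l)) sums (LINT u|lborel. (\<Sum>l. f l u))"
  proof (rule sums_integral)
    show "integrable lborel (f l)" for l using hb by (simp add: has_bochner_integral_iff)
    show "AE u in lborel. summable (\<lambda>l. norm (f l u))"
    proof (intro always_eventually allI)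
      fix u
      let ?q = "exp (- (2 * pi * real h * exp u))"
      show "summable (\<lambda>l. norm (f l u))"
      proof (rule summable_comparison_test')
        show "summable (\<lambda>l. (C * (2 * pi) * exp ((s + 1) * u - 2 * pi * exp u)) * ?q ^ l)"
          using h by (intro summable_mult summable_geometric) auto
        fix l
        have "?q ^ l = exp (- (2 * pi * real l * real h * exp u))"
          using exp_of_nat_mult[of l "- (2 * pi * real h * exp u)"] by (simp add: mult_ac)
        then have eq: "(C * (2 * pi) * exp ((s + 1) * u - 2 * pi * exp u)) * ?q ^ l = C * (2 * pi) * exp ((s + 1) * u - (2 * pi * (1 + real l * real h)) * exp u)"
          by (simp add: algebra_simps flip: exp_add)
        show "norm (norm (f l u)) \<le> (C * (2 * pi) * exp ((s + 1) * u - 2 * pi * exp u)) * ?q ^ l"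
          unfolding eq using bound[of l u] by simp
      qed
    qed
    show "summable (\<lambda>l. LINT u|lborel. norm (f l u))"
    proof (rule summable_comparison_test')
      show "summable (\<lambda>l. C * (2 * pi) * (Gamma (s + 1) * ((2 * pi * real h) powr (- (s + 1)) * (real l + 1 / real h) powr (- (s + 1)))))"
        using s h by (intro summable_mult summable_shift_powr) auto
      fix l
      have "(LINT u|lborel. norm (f l u)) \<le> (LINT u|lborel. C * (2 * pi) * exp ((s + 1) * u - (2 * pi * (1 + real l * real h)) * exp u))"
        using hb[of l] hbb[of l] bound by (intro integral_mono) (auto simp: has_bochner_integral_iff)
      also have "\<dots> = C * (2 * pi) * (Gamma (s + 1) * (2 * pi * (1 + real l * real h)) powr (- (s + 1)))"
        using hbb by (simp add: has_bochner_integral_iff)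
      also have "2 * pi * (1 + real l * real h) = (2 * pi * real h) * (real l + 1 / real h)"
        using h by (simp add: field_simps)
      also have "\<dots> powr (- (s + 1)) = (2 * pi * real h) powr (- (s + 1)) * (real l + 1 / real h) powr (- (s + 1))"
        by (rule powr_mult)
      finally show "norm (LINT u|lborel. norm (f l u)) \<le> C * (2 * pi) * (Gamma (s + 1) * ((2 * pi * real h) powr (- (s + 1)) * (real l + 1 / real h) powr (- (s + 1))))"
        by simp
    qed
  qed
  moreover have "integral\<^sup>L lborel (f l) = (\<Sum>n\<in>{1..<h}. B n * (Gamma s * (2 * pi * (real n + real l * real h)) powr (- s)))" for l
    using hb by (simp add: has_bochner_integral_iff)
  ultimately show ?thesis by (simp add: sums_unique[OF sums_pt, symmetric])
qed

text \<open>Each fraction alone contributes a multiple of \<open>(x + n) powr (s - 1)\<close>, which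
  is not summable; the difference of the paired fractions integrates in absolute value to at most a
  multiple of \<open>(n + b) powr (s - 2)\<close>, and this is summable since
  \<open>s < 1\<close>.\<close>

lemma mellin_partial_fractions_sums:
  assumes s: "0 < s" "s < (1::real)" and x: "0 < x" "x < 1"
  shows "(\<lambda>n. ((x + real n) powr (s - 1) - (1 - x + real n) powr (s - 1)) * (pi / (2 * sin (pi * s / 2)))) sums
     (LINT u|lborel. exp (s * u) * (2 * pi * Im (1 / (1 - of_real (exp (- (2 * pi * exp u))) * cis (2 * pi * x)))))"
proof -
  define K where "K = pi / (2 * sin (pi * s / 2))"
  define f where "f n u = (x + real n) * (exp (s * u) / ((x + real n)\<^sup>2 + exp (2 * u))) - (1 - x + real n) * (exp (s * u) / ((1 - x + real n)\<^sup>2 + exp (2 * u)))" for n :: nat and u :: real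
  define b where "b = min x (1 - x)"
  have b: "b > 0" using x by (simp add: b_def)
  have hb1: "has_bochner_integral lborel (\<lambda>u. exp (s * u) / (c\<^sup>2 + exp (2 * u))) (c powr (s - 2) * K)" if "c > 0" for c
    unfolding K_def using s that by (intro has_bochner_integral_mellin_quadratic) auto
  have pw: "c * (c powr (s - 2) * K) = c powr (s - 1) * K" if "c > 0" for c
  proof -
    have "c powr (s - 1) = c powr (1 + (s - 2))" by simp
    also have "\<dots> = c * c powr (s - 2)" unfolding powr_add using that by simp
    finally show ?thesis by simp
  qed
  have hb: "has_bochner_integral lborel (f n) ((x + real n) powr (s - 1) * K - (1 - x + real n) powr (s - 1) * K)" for n
  proof -
    have "has_bochner_integral lborel (f n) ((x + real n) * ((x + real n) powr (s - 2) * K) - (1 - x + real n) * ((1 - x + real n) powr (s - 2) * K))"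
      unfolding f_def by (intro has_bochner_integral_diff has_bochner_integral_mult_right hb1) (use x in auto)
    then show ?thesis using x by (subst (asm) (1 2) pw) auto
  qed
  have f_eq: "f n u = exp (s * u) * ((x + real n) / ((x + real n)\<^sup>2 + (exp u)\<^sup>2) - (1 - x + real n) / ((1 - x + real n)\<^sup>2 + (exp u)\<^sup>2))" for n u
    unfolding f_def exp_double by (simp add: right_diff_distrib mult_ac)
  \<comment> \<open>The numerator of the difference is \<open>(d - c) * (c * d - y)\<close>, and
    \<open>\<bar>c * d - y\<bar> \<le> d\<^sup>2 + y\<close> cancels the larger denominator. It is
    applied with \<open>d - c = \<bar>1 - 2 * x\<bar>\<close>, which is at most 1.\<close>
  have quot: "\<bar>c / (c\<^sup>2 + y) - d / (d\<^sup>2 + y)\<bar> \<le> 1 / (c\<^sup>2 + y)" if "0 < c" "c \<le> d" "d - c \<le> 1" "y > 0" for c d y :: real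
  proof -
    have p: "c\<^sup>2 + y > 0" "d\<^sup>2 + y > 0" using that by (auto intro!: add_nonneg_pos)
    have "c / (c\<^sup>2 + y) - d / (d\<^sup>2 + y) = (d - c) * (c * d - y) / ((c\<^sup>2 + y) * (d\<^sup>2 + y))"
      using p by (simp add: divide_simps) (simp add: algebra_simps power2_eq_square)
    also have "\<bar>\<dots>\<bar> = (d - c) * \<bar>c * d - y\<bar> / ((c\<^sup>2 + y) * (d\<^sup>2 + y))"
      using p that by (simp add: abs_mult)
    also have "\<dots> \<le> 1 * (d\<^sup>2 + y) / ((c\<^sup>2 + y) * (d\<^sup>2 + y))"
    proof (intro divide_right_mono mult_mono)
      have "c * d \<le> d\<^sup>2" using that by (simp add: power2_eq_square mult_right_mono)
      moreover have "0 \<le> c * d" using that by simp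
      ultimately show "\<bar>c * d - y\<bar> \<le> d\<^sup>2 + y" using that by linarith
    qed (use p that in auto)
    also have "\<dots> = 1 / (c\<^sup>2 + y)" using p by simp
    finally show ?thesis .
  qed
  have bound: "norm (f n u) \<le> exp (s * u) / ((real n + b)\<^sup>2 + exp (2 * u))" for n u
  proof -
    have "\<bar>(x + real n) / ((x + real n)\<^sup>2 + exp (2 * u)) - (1 - x + real n) / ((1 - x + real n)\<^sup>2 + exp (2 * u))\<bar> \<le> 1 / ((real n + b)\<^sup>2 + exp (2 * u))"
    proof (cases "x \<le> 1 - x")
      case True
      then show ?thesis using quot[of "x + real n" "1 - x + real n" "exp (2 * u)"] x by (simp add: b_def add.commute)
    next
      case False
      then show ?thesis using quot[of "1 - x + real n" "x + real n" "exp (2 * u)"] x by (simp add: b_def min_def abs_minus_commute add.commute)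
    qed
    then have "exp (s * u) * \<bar>(x + real n) / ((x + real n)\<^sup>2 + exp (2 * u)) - (1 - x + real n) / ((1 - x + real n)\<^sup>2 + exp (2 * u))\<bar> \<le> exp (s * u) * (1 / ((real n + b)\<^sup>2 + exp (2 * u)))"
      by (intro mult_left_mono) auto
    then show ?thesis unfolding f_eq by (simp add: abs_mult exp_double)
  qed
  have hbb: "has_bochner_integral lborel (\<lambda>u. exp (s * u) / ((real n + b)\<^sup>2 + exp (2 * u))) ((real n + b) powr (s - 2) * K)" for n
    by (intro hb1) (use b in auto)
  have sums_pt: "(\<lambda>n. f n u) sums (exp (s * u) * (2 * pi * Im (1 / (1 - of_real (exp (- (2 * pi * exp u))) * cis (2 * pi * x)))))" for u
    unfolding f_eq by (intro sums_mult partial_fractions_sums) simp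
  have "(\<lambda>n. integral\<^sup>L lborel (f n)) sums (LINT u|lborel. (\<Sum>n. f n u))"
  proof (rule sums_integral)
    show "integrable lborel (f n)" for n using hb by (simp add: has_bochner_integral_iff)
    show "AE u in lborel. summable (\<lambda>n. norm (f n u))"
    proof (intro always_eventually allI)
      fix u
      show "summable (\<lambda>n. norm (f n u))"
      proof (rule summable_comparison_test')
        show "summable (\<lambda>n. exp (s * u) * (real n + b) powr (- 2))"
          using b by (intro summable_mult summable_shift_powr) auto
        fix n
        have pos: "real n + b > 0" using b by simp
        have "norm (f n u) \<le> exp (s * u) / ((real n + b)\<^sup>2 + exp (2 * u))" by (rule bound)
        also have "\<dots> \<le> exp (s * u) / (real n + b)\<^sup>2"
          using pos by (intro divide_left_mono) (auto intro!: mult_pos_pos add_pos_pos)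
        also have "\<dots> = exp (s * u) * (real n + b) powr (- 2)" using pos by (simp add: powr_minus_divide)
        finally show "norm (norm (f n u)) \<le> exp (s * u) * (real n + b) powr (- 2)" by simp
      qed
    qed
    show "summable (\<lambda>n. LINT u|lborel. norm (f n u))"
    proof (rule summable_comparison_test')
      show "summable (\<lambda>n. (real n + b) powr (- (2 - s)) * K)"
        using s b by (intro summable_mult2 summable_shift_powr) auto
      fix n
      have "(LINT u|lborel. norm (f n u)) \<le> (LINT u|lborel. exp (s * u) / ((real n + b)\<^sup>2 + exp (2 * u)))"
        using hb[of n] hbb[of n] bound by (intro integral_mono) (auto simp: has_bochner_integral_iff)
      also have "\<dots> = (real n + b) powr (- (2 - s)) * K"
        using hbb by (simp add: has_bochner_integral_iff)
      finally show "norm (LINT u|lborel. norm (f n u)) \<le> (real n + b) powr (- (2 - s)) * K" by simp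
    qed
  qed
  moreover have "integral\<^sup>L lborel (f n) = ((x + real n) powr (s - 1) - (1 - x + real n) powr (s - 1)) * K" for n
    using hb by (simp add: has_bochner_integral_iff algebra_simps)
  ultimately show ?thesis by (simp add: sums_unique[OF sums_pt, symmetric] K_def)
qed


text \<open>Both expansions of the cotangent, into geometric series and into partial fractions, are integrated
  termwise against \<open>e\<^bsup>su\<^esup>\<close>. Pairing the terms so that the coefficients sum to zero makes both series of
  integrals converge absolutely for \<open>0 < s < 1\<close>.\<close>

lemma hurwitz_zeta_odd_reflection_real:
  fixes m h :: nat and s :: real
  assumes s: "0 < s" "s < 1" and m: "m \<in> {1..<h}"
  shows "hurwitz_zeta (real m / real h) (1 - of_real s) - hurwitz_zeta (1 - real m / real h) (1 - of_real s) =
     of_real (4 * Gamma s * (2 * pi * real h) powr (- s) * sin (pi * s / 2)) *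
       (\<Sum>n\<in>{1..<h}. of_real (sin (2 * pi * real m * real n / real h)) * hurwitz_zeta (real n / real h) (of_real s))"
proof -
  have h: "h \<ge> 1" using m by auto
  define x where "x = real m / real h"
  have x: "0 < x" "x < 1" using m by (auto simp: x_def)
  define B where "B n = sin (2 * pi * real m * real n / real h)" for n
  define K where "K = pi / (2 * sin (pi * s / 2))"
  define G where "G = Gamma s * (2 * pi * real h) powr (- s)"
  \<comment> \<open>The common integral: \<open>I1\<close> evaluates it through geometric blocks,
    giving zeta values at \<open>s\<close>, and \<open>I2\<close> through partial fractions, giving
    zeta values at \<open>1 - s\<close>.\<close>
  define I where "I = (LINT u|lborel. exp (s * u) * Im (1 / (1 - of_real (exp (- (2 * pi * exp u))) * cis (2 * pi * x))))"
  have sin: "sin (pi * s / 2) > 0" using s by (intro sin_gt_zero) auto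
  have s1: "complex_of_real s \<noteq> 1" "1 - complex_of_real s \<noteq> 1" using s by (auto simp: complex_eq_iff)
  have B0: "(\<Sum>n\<in>{1..<h}. B n) = 0" unfolding B_def by (rule sum_sin_mod[OF h])
  have "(\<lambda>N. \<Sum>l<N. \<Sum>n\<in>{1..<h}. B n * (Gamma s * (2 * pi * (real n + real l * real h)) powr (- s))) \<longlonglongrightarrow> I"
    using mellin_sin_blocks_sums[OF s h, of m] unfolding sums_def B_def I_def x_def .
  then have lim1: "(\<lambda>N. of_real (\<Sum>l<N. \<Sum>n\<in>{1..<h}. B n * (Gamma s * (2 * pi * (real n + real l * real h)) powr (- s)))) \<longlonglongrightarrow> complex_of_real I"
    by (rule tendsto_of_real)
  have "(\<lambda>N. of_real G * (\<Sum>n\<in>{1..<h}. of_real (B n) * ((\<Sum>l<N. of_real (real l + real n / real h) powr (- of_real s)) - of_real (real N) powr (1 - of_real s) / (1 - of_real s))))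
    \<longlonglongrightarrow> of_real G * (\<Sum>n\<in>{1..<h}. of_real (B n) * hurwitz_zeta (real n / real h) (of_real s))"
    by (intro tendsto_intros hurwitz_zeta_tendsto) (use s s1 h in auto)
  also have "(\<lambda>N. of_real G * (\<Sum>n\<in>{1..<h}. of_real (B n) * ((\<Sum>l<N. of_real (real l + real n / real h) powr (- of_real s)) - of_real (real N) powr (1 - of_real s) / (1 - of_real s))))
     = (\<lambda>N. complex_of_real (\<Sum>l<N. \<Sum>n\<in>{1..<h}. B n * (Gamma s * (2 * pi * (real n + real l * real h)) powr (- s))))"
  proof
    fix N
    let ?c = "of_real (real N) powr (1 - of_real s) / (1 - complex_of_real s)"
    have "(\<Sum>n\<in>{1..<h}. of_real (B n) * ((\<Sum>l<N. of_real (real l + real n / real h) powr (- of_real s)) - ?c)) =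
        (\<Sum>n\<in>{1..<h}. of_real (B n) * (\<Sum>l<N. of_real (real l + real n / real h) powr (- complex_of_real s))) - of_real (\<Sum>n\<in>{1..<h}. B n) * ?c"
      by (simp add: right_diff_distrib sum_subtractf sum_distrib_right sum_divide_distrib)
    \<comment> \<open>The counterterm \<open>?c\<close> is the same for every \<open>n\<close> and
      meets the sum of the weights, which is 0.\<close>
    also have "\<dots> = (\<Sum>n\<in>{1..<h}. of_real (B n) * (\<Sum>l<N. of_real (real l + real n / real h) powr (- complex_of_real s)))"
      unfolding B0 by simp
    also have "\<dots> = of_real (\<Sum>n\<in>{1..<h}. B n * (\<Sum>l<N. (real l + real n / real h) powr (- s)))"
    proof -
      have "of_real (real l + real n / real h) powr (- complex_of_real s) = of_real ((real l + real n / real h) powr (- s))" for l n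
        using powr_of_real[of "real l + real n / real h" "- s"] by simp
      then show ?thesis by simp
    qed
    finally have "of_real G * (\<Sum>n\<in>{1..<h}. of_real (B n) * ((\<Sum>l<N. of_real (real l + real n / real h) powr (- of_real s)) - ?c)) =
       complex_of_real (G * (\<Sum>n\<in>{1..<h}. B n * (\<Sum>l<N. (real l + real n / real h) powr (- s))))" by simp
    also have "G * (\<Sum>n\<in>{1..<h}. B n * (\<Sum>l<N. (real l + real n / real h) powr (- s))) =
       (\<Sum>l<N. \<Sum>n\<in>{1..<h}. B n * (G * (real l + real n / real h) powr (- s)))"
      unfolding sum_distrib_left by (subst sum.swap) (simp add: mult_ac)
    also have "\<dots> = (\<Sum>l<N. \<Sum>n\<in>{1..<h}. B n * (Gamma s * (2 * pi * (real n + real l * real h)) powr (- s)))"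
    proof (intro sum.cong refl)
      fix l n
      have "2 * pi * (real n + real l * real h) = (2 * pi * real h) * (real l + real n / real h)" using h by (simp add: field_simps)
      then have "(2 * pi * (real n + real l * real h)) powr (- s) = (2 * pi * real h) powr (- s) * (real l + real n / real h) powr (- s)"
        by (simp only: powr_mult)
      then show "B n * (G * (real l + real n / real h) powr (- s)) = B n * (Gamma s * (2 * pi * (real n + real l * real h)) powr (- s))"
        by (simp add: G_def mult_ac)
    qed
    finally show "of_real G * (\<Sum>n\<in>{1..<h}. of_real (B n) * ((\<Sum>l<N. of_real (real l + real n / real h) powr (- of_real s)) - ?c)) =
       complex_of_real (\<Sum>l<N. \<Sum>n\<in>{1..<h}. B n * (Gamma s * (2 * pi * (real n + real l * real h)) powr (- s)))" .
  qed
  finally have I1: "complex_of_real I = of_real G * (\<Sum>n\<in>{1..<h}. of_real (B n) * hurwitz_zeta (real n / real h) (of_real s))"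
    using lim1 LIMSEQ_unique by blast
  have "(LINT u|lborel. exp (s * u) * (2 * pi * Im (1 / (1 - of_real (exp (- (2 * pi * exp u))) * cis (2 * pi * x))))) = 2 * pi * I"
    unfolding I_def integral_mult_right_zero[symmetric] by (simp add: mult_ac)
  then have "(\<lambda>N. \<Sum>n<N. ((x + real n) powr (s - 1) - (1 - x + real n) powr (s - 1)) * K) \<longlonglongrightarrow> 2 * pi * I"
    using mellin_partial_fractions_sums[OF s x] unfolding sums_def K_def by simp
  then have lim2: "(\<lambda>N. of_real (\<Sum>n<N. ((x + real n) powr (s - 1) - (1 - x + real n) powr (s - 1)) * K)) \<longlonglongrightarrow> complex_of_real (2 * pi * I)"
    by (rule tendsto_of_real)
  have "(\<lambda>N. of_real K * (((\<Sum>n<N. of_real (real n + x) powr (- (1 - of_real s))) - of_real (real N) powr (1 - (1 - of_real s)) / (1 - (1 - of_real s)))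
      - ((\<Sum>n<N. of_real (real n + (1 - x)) powr (- (1 - of_real s))) - of_real (real N) powr (1 - (1 - of_real s)) / (1 - (1 - of_real s)))))
    \<longlonglongrightarrow> of_real K * (hurwitz_zeta x (1 - of_real s) - hurwitz_zeta (1 - x) (1 - of_real s))"
    by (intro tendsto_mult tendsto_diff tendsto_const hurwitz_zeta_tendsto) (use s s1 x in auto)
  also have "(\<lambda>N. of_real K * (((\<Sum>n<N. of_real (real n + x) powr (- (1 - of_real s))) - of_real (real N) powr (1 - (1 - of_real s)) / (1 - (1 - of_real s)))
      - ((\<Sum>n<N. of_real (real n + (1 - x)) powr (- (1 - of_real s))) - of_real (real N) powr (1 - (1 - of_real s)) / (1 - (1 - of_real s)))))
    = (\<lambda>N. complex_of_real (\<Sum>n<N. ((x + real n) powr (s - 1) - (1 - x + real n) powr (s - 1)) * K))"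
  proof
    fix N
    have pw: "of_real y powr (- (1 - complex_of_real s)) = of_real (y powr (s - 1))" if "y > 0" for y
      using powr_of_real[of y "s - 1"] that by simp
    have "of_real (real n + x) powr (- (1 - complex_of_real s)) = of_real ((x + real n) powr (s - 1))"
         "of_real (real n + (1 - x)) powr (- (1 - complex_of_real s)) = of_real ((1 - x + real n) powr (s - 1))" for n
      using pw[of "real n + x"] pw[of "real n + (1 - x)"] x by (simp_all add: add.commute)
    then show "of_real K * (((\<Sum>n<N. of_real (real n + x) powr (- (1 - of_real s))) - of_real (real N) powr (1 - (1 - of_real s)) / (1 - (1 - of_real s)))
      - ((\<Sum>n<N. of_real (real n + (1 - x)) powr (- (1 - of_real s))) - of_real (real N) powr (1 - (1 - of_real s)) / (1 - (1 - of_real s))))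
      = complex_of_real (\<Sum>n<N. ((x + real n) powr (s - 1) - (1 - x + real n) powr (s - 1)) * K)"
      by (simp add: sum_subtractf sum_distrib_left mult.commute right_diff_distrib)
  qed
  finally have I2: "complex_of_real (2 * pi * I) = of_real K * (hurwitz_zeta x (1 - of_real s) - hurwitz_zeta (1 - x) (1 - of_real s))"
    using lim2 LIMSEQ_unique by blast
  have K0: "K \<noteq> 0" using sin by (simp add: K_def)
  have "hurwitz_zeta x (1 - of_real s) - hurwitz_zeta (1 - x) (1 - of_real s) = of_real (2 * pi / K) * of_real I"
    using I2 K0 by (simp add: field_simps)
  also have "2 * pi / K = 4 * sin (pi * s / 2)" using sin by (simp add: K_def)
  finally show ?thesis unfolding I1 G_def x_def B_def by (simp add: mult_ac)
qed

text \<open>Both sides are holomorphic in the strip \<open>\<bar>Re a\<bar> < 1\<close> without 0,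
  where \<open>Gamma (- a)\<close> and the zeta functions at \<open>1 + a\<close> are singular. They
  agree on the real interval from -1 to 0, where \<open>a = - s\<close>, so the identity theorem
  applies. The minus sign is that of \<open>sin (- pi * s / 2)\<close>.\<close>

lemma hurwitz_zeta_odd_reflection:
  fixes m h :: nat and a :: complex
  assumes a: "\<bar>Re a\<bar> < 1" "a \<noteq> 0" and m: "m \<in> {1..<h}"
  shows "hurwitz_zeta (real m / real h) (1 + a) - hurwitz_zeta (1 - real m / real h) (1 + a) =
     - 4 * Gamma (- a) * (of_real (2 * pi) powr a * of_nat h powr a) * sin (of_real pi * a / 2) *
       (\<Sum>n\<in>{1..<h}. of_real (sin (2 * pi * real m * real n / real h)) * hurwitz_zeta (real n / real h) (- a))"
proof -
  have h: "h \<ge> 1" using m by auto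
  define T where "T = {a::complex. Re a < 1} \<inter> {a. Re a > -1}"
  define U where "U = complex_of_real ` {-1<..<0}"
  define F where "F a = hurwitz_zeta (real m / real h) (1 + a) - hurwitz_zeta (1 - real m / real h) (1 + a) +
     4 * Gamma (- a) * (of_real (2 * pi) powr a * of_nat h powr a) * sin (of_real pi * a / 2) *
       (\<Sum>n\<in>{1..<h}. of_real (sin (2 * pi * real m * real n / real h)) * hurwitz_zeta (real n / real h) (- a))" for a
  have T: "open T" "connected T" unfolding T_def
    by (intro open_Int open_halfspace_Re_lt open_halfspace_Re_gt, intro convex_connected convex_Int convex_halfspace_Re_lt convex_halfspace_Re_gt)
  have "F a = 0"
  proof (rule analytic_continuation[of F "T - {0}" U "- (1/2)"])
    show "F holomorphic_on T - {0}" unfolding F_def[abs_def]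
    proof (intro holomorphic_intros)
      fix z assume z: "z \<in> T - {0}"
      show "- z \<notin> \<int>\<^sub>\<le>\<^sub>0"
      proof
        assume "- z \<in> \<int>\<^sub>\<le>\<^sub>0"
        then obtain n where n: "- z = of_int n" "n \<le> 0" by (auto elim: nonpos_Ints_cases)
        then have "Re z = - of_int n" by (metis Re_complex_of_real minus_complex.simps(1) neg_equal_iff_equal of_real_of_int_eq uminus_complex.simps(1) minus_minus)
        then have "n = 0" using z n(2) by (auto simp: T_def)
        then show False using n z by simp
      qed
    qed (use m h in \<open>auto simp: T_def dest: arg_cong[of _ _ Re]\<close>)
    show "open (T - {0})" using T by (simp add: open_delete)
    show "connected (T - {0})" using T by (intro connected_open_delete) auto
    show "U \<subseteq> T - {0}" by (auto simp: U_def T_def)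
    show "- (1/2) \<in> T - {0}" by (auto simp: T_def)
    show "- (1/2) islimpt U"
      unfolding islimpt_approachable
    proof (intro allI impI)
      fix e :: real assume e: "e > 0"
      define y where "y = -1/2 + min (e/2) (1/4)"
      have "y \<in> {-1<..<0}" "y \<noteq> -1/2" "\<bar>y - (-1/2)\<bar> < e" using e by (auto simp: y_def min_def)
      moreover have "dist (complex_of_real y) (- (1/2)) = \<bar>y - (-1/2)\<bar>"
        using dist_of_real[of y "-1/2", where 'a = complex] by (simp add: dist_real_def)
      moreover have "complex_of_real y \<noteq> - (1/2)" using \<open>y \<noteq> -1/2\<close> of_real_eq_iff[of y "-1/2", where 'a = complex] by simp
      ultimately show "\<exists>x'\<in>U. x' \<noteq> - (1/2) \<and> dist x' (- (1/2)) < e" unfolding U_def by auto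
    qed
    show "F z = 0" if "z \<in> U" for z
    proof -
      obtain r where r: "z = of_real r" "-1 < r" "r < 0" using \<open>z \<in> U\<close> by (auto simp: U_def)
      define s where "s = - r"
      have s: "0 < s" "s < 1" and z: "z = - of_real s" using r by (auto simp: s_def)
      have 1: "Gamma (complex_of_real s) = of_real (Gamma s)" by (rule Gamma_complex_of_real)
      have 2: "of_real (2 * pi) powr (- complex_of_real s) * of_nat h powr (- complex_of_real s) = of_real ((2 * pi * real h) powr (- s))"
        using powr_of_real[of "2 * pi" "- s"] powr_of_real[of "real h" "- s"] powr_mult[of "2 * pi" "real h" "- s"]
        by simp
      have 3: "sin (of_real pi * - complex_of_real s / 2) = - of_real (sin (pi * s / 2))"
        using sin_of_real[of "pi * s / 2", where 'a = complex] by simp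
      show ?thesis
        unfolding F_def z minus_minus 1 2 3 using hurwitz_zeta_odd_reflection_real[OF s m]
        by (simp add: mult_ac)
    qed
    show "a \<in> T - {0}" using a by (auto simp: T_def)
  qed
  then show ?thesis unfolding F_def by (simp add: add_eq_0_iff2)
qed

section \<open>Cotangent sums and the twisted moment\<close>

text \<open>Multiplying by \<open>w - 1\<close> telescopes, as in Abel summation; the leftover
  geometric sum vanishes because \<open>w ^ h = 1\<close>.\<close>

lemma sum_of_nat_times_root_of_unity:
  fixes w :: complex
  assumes "w ^ h = 1" "w \<noteq> 1"
  shows "(\<Sum>r<h. of_nat r * w ^ r) = of_nat h / (w - 1)"
proof -
  have "(w - 1) * (\<Sum>r<n. of_nat r * w ^ r) = of_nat n * w ^ n - w * (\<Sum>r<n. w ^ r)" for n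
    by (induction n) (simp_all add: algebra_simps)
  from this[of h] have "(w - 1) * (\<Sum>r<h. of_nat r * w ^ r) = of_nat h"
    using assms by (simp add: sum_gp_strict)
  then show ?thesis using assms by (simp add: field_simps)
qed

text \<open>A finite Fourier coefficient of the sawtooth: the sum is the imaginary part of
  \<open>1 / (w - 1)\<close> with \<open>w = cis (2 * \<phi>)\<close>, which is
  \<open>- cot \<phi> / 2\<close>. The divisibility hypothesis ensures
  \<open>w \<noteq> 1\<close>.\<close>

lemma sum_sawtooth_sin:
  fixes N :: int
  assumes h: "h \<ge> 1" and N: "\<not> int h dvd N"
  shows "(\<Sum>r\<in>{1..<h}. real r / real h * sin (2 * pi * of_int N * real r / real h)) = - cot (pi * of_int N / real h) / 2"
proof -
  define \<phi> where "\<phi> = pi * of_int N / real h"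
  define w where "w = cis (2 * \<phi>)"
  have s0: "sin \<phi> \<noteq> 0"
  proof
    assume "sin \<phi> = 0"
    then obtain i :: int where "\<phi> = of_int i * pi" by (auto simp: sin_zero_iff_int2)
    then have "real_of_int N = of_int (i * int h)" using h by (simp add: \<phi>_def field_simps)
    then have "N = i * int h" by linarith
    then show False using N by simp
  qed
  have wp: "w ^ r = cis (2 * pi * of_int N * real r / real h)" for r
    unfolding w_def Complex.DeMoivre \<phi>_def by (simp add: mult_ac)
  have wh: "w ^ h = 1" unfolding wp using h cis_multiple_2pi[of "of_int N"] by (simp add: mult_ac)
  have cs: "cos (2 * \<phi>) - 1 = - 2 * (sin \<phi>)\<^sup>2" "sin (2 * \<phi>) = 2 * sin \<phi> * cos \<phi>"
    by (simp_all add: cos_double_sin sin_double)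
  have w1: "w \<noteq> 1"
  proof
    assume "w = 1"
    then have "cos (2 * \<phi>) = 1" by (simp add: w_def complex_eq_iff)
    with cs s0 show False by simp
  qed
  have "(\<Sum>r\<in>{1..<h}. real r / real h * sin (2 * pi * of_int N * real r / real h)) = (\<Sum>r<h. real r / real h * sin (2 * pi * of_int N * real r / real h))"
    by (rule sum.mono_neutral_left) (auto simp: not_le)
  also have "\<dots> = Im (\<Sum>r<h. of_nat r * w ^ r) / real h"
    unfolding Im_sum wp sum_divide_distrib by (intro sum.cong) auto
  also have "\<dots> = Im (1 / (w - 1))"
  proof -
    have "complex_of_nat h / (w - 1) = of_real (real h) * (1 / (w - 1))" by simp
    then have "Im (complex_of_nat h / (w - 1)) = real h * Im (1 / (w - 1))"
      by (simp only: times_complex.sel Re_complex_of_real Im_complex_of_real)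
    then show ?thesis unfolding sum_of_nat_times_root_of_unity[OF wh w1] using h by simp
  qed
  also have "\<dots> = - sin (2 * \<phi>) / ((cos (2 * \<phi>) - 1)\<^sup>2 + (sin (2 * \<phi>))\<^sup>2)"
    by (simp add: w_def Im_divide)
  also have "(cos (2 * \<phi>) - 1)\<^sup>2 + (sin (2 * \<phi>))\<^sup>2 = 4 * (sin \<phi>)\<^sup>2 * ((sin \<phi>)\<^sup>2 + (cos \<phi>)\<^sup>2)"
  proof -
    have "(- 2 * x\<^sup>2)\<^sup>2 + (2 * x * y)\<^sup>2 = 4 * x\<^sup>2 * (x\<^sup>2 + y\<^sup>2)" for x y :: real
      by (simp add: power2_eq_square algebra_simps)
    then show ?thesis unfolding cs .
  qed
  also have "- sin (2 * \<phi>) / (4 * (sin \<phi>)\<^sup>2 * ((sin \<phi>)\<^sup>2 + (cos \<phi>)\<^sup>2)) = - cot \<phi> / 2"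
    unfolding cs using s0 by (simp add: cot_def field_simps power2_eq_square)
  finally show ?thesis unfolding \<phi>_def .
qed

lemma frac_of_nat_div:
  assumes "h \<ge> 1" shows "frac (real n / real h) = real (n mod h) / real h"
  using floor_divide_of_nat_eq[of n h, where 'a = real] assms
  by (simp add: frac_def field_simps) (metis mod_mult_div_eq of_nat_add of_nat_mult add.commute mult.commute)

text \<open>Multiplication by \<open>k\<close> permutes the nonzero residues modulo
  \<open>h\<close>, and \<open>m\<close> is congruent to \<open>k' * \<sigma> m\<close>. The
  substitution moves the multiplier from the fractional part into the sine, where it appears as its
  inverse; this is how the inverse residues enter the final formula.\<close>

lemma sum_frac_sin:
  fixes k' :: int
  assumes h: "h \<ge> 1" and cop: "coprime h k" and inv: "[int k * k' = 1] (mod int h)" and n: "n \<in> {1..<h}"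
  shows "(\<Sum>m\<in>{1..<h}. frac (real k * real m / real h) * sin (2 * pi * real m * real n / real h)) = - cot (pi * real n * of_int k' / real h) / 2"
proof -
  define \<sigma> where "\<sigma> m = (k * m) mod h" for m
  define g where "g r = real r / real h * sin (2 * pi * of_int (int n * k') * real r / real h)" for r
  have sub: "\<sigma> ` {1..<h} \<subseteq> {1..<h}"
  proof
    fix r assume "r \<in> \<sigma> ` {1..<h}"
    then obtain m where m: "m \<in> {1..<h}" "r = \<sigma> m" by auto
    have "\<sigma> m \<noteq> 0"
    proof
      assume "\<sigma> m = 0"
      then have "h dvd k * m" by (auto simp: \<sigma>_def)
      then have "h dvd m" using cop by (simp add: coprime_dvd_mult_right_iff)
      then show False using m by (auto dest: dvd_imp_le)
    qed
    then show "r \<in> {1..<h}" using m h by (auto simp: \<sigma>_def Suc_le_eq)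
  qed
  have inj: "inj_on \<sigma> {1..<h}"
  proof (rule inj_onI)
    fix m m' assume mm: "m \<in> {1..<h}" "m' \<in> {1..<h}" "\<sigma> m = \<sigma> m'"
    then have "[k * m = k * m'] (mod h)" by (simp add: \<sigma>_def cong_def)
    then have "[m = m'] (mod h)" using cop by (simp add: cong_mult_lcancel_nat coprime_commute)
    then show "m = m'" using mm by (simp add: cong_def)
  qed
  have "bij_betw \<sigma> {1..<h} {1..<h}"
    using endo_inj_surj[OF _ sub inj] inj by (simp add: bij_betw_def)
  then have re: "(\<Sum>m\<in>{1..<h}. g (\<sigma> m)) = (\<Sum>r\<in>{1..<h}. g r)" by (rule sum.reindex_bij_betw)
  have "frac (real k * real m / real h) * sin (2 * pi * real m * real n / real h) = g (\<sigma> m)" for m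
  proof -
    have 1: "frac (real k * real m / real h) = real (\<sigma> m) / real h"
      using frac_of_nat_div[OF h, of "k * m"] by (simp add: \<sigma>_def)
    have "[int (\<sigma> m) = int (k * m)] (mod int h)" by (simp add: \<sigma>_def cong_def zmod_int)
    then have "[(int n * k') * int (\<sigma> m) = (int n * k') * (int k * int m)] (mod int h)" by (intro cong_mult) auto
    moreover have "[(int k * k') * (int n * int m) = 1 * (int n * int m)] (mod int h)" by (intro cong_mult inv) auto
    ultimately have "[(int n * k') * int (\<sigma> m) = int n * int m] (mod int h)" by (simp add: cong_def mult_ac)
    then obtain z where z: "(int n * k') * int (\<sigma> m) = int n * int m + int h * z"
      by (metis cong_iff_lin cong_sym)
    have "real_of_int (int n * k') * real (\<sigma> m) = real_of_int ((int n * k') * int (\<sigma> m))" by simp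
    also have "\<dots> = real n * real m + real h * of_int z" unfolding z by simp
    finally have "2 * pi * (of_int (int n * k') * real (\<sigma> m)) / real h = 2 * pi * real m * real n / real h + of_int z * (2 * pi)"
      using h by (simp only:) (simp add: field_simps)
    then have "2 * pi * of_int (int n * k') * real (\<sigma> m) / real h = 2 * pi * real m * real n / real h + of_int z * (2 * pi)"
      by (simp only: mult.assoc)
    then have "sin (2 * pi * of_int (int n * k') * real (\<sigma> m) / real h) = sin (2 * pi * real m * real n / real h)"
      using sin_int_2pin[of z] cos_int_2pin[of z] by (simp add: sin_add mult_ac)
    with 1 show ?thesis by (simp add: g_def)
  qed
  then have "(\<Sum>m\<in>{1..<h}. frac (real k * real m / real h) * sin (2 * pi * real m * real n / real h)) = (\<Sum>r\<in>{1..<h}. g r)"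
    using re by simp
  also have "\<dots> = - cot (pi * of_int (int n * k') / real h) / 2"
    unfolding g_def
  proof (rule sum_sawtooth_sin[OF h])
    have "coprime (int h) k'" using inv
      by (metis cong_imp_coprime coprime_1_left coprime_commute coprime_mult_right_iff cong_sym)
    then show "\<not> int h dvd int n * k'"
      using n by (auto simp: coprime_dvd_mult_left_iff dest: zdvd_imp_le)
  qed
  finally show ?thesis by (simp add: mult_ac)
qed

text \<open>Together with the residue \<open>r = h\<close>, which contributes \<open>zeta s\<close>
  itself, the Hurwitz series over all residues rearrange to \<open>h powr s * zeta s\<close>.
  Corrected partial sums carry this down to \<open>Re s > 0\<close>.\<close>

lemma sum_hurwitz_zeta_fractions:
  assumes s: "Re s > 0" "s \<noteq> 1" and h: "h \<ge> 1"
  shows "(\<Sum>r\<in>{1..<h}. hurwitz_zeta (real r / real h) s) = (of_nat h powr s - 1) * zeta s"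
proof -
  have "(\<lambda>N. (\<Sum>n=1..N. of_nat n powr (- s)) - of_nat N powr (1 - s) / (1 - s)) \<longlonglongrightarrow> zeta s"
    by (intro zeta_tendsto s)
  moreover have "strict_mono (\<lambda>N. h * N)" using h by (auto simp: strict_mono_def)
  ultimately have "(\<lambda>N. (\<Sum>n=1..h*N. of_nat n powr (- s)) - of_nat (h*N) powr (1 - s) / (1 - s)) \<longlonglongrightarrow> zeta s"
    using LIMSEQ_subseq_LIMSEQ by (fastforce simp: o_def)
  then have lim: "(\<lambda>N. of_nat h powr s * ((\<Sum>n=1..h*N. of_nat n powr (- s)) - of_nat (h*N) powr (1 - s) / (1 - s))) \<longlonglongrightarrow> of_nat h powr s * zeta s"
    by (intro tendsto_mult tendsto_const)
  have eq: "of_nat h powr s * ((\<Sum>n=1..h*N. of_nat n powr (- s)) - of_nat (h*N) powr (1 - s) / (1 - s)) =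
     (\<Sum>r=1..h. (\<Sum>j<N. of_real (real j + real r / real h) powr (- s)) - of_real (real N) powr (1 - s) / (1 - s))" if "N \<ge> 1" for N
  proof -
    have "of_nat h powr s * (\<Sum>n=1..h*N. of_nat n powr (- s)) = (\<Sum>n=1..h*N. complex_of_real (real n / real h) powr (- s))"
      unfolding sum_distrib_left by (intro sum.cong refl, subst of_nat_div_powr) (use h in auto)
    also have "\<dots> = (\<Sum>r=1..h. \<Sum>j<N. of_real (real j + real r / real h) powr (- s))"
    proof -
      have "real (j * h + r) / real h = real j + real r / real h" for j r using h by (simp add: field_simps)
      then show ?thesis unfolding sum_blocks by simp
    qed
    finally have 1: "of_nat h powr s * (\<Sum>n=1..h*N. of_nat n powr (- s)) = (\<Sum>r=1..h. \<Sum>j<N. of_real (real j + real r / real h) powr (- s))" .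
    have 2: "of_nat h powr s * of_nat (h*N) powr (1 - s) = of_nat h * complex_of_real (real N) powr (1 - s)"
    proof -
      have "complex_of_nat N powr (1 - s) = of_nat (h*N) powr (1 - s) * of_nat h powr (s - 1)"
        using of_nat_div_powr[of "h * N" h "1 - s"] h that by simp
      moreover have "of_nat h powr (s - 1) = of_nat h powr s / complex_of_nat h"
        using h by (simp add: powr_diff)
      ultimately show ?thesis using h by simp
    qed
    show ?thesis unfolding right_diff_distrib times_divide_eq_right 1 2 by (simp add: sum_subtractf)
  qed
  have "(\<lambda>N. \<Sum>r=1..h. (\<Sum>j<N. of_real (real j + real r / real h) powr (- s)) - of_real (real N) powr (1 - s) / (1 - s)) \<longlonglongrightarrow> of_nat h powr s * zeta s"
    by (rule Lim_transform_eventually[OF lim]) (rule eventually_mono[OF eventually_ge_at_top[of 1]], rule eq)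
  moreover have "(\<lambda>N. \<Sum>r=1..h. (\<Sum>j<N. of_real (real j + real r / real h) powr (- s)) - of_real (real N) powr (1 - s) / (1 - s)) \<longlonglongrightarrow> (\<Sum>r=1..h. hurwitz_zeta (real r / real h) s)"
    by (intro tendsto_sum hurwitz_zeta_tendsto) (use s h in auto)
  ultimately have "(\<Sum>r=1..h. hurwitz_zeta (real r / real h) s) = of_nat h powr s * zeta s"
    using LIMSEQ_unique by blast
  moreover have "{1..h} = insert h {1..<h}" using h by auto
  ultimately show ?thesis using h by (simp add: zeta_def algebra_simps)
qed

text \<open>\<open>cot_sum\<close> reads numerator and denominator through
  \<open>quotient_of\<close>; coprimality and \<open>h \<ge> 1\<close> guarantee that these are
  \<open>k'\<close> and \<open>h\<close> unchanged.\<close>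

lemma cot_sum_Fract:
  fixes k' :: int
  assumes h: "h \<ge> 1" and cop: "coprime k' (int h)"
  shows "cot_sum a (Fract k' (int h)) = of_nat h powr a *
    (\<Sum>n\<in>{1..<h}. of_real (cot (pi * real n * of_int k' / real h)) * hurwitz_zeta (real n / real h) (- a))"
proof -
  have "quotient_of (Fract k' (int h)) = (k', int h)"
    unfolding quotient_of_Fract using h cop by (intro Rat.normalize_stable) auto
  moreover have "(\<Sum>m = 1..int h - 1. complex_of_real (cot (pi * of_int m * of_int k' / of_int (int h))) * hurwitz_zeta (of_int m / of_int (int h)) (- a)) =
     (\<Sum>n\<in>{1..<h}. of_real (cot (pi * real n * of_int k' / real h)) * hurwitz_zeta (real n / real h) (- a))"
    by (rule sum.reindex_bij_witness[of _ int nat]) auto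
  ultimately show ?thesis by (simp add: cot_sum_def)
qed

text \<open>Since the fractional parts at \<open>r\<close> and \<open>h - r\<close> add up to 1,
  twice the sum is the plain sum of the \<open>Z r\<close> plus a sum weighting the differences
  \<open>Z r - Z (h - r)\<close>. The first is a multiple of \<open>zeta (1 + a)\<close>; in the
  second the odd reflection produces sines, and summing over \<open>r\<close> first turns them into
  cotangents.\<close>

lemma sum_frac_hurwitz_zeta:
  fixes k' :: int
  assumes a: "\<bar>Re a\<bar> < 1" "a \<noteq> 0" and h: "h \<ge> 1" and cop: "coprime h k" and inv: "[int k * k' = 1] (mod int h)"
  shows "(\<Sum>r\<in>{1..<h}. of_real (frac (real k * real r / real h)) * hurwitz_zeta (real r / real h) (1 + a)) =
    (of_nat h powr (1 + a) - 1) * zeta (1 + a) / 2 +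
    of_real (2 * pi) powr a * Gamma (- a) * sin (of_real pi * a / 2) * cot_sum a (Fract k' (int h))"
proof -
  define Z where "Z r = hurwitz_zeta (real r / real h) (1 + a)" for r
  define q where "q r = complex_of_real (frac (real k * real r / real h))" for r
  define C where "C = - 4 * Gamma (- a) * (of_real (2 * pi) powr a * of_nat h powr a) * sin (of_real pi * a / 2)"
  define W where "W n = hurwitz_zeta (real n / real h) (- a)" for n
  define X where "X = (\<Sum>r\<in>{1..<h}. q r * Z r)"
  have reflect: "(\<Sum>r\<in>{1..<h}. F r) = (\<Sum>r\<in>{1..<h}. F (h - r))" for F :: "nat \<Rightarrow> complex"
    by (rule sum.reindex_bij_witness[of _ "\<lambda>r. h - r" "\<lambda>r. h - r"]) auto
  have "X = (\<Sum>r\<in>{1..<h}. q (h - r) * Z (h - r))" unfolding X_def by (rule reflect)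
  also have "\<dots> = (\<Sum>r\<in>{1..<h}. Z (h - r) - q r * Z (h - r))"
    unfolding q_def by (intro sum.cong refl, subst frac_mult_div_reflect[OF cop]) (auto simp: left_diff_distrib)
  also have "\<dots> = (\<Sum>r\<in>{1..<h}. Z r) - (\<Sum>r\<in>{1..<h}. q r * Z (h - r))"
    using reflect[of Z] by (simp add: sum_subtractf)
  finally have "X + X = (\<Sum>r\<in>{1..<h}. Z r) + (\<Sum>r\<in>{1..<h}. q r * (Z r - Z (h - r)))"
    by (simp add: X_def right_diff_distrib sum_subtractf algebra_simps)
  also have "(\<Sum>r\<in>{1..<h}. q r * (Z r - Z (h - r))) = (\<Sum>r\<in>{1..<h}. q r * (C * (\<Sum>n\<in>{1..<h}. of_real (sin (2 * pi * real r * real n / real h)) * W n)))"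
  proof (intro sum.cong refl arg_cong2[of _ _ _ _ "(*)"])
    fix r assume r: "r \<in> {1..<h}"
    have "real (h - r) / real h = 1 - real r / real h" using r by (simp add: of_nat_diff field_simps)
    then show "Z r - Z (h - r) = C * (\<Sum>n\<in>{1..<h}. of_real (sin (2 * pi * real r * real n / real h)) * W n)"
      unfolding Z_def C_def W_def using hurwitz_zeta_odd_reflection[OF a r] by simp
  qed
  also have "\<dots> = C * (\<Sum>n\<in>{1..<h}. of_real (\<Sum>r\<in>{1..<h}. frac (real k * real r / real h) * sin (2 * pi * real r * real n / real h)) * W n)"
    unfolding of_real_sum sum_distrib_left sum_distrib_right by (subst sum.swap) (simp add: q_def mult_ac)
  also have "(\<Sum>n\<in>{1..<h}. of_real (\<Sum>r\<in>{1..<h}. frac (real k * real r / real h) * sin (2 * pi * real r * real n / real h)) * W n) =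
      (\<Sum>n\<in>{1..<h}. of_real (- cot (pi * real n * of_int k' / real h) / 2) * W n)"
    by (intro sum.cong refl, subst sum_frac_sin[OF h cop inv]) auto
  also have "\<dots> = - (\<Sum>n\<in>{1..<h}. of_real (cot (pi * real n * of_int k' / real h)) * W n) / 2"
    by (simp add: sum_negf sum_divide_distrib)
  also have "(\<Sum>r\<in>{1..<h}. Z r) = (of_nat h powr (1 + a) - 1) * zeta (1 + a)"
    unfolding Z_def by (rule sum_hurwitz_zeta_fractions) (use a h in auto)
  finally have dbl: "X + X = (of_nat h powr (1 + a) - 1) * zeta (1 + a) + C * (- (\<Sum>n\<in>{1..<h}. of_real (cot (pi * real n * of_int k' / real h)) * W n) / 2)" .
  have "x = p / 2 - c / 4 * y" if "x + x = p + c * (- y / 2)" for x p c y :: complex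
  proof -
    have "x = (x + x) / 2" by simp
    also have "\<dots> = p / 2 - c / 4 * y" unfolding that by (simp add: add_divide_distrib)
    finally show ?thesis .
  qed
  from this[OF dbl] have "X = (of_nat h powr (1 + a) - 1) * zeta (1 + a) / 2 - C / 4 * (\<Sum>n\<in>{1..<h}. of_real (cot (pi * real n * of_int k' / real h)) * W n)" .
  moreover have "coprime k' (int h)" using inv
    by (metis cong_imp_coprime coprime_1_left coprime_commute coprime_mult_right_iff cong_sym)
  then have "cot_sum a (Fract k' (int h)) = of_nat h powr a * (\<Sum>n\<in>{1..<h}. of_real (cot (pi * real n * of_int k' / real h)) * W n)"
    unfolding W_def by (rule cot_sum_Fract[OF h])
  ultimately show ?thesis unfolding X_def q_def Z_def C_def by (simp add: mult_ac)
qed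

section \<open>The twisted integral as a Parseval integral\<close>

text \<open>Supplies the continuity hypothesis of \<open>fourier_parseval\<close>: jumps occur only
  where \<open>exp u\<close> is an integer. The values of \<open>ln\<close> at nonpositive integers
  merely enlarge the countable cover.\<close>

lemma countable_not_isCont_frac_exp:
  "countable {u. \<not> isCont (\<lambda>u. complex_of_real (frac (exp u)) * exp (- s * of_real u)) u}"
proof (rule countable_subset)
  show "countable (ln ` range real_of_int)" by simp
  show "{u. \<not> isCont (\<lambda>u. complex_of_real (frac (exp u)) * exp (- s * of_real u)) u} \<subseteq> ln ` range real_of_int"
  proof
    fix u assume u: "u \<in> {u. \<not> isCont (\<lambda>u. complex_of_real (frac (exp u)) * exp (- s * of_real u)) u}"
    have "exp u \<in> \<int>"
    proof (rule ccontr)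
      assume "exp u \<notin> \<int>"
      then have "isCont (frac :: real \<Rightarrow> real) (exp u)" by (rule continuous_frac)
      then have "isCont (\<lambda>u. frac (exp u)) u" by (intro isCont_o2[of u exp frac]) auto
      then have "isCont (\<lambda>u. complex_of_real (frac (exp u)) * exp (- s * of_real u)) u"
        by (intro continuous_intros)
      with u show False by simp
    qed
    then obtain i where "exp u = real_of_int i" by (auto elim: Ints_cases)
    then have "u = ln (real_of_int i)" by (metis ln_exp)
    then show "u \<in> ln ` range real_of_int" by auto
  qed
qed

lemma of_nat_quotient_powr:
  assumes "h \<ge> 1" "k \<ge> 1"
  shows "(of_nat h / of_nat k :: complex) powr w = exp (w * of_real (ln (real h) - ln (real k)))"
  using exp_times_ln[of "real h / real k" w] assms by (simp add: ln_div)

text \<open>Both zeta factors have the same real part \<open>1/2 + Re a / 2\<close>, so one function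
  \<open>f\<close> serves for both, transformed at \<open>t\<close> and at \<open>- t\<close>; the
  two minus signs cancel. The power of \<open>h / k\<close> is a character in \<open>t\<close> and
  becomes the translation by \<open>ln h - ln k\<close>.\<close>

lemma twisted_integrand_fourier:
  fixes h k :: nat and a :: complex
  assumes h: "h \<ge> 1" "k \<ge> 1" and a: "\<bar>Re a\<bar> < 1"
  defines "f \<equiv> (\<lambda>u. complex_of_real (frac (exp u)) * exp (- (1/2 + a/2) * of_real u))"
  shows "twisted_integrand h k a = (\<lambda>t. fourier f t * fourier f (- t) * cis (- ((ln (real h) - ln (real k)) * t)))"
    and "integrable lborel (twisted_integrand h k a)"
    and "(LINT t|lborel. twisted_integrand h k a t) = of_real (2 * pi) * ((1 / (of_nat h * of_nat k)) powr (1/2 + a/2) * frac_moment h k a)"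
proof -
  let ?c = "ln (real h) - ln (real k)"
  have F: "fourier f t = - zeta (1/2 + a/2 + \<i> * of_real t) / (1/2 + a/2 + \<i> * of_real t)" for t
  proof -
    have "f u * cis (- (t * u)) = of_real (frac (exp u)) * exp (- (1/2 + a/2 + \<i> * of_real t) * of_real u)" for u
    proof -
      have "exp (- (1/2 + a/2) * of_real u) * exp (\<i> * of_real (- (t * u))) = exp (- (1/2 + a/2 + \<i> * of_real t) * of_real u)"
        unfolding exp_add[symmetric] by (rule arg_cong[of _ _ exp]) (simp add: algebra_simps)
      then show ?thesis unfolding f_def cis_conv_exp mult.assoc by (simp only:)
    qed
    then show ?thesis unfolding fourier_def using a by (subst integral_frac_exp[symmetric]) (auto simp: field_simps)
  qed
  show eq: "twisted_integrand h k a = (\<lambda>t. fourier f t * fourier f (- t) * cis (- (?c * t)))"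
  proof
    fix t
    have "(of_nat h / of_nat k :: complex) powr (- (\<i> * of_real t)) = cis (- (?c * t))"
      unfolding of_nat_quotient_powr[OF h] cis_conv_exp by (simp add: algebra_simps)
    then show "twisted_integrand h k a t = fourier f t * fourier f (- t) * cis (- (?c * t))"
      unfolding twisted_integrand_def F by simp
  qed
  have int: "integrable lborel f" unfolding f_def by (rule integrable_frac_exp) (use a in auto)
  have bd: "norm (f u) \<le> 1" for u
  proof -
    define \<sigma> where "\<sigma> = 1/2 + Re a / 2"
    have \<sigma>: "0 < \<sigma>" "\<sigma> < 1" using a by (auto simp: \<sigma>_def)
    have n: "norm (f u) = frac (exp u) * exp (- (\<sigma> * u))"
      by (simp add: f_def norm_mult \<sigma>_def algebra_simps)
    show ?thesis
    proof (cases "u \<le> 0")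
      case True
      have "norm (f u) \<le> exp u * exp (- (\<sigma> * u))" unfolding n by (intro mult_right_mono frac_nonneg_le) auto
      also have "\<dots> = exp ((1 - \<sigma>) * u)" by (simp add: algebra_simps flip: exp_add)
      also have "\<dots> \<le> 1" using True \<sigma> by (simp add: mult_nonneg_nonpos)
      finally show ?thesis .
    next
      case False
      have "norm (f u) \<le> 1 * exp (- (\<sigma> * u))" unfolding n by (intro mult_right_mono less_imp_le[OF frac_lt_1]) auto
      also have "\<dots> \<le> 1" using False \<sigma> by simp
      finally show ?thesis .
    qed
  qed
  show "integrable lborel (twisted_integrand h k a)"
    unfolding eq by (rule integrable_fourier_product[OF int bd int bd])
  have "(LINT t|lborel. twisted_integrand h k a t) = of_real (2 * pi) * (LINT u|lborel. f u * f (u + ?c))"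
    unfolding eq by (rule fourier_parseval[OF int bd int bd]) (unfold f_def, rule countable_not_isCont_frac_exp)
  \<comment> \<open>Translating by \<open>ln k\<close> makes the integrand symmetric in
    \<open>h\<close> and \<open>k\<close>: \<open>u\<close> becomes \<open>ln k + v\<close>, and
    \<open>u + ?c\<close> becomes \<open>ln h + v\<close>. The powers of \<open>h\<close> and
    \<open>k\<close> come out as the prefactor.\<close>
  also have "(LINT u|lborel. f u * f (u + ?c)) = (LINT v|lborel. f (ln (real k) + 1 * v) * f (ln (real k) + 1 * v + ?c))"
    by (subst lborel_integral_real_affine[of 1 _ "ln (real k)"]) auto
  also have "\<dots> = (LINT v|lborel. (1 / (of_nat h * of_nat k)) powr (1/2 + a/2) * (of_real (frac (real h * exp v) * frac (real k * exp v)) * exp (- (1 + a) * of_real v)))"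
  proof (rule Bochner_Integration.integral_cong[OF refl])
    fix v
    have e: "exp (v + ln (real k)) = real k * exp v" "exp (v + ln (real h)) = real h * exp v" using h by (simp_all add: exp_add)
    have hk: "(1 / (of_nat h * of_nat k) :: complex) powr (1/2 + a/2) = exp ((1/2 + a/2) * of_real (- ln (real h) - ln (real k)))"
      using of_nat_quotient_powr[of 1 "h * k" "1/2 + a/2"] h by (simp add: ln_mult)
    have "f (ln (real k) + 1 * v) * f (ln (real k) + 1 * v + ?c) =
       of_real (frac (real k * exp v) * frac (real h * exp v)) * (exp (- (1/2 + a/2) * of_real (ln (real k) + v)) * exp (- (1/2 + a/2) * of_real (ln (real h) + v)))"
      by (simp add: f_def e add.commute)
    also have "exp (- (1/2 + a/2) * of_real (ln (real k) + v)) * exp (- (1/2 + a/2) * of_real (ln (real h) + v)) =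
       exp ((1/2 + a/2) * of_real (- ln (real h) - ln (real k))) * exp (- (1 + a) * of_real v)"
      unfolding exp_add[symmetric] by (rule arg_cong[of _ _ exp]) (simp add: algebra_simps)
    finally show "f (ln (real k) + 1 * v) * f (ln (real k) + 1 * v + ?c) =
       (1 / (of_nat h * of_nat k)) powr (1/2 + a/2) * (of_real (frac (real h * exp v) * frac (real k * exp v)) * exp (- (1 + a) * of_real v))"
      unfolding hk by (simp add: mult_ac)
  qed
  also have "\<dots> = (1 / (of_nat h * of_nat k)) powr (1/2 + a/2) * frac_moment h k a"
    unfolding frac_moment_def by (rule integral_mult_right_zero)
  finally show "(LINT t|lborel. twisted_integrand h k a t) = of_real (2 * pi) * ((1 / (of_nat h * of_nat k)) powr (1/2 + a/2) * frac_moment h k a)" .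
qed

lemma twisted_moment_eq:
  assumes "h \<ge> 1" "k \<ge> 1" "\<bar>Re a\<bar> < 1"
  shows "twisted_moment h k a = (1 / (of_nat h * of_nat k)) powr (1/2 + a/2) * ((1 + a) * frac_moment h k a)"
  unfolding twisted_moment_def twisted_integrand_fourier(3)[OF assms] by simp

lemma twisted_moment_tendsto_0:
  assumes h: "h \<ge> 1" "k \<ge> 1"
  shows "(twisted_moment h k \<longlongrightarrow> twisted_moment h k 0) (at 0)"
proof -
  have z: "(1 / (of_nat h * of_nat k) :: complex) \<noteq> 0" using h by simp
  have lim: "((\<lambda>a. (1 / (of_nat h * of_nat k)) powr (1/2 + a/2) * ((1 + a) * frac_moment h k a)) \<longlongrightarrow>
     (1 / (of_nat h * of_nat k)) powr (1/2 + 0/2) * ((1 + 0) * frac_moment h k 0)) (at 0)"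
  proof -
    have pw: "(1 / (of_nat h * of_nat k) :: complex) powr w = exp (w * Ln (1 / (of_nat h * of_nat k)))" for w
      using z by (simp add: powr_def)
    show ?thesis unfolding pw
      by (intro tendsto_mult tendsto_exp tendsto_add tendsto_divide tendsto_const tendsto_ident_at frac_moment_tendsto_0 h) auto
  qed
  have "eventually (\<lambda>a::complex. \<bar>Re a\<bar> < 1) (at 0)"
  proof -
    have "eventually (\<lambda>a::complex. a \<in> ball 0 1) (at 0)" by (intro eventually_at_in_open') auto
    then show ?thesis 
    proof eventually_elim
      case (elim a)
      then show ?case using abs_Re_le_cmod[of a] by simp
    qed
  qed
  then have ev: "eventually (\<lambda>a. (1 / (of_nat h * of_nat k)) powr (1/2 + a/2) * ((1 + a) * frac_moment h k a) = twisted_moment h k a) (at 0)"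
    by eventually_elim (rule twisted_moment_eq[OF h, symmetric])
  from Lim_transform_eventually[OF lim ev] show ?thesis using twisted_moment_eq[OF h, of 0] by simp
qed

lemma twisted_moment_eq_moment_formula:
  fixes h k :: nat and h' k' :: int
  assumes h: "h \<ge> 1" "k \<ge> 1" and cop: "coprime h k"
    and inv: "[int h * h' = 1] (mod int k)" "[int k * k' = 1] (mod int h)"
    and a: "\<bar>Re a\<bar> < 1" "a \<noteq> 0"
  shows "twisted_moment h k a = moment_formula h k h' k' a"
proof -
  let ?P = "(1 / (of_nat h * of_nat k) :: complex) powr (1/2 + a/2)"
  define Ch where "Ch = cot_sum a (Fract k' (int h))"
  define Ck where "Ck = cot_sum a (Fract h' (int k))"
  define G where "G = of_real (2 * pi) powr a * Gamma (- a) * sin (of_real pi * a / 2)"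
  have P: "?P = exp ((1/2 + a/2) * of_real (- ln (real h) - ln (real k)))"
    using of_nat_quotient_powr[of 1 "h * k" "1/2 + a/2"] h by (simp add: ln_mult)
  have pw: "of_nat n powr w = exp (w * complex_of_real (ln (real n)))" if "n \<ge> 1" for n w
    using exp_times_ln[of "real n" w] that by simp
  have 1: "?P * of_nat h powr (1 + a) = (of_nat h / of_nat k) powr (1/2 + a/2)"
          "?P * of_nat k powr (1 + a) = (of_nat k / of_nat h) powr (1/2 + a/2)"
    unfolding P pw[OF h(1)] pw[OF h(2)] of_nat_quotient_powr[OF h] of_nat_quotient_powr[OF h(2) h(1)] exp_add[symmetric]
    by (rule arg_cong[of _ _ exp], simp add: field_simps)+
  have 2: "?P * (of_nat h * of_nat k powr a) = (of_nat h / of_nat k) powr (1/2 - a/2)"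
          "?P * (of_nat k * of_nat h powr a) = (of_nat k / of_nat h) powr (1/2 - a/2)"
  proof -
    have n: "of_nat n = exp (1 * complex_of_real (ln (real n)))" if "n \<ge> 1" for n
      using pw[OF that, of 1] that by simp
    show "?P * (of_nat h * of_nat k powr a) = (of_nat h / of_nat k) powr (1/2 - a/2)"
         "?P * (of_nat k * of_nat h powr a) = (of_nat k / of_nat h) powr (1/2 - a/2)"
      unfolding P pw[OF h(1)] pw[OF h(2)] of_nat_quotient_powr[OF h] of_nat_quotient_powr[OF h(2) h(1)]
      by (subst n[OF h(1)], unfold exp_add[symmetric], rule arg_cong[of _ _ exp], simp add: field_simps)
         (subst n[OF h(2)], unfold exp_add[symmetric], rule arg_cong[of _ _ exp], simp add: field_simps)
  qed
  have "(1 + a) * frac_moment h k a = - (of_nat h * of_nat k powr a + of_nat k * of_nat h powr a) * zeta a / a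
     - ((of_nat h powr (1 + a) - 1) * zeta (1 + a) / 2 + G * Ch) - ((of_nat k powr (1 + a) - 1) * zeta (1 + a) / 2 + G * Ck) - zeta (1 + a)"
    unfolding frac_moment_eq[OF a h cop] sum_frac_hurwitz_zeta[OF a h(1) cop inv(2)]
      sum_frac_hurwitz_zeta[OF a h(2) coprime_commute[THEN iffD1, OF cop] inv(1)] G_def Ch_def Ck_def ..
  \<comment> \<open>The two \<open>- 1\<close> in the residue sums contribute
    \<open>zeta (1 + a)\<close> in total and cancel the final \<open>- zeta (1 + a)\<close>.\<close>
  also have "\<dots> = - (zeta (1 + a) / 2) * (of_nat k powr (1 + a) + of_nat h powr (1 + a))
     - zeta a / a * (of_nat k * of_nat h powr a + of_nat h * of_nat k powr a) - G * (Ck + Ch)"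
    by (simp add: algebra_simps diff_divide_distrib add_divide_distrib)
  finally have "twisted_moment h k a = ?P * (- (zeta (1 + a) / 2) * (of_nat k powr (1 + a) + of_nat h powr (1 + a))
     - zeta a / a * (of_nat k * of_nat h powr a + of_nat h * of_nat k powr a) - G * (Ck + Ch))"
    using twisted_moment_eq[OF h a(1)] by simp
  also have "\<dots> = - (zeta (1 + a) / 2) * (?P * of_nat k powr (1 + a) + ?P * of_nat h powr (1 + a))
     - zeta a / a * (?P * (of_nat k * of_nat h powr a) + ?P * (of_nat h * of_nat k powr a)) - ?P * G * (Ck + Ch)"
    by (simp only: algebra_simps)
  also have "\<dots> = moment_formula h k h' k' a"
    unfolding 1 2 moment_formula_def G_def Ch_def Ck_def by (simp add: mult.assoc)
  finally show ?thesis .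
qed

text \<open>Integrability is asserted separately because \<open>LINT\<close> of a non-integrable
  function is 0 by convention. At \<open>a = 0\<close> the formula is meaningful only as a limit:
  single terms have poles there, and what HOL assigns to them at 0 are default values.\<close>

theorem theorem5:
  fixes h k :: nat and h' k' :: int and a :: complex
  assumes "h \<ge> 1" and "k \<ge> 1" and "coprime h k"
    and "[int h * h' = 1] (mod int k)" and "[int k * k' = 1] (mod int h)"
    and "\<bar>Re a\<bar> < 1"
  shows "integrable lborel (twisted_integrand h k a) \<and>
    (a \<noteq> 0 \<longrightarrow> twisted_moment h k a = moment_formula h k h' k' a) \<and>
    (a = 0 \<longrightarrow> (moment_formula h k h' k' \<longlongrightarrow> twisted_moment h k 0) (at 0))"
proof (intro conjI impI)
  show "integrable lborel (twisted_integrand h k a)"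
    using assms by (intro twisted_integrand_fourier(2))
  show "twisted_moment h k a = moment_formula h k h' k' a" if "a \<noteq> 0"
    using assms that by (intro twisted_moment_eq_moment_formula)
  show "(moment_formula h k h' k' \<longlongrightarrow> twisted_moment h k 0) (at 0)"
  proof (rule Lim_transform_eventually[OF twisted_moment_tendsto_0[OF assms(1,2)]])
    have "eventually (\<lambda>a::complex. a \<in> ball 0 1 - {0}) (at 0)" by (intro eventually_at_in_open) auto
    then show "eventually (\<lambda>a. twisted_moment h k a = moment_formula h k h' k' a) (at 0)"
    proof eventually_elim
      case (elim a)
      then have "\<bar>Re a\<bar> < 1" "a \<noteq> 0" using abs_Re_le_cmod[of a] by auto
      then show ?case using assms by (intro twisted_moment_eq_moment_formula)
    qed
  qed
qed

end
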